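(* The global asymptotic-stability decision problem (given an MPC instance, decide whether the origin of its closed loop is globally asymptotically stable) is undecidable already for rational horizon-one ($N=1$) linear MPC instances with fixed state dimension $n_x=3$, fixed input dimension $n_u=6$, weights $Q=I_3$, $R=I_6$, $P=I_3$, and with the only inequality constraints being finitely many rational mixed state-input linear inequalities on $(x_{0|k},u_{0|k})$, the number of which is part of the instance. Moreover, this holds already for those instances of this class whose quadratic program has a unique optimizer and is feasible for every current state $x_k\in\mathbb{R}^3$ (so that, in particular, recursive feasibility is automatic).
   Context: A rational horizon-one linear MPC instance of the kind considered consists of a linear plant $x_{k+1}=Fx_k+Gu_k$ with rational matrices $F\in\mathbb{Q}^{n_x\times n_x}$, $G\in\mathbb{Q}^{n_x\times n_u}$, weights $Q\succeq0$, $R\succ0$, $P\succeq0$, and a set $\mathcal Z\subseteq\mathbb{R}^{n_x+n_u}$ defined by finitely many rational linear inequalities and containing $(0,0)$. At state $x_k$ the controller solves $$\min\ x_{0|k}^{\mathsf T}Qx_{0|k}+u_{0|k}^{\mathsf T}Ru_{0|k}+x_{1|k}^{\mathsf T}Px_{1|k}$$ subject to $x_{0|k}=x_k$, $x_{1|k}=Fx_{0|k}+Gu_{0|k}$, $(x_{0|k},u_{0|k})\in\mathcal Z$ (no terminal constraint). The closed loop is $x_{k+1}=Fx_k+Gu_{0|k}^\star(x_k)$, where $u_{0|k}^\star(x_k)$ is the optimal input. When the problem is feasible for every state, the origin is globally asymptotically stable if it is Lyapunov stable and every closed-loop trajectory converges to the origin. (In general, stability is understood relative to the set of feasible states: every trajectory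 initialized in that set remains in it and converges to the origin, and the origin is Lyapunov stable relative to it.) Recursive feasibility means that the closed loop maps feasible states to feasible states. Undecidability for a class of instances means that there is no algorithm which, on every instance in the class (encoded by its rational data in binary), terminates and answers correctly. *)

theory Defs
  imports "HOL-Analysis.Analysis"
begin

section \<open>Algorithms: partial recursive functions\<close>

text \<open>
  Algorithms are the partial recursive functions.  In a primitive recursion the first
  argument is the recursion argument, and in \<^term>\<open>g (n # r # xs)\<close> the value \<open>r\<close> is the
  previous value; minimisation is over the first argument.  Arities are not recorded:
  an ill-formed application simply has no value.
\<close>

datatype recf =
    Zero
  | Succ
  | Proj nat
  | Comp recf "recf list"
  | PrimRec recf recf
  | Minim recf

inductive computes :: "recf \<Rightarrow> nat list \<Rightarrow> nat \<Rightarrow> bool" where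
  zero: "computes Zero xs 0"
| succ: "computes Succ [x] (Suc x)"
| proj: "i < length xs \<Longrightarrow> computes (Proj i) xs (xs ! i)"
| comp: "\<lbrakk>list_all2 (\<lambda>g y. computes g xs y) gs ys; computes f ys z\<rbrakk>
    \<Longrightarrow> computes (Comp f gs) xs z"
| prim_0: "computes f xs y \<Longrightarrow> computes (PrimRec f g) (0 # xs) y"
| prim_Suc: "\<lbrakk>computes (PrimRec f g) (n # xs) r; computes g (n # r # xs) y\<rbrakk>
    \<Longrightarrow> computes (PrimRec f g) (Suc n # xs) y"
| minim: "\<lbrakk>computes f (n # xs) 0; \<forall>m<n. \<exists>y>0. computes f (m # xs) y\<rbrakk>
    \<Longrightarrow> computes (Minim f) xs n"

lemma computes_deterministic:
  "computes f xs y \<Longrightarrow> computes f xs z \<Longrightarrow> y = z"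
proof (induction f xs y arbitrary: z rule: computes.induct)
  case (comp xs gs ys f w)
  from comp.prems obtain ys' where
    ys': "list_all2 (\<lambda>g y. computes g xs y) gs ys'" "computes f ys' z"
    by (auto elim: computes.cases)
  have "ys = ys'"
  proof (rule nth_equalityI)
    show "length ys = length ys'"
      using comp.IH(1) ys'(1) by (auto dest!: list_all2_lengthD)
    show "ys ! i = ys' ! i" if "i < length ys" for i
      using comp.IH(1) ys'(1) that by (auto simp: list_all2_conv_all_nth)
  qed
  then show ?case using comp.IH(2) ys'(2) by blast
next
  case (prim_0 f xs y g)
  from prim_0.prems show ?case by (cases rule: computes.cases) (auto intro: prim_0.IH)
next
  case (prim_Suc f g n xs r y)
  from prim_Suc.prems obtain r' where
    "computes (PrimRec f g) (n # xs) r'" "computes g (n # r' # xs) z"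
    by (auto elim: computes.cases)
  then show ?case using prim_Suc.IH by blast
next
  case (minim f n xs)
  from minim.prems have z: "computes f (z # xs) 0" "\<forall>m<z. \<exists>y>0. computes f (m # xs) y"
    by (auto elim: computes.cases)
  have "\<not> n < z" using minim.IH(1) z(2) by fastforce
  moreover have "\<not> z < n" using minim.IH(2) z(1) by fastforce
  ultimately show ?case by simp
qed (auto elim: computes.cases)

text \<open>
  A binary word is passed to a recursive function as the number whose binary expansion
  (least significant digit first) is the word followed by a leading digit 1.
\<close>

definition word_number :: "bool list \<Rightarrow> nat" where
  "word_number w = horner_sum of_bool 2 (w @ [True])"

text \<open>
  The algorithm has to halt with the correct answer (1 for yes, 0 for no) on the
  instances in \<open>C\<close>; nothing is required on any other input.
\<close>

definition decidable_on :: "('i \<Rightarrow> bool list) \<Rightarrow> 'i set \<Rightarrow> ('i \<Rightarrow> bool) \<Rightarrow> bool" where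
  "decidable_on encode C p \<longleftrightarrow>
    (\<exists>f. \<forall>I\<in>C. computes f [word_number (encode I)] (if p I then 1 else 0))"


section \<open>Rational horizon-one linear MPC\<close>

text \<open>
  An entry \<open>(a, b, c)\<close> of \<open>inequalities\<close> is the mixed state-input constraint
  \<open>a\<^sup>T x + b\<^sup>T u \<le> c\<close>.
\<close>

record ('n::finite, 'm::finite) mpc =
  plant_F :: "rat^'n^'n"
  plant_G :: "rat^'m^'n"
  weight_Q :: "rat^'n^'n"
  weight_R :: "rat^'m^'m"
  weight_P :: "rat^'n^'n"
  inequalities :: "((rat^'n) \<times> (rat^'m) \<times> rat) list"

abbreviation real_vec :: "rat^'n \<Rightarrow> real^'n" where
  "real_vec v \<equiv> (\<chi> i. of_rat (v $ i))"

abbreviation real_mat :: "rat^'n^'m \<Rightarrow> real^'n^'m" where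
  "real_mat A \<equiv> map_matrix of_rat A"

definition pos_semidef :: "real^'n^'n \<Rightarrow> bool" where
  "pos_semidef A \<longleftrightarrow> transpose A = A \<and> (\<forall>v. 0 \<le> v \<bullet> (A *v v))"

definition pos_def :: "real^'n^'n \<Rightarrow> bool" where
  "pos_def A \<longleftrightarrow> transpose A = A \<and> (\<forall>v. v \<noteq> 0 \<longrightarrow> 0 < v \<bullet> (A *v v))"

definition constraint_set :: "('n::finite, 'm::finite) mpc \<Rightarrow> ((real^'n) \<times> (real^'m)) set" where
  "constraint_set I =
    {(x, u). \<forall>(a, b, c) \<in> set (inequalities I). real_vec a \<bullet> x + real_vec b \<bullet> u \<le> of_rat c}"

definition mpc_instance :: "('n::finite, 'm::finite) mpc \<Rightarrow> bool" where
  "mpc_instance I \<longleftrightarrow>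
    pos_semidef (real_mat (weight_Q I)) \<and>
    pos_def (real_mat (weight_R I)) \<and>
    pos_semidef (real_mat (weight_P I)) \<and>
    (0, 0) \<in> constraint_set I"

definition plant :: "('n::finite, 'm::finite) mpc \<Rightarrow> real^'n \<Rightarrow> real^'m \<Rightarrow> real^'n" where
  "plant I x u = real_mat (plant_F I) *v x + real_mat (plant_G I) *v u"

text \<open>The decision variables are the triples \<open>(x0, u0, x1)\<close>.\<close>

definition mpc_cost ::
    "('n::finite, 'm::finite) mpc \<Rightarrow> (real^'n) \<times> (real^'m) \<times> (real^'n) \<Rightarrow> real" where
  "mpc_cost I = (\<lambda>(x0, u0, x1).
    x0 \<bullet> (real_mat (weight_Q I) *v x0) +
    u0 \<bullet> (real_mat (weight_R I) *v u0) +
    x1 \<bullet> (real_mat (weight_P I) *v x1))"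

definition mpc_feasible ::
    "('n::finite, 'm::finite) mpc \<Rightarrow> real^'n \<Rightarrow> (real^'n) \<times> (real^'m) \<times> (real^'n) \<Rightarrow> bool" where
  "mpc_feasible I x = (\<lambda>(x0, u0, x1).
    x0 = x \<and> x1 = plant I x0 u0 \<and> (x0, u0) \<in> constraint_set I)"

definition mpc_optimizer ::
    "('n::finite, 'm::finite) mpc \<Rightarrow> real^'n \<Rightarrow> (real^'n) \<times> (real^'m) \<times> (real^'n) \<Rightarrow> bool" where
  "mpc_optimizer I x = is_arg_min (mpc_cost I) (mpc_feasible I x)"

definition feasible_states :: "('n::finite, 'm::finite) mpc \<Rightarrow> (real^'n) set" where
  "feasible_states I = {x. \<exists>z. mpc_feasible I x z}"

text \<open>
  At a feasible state of an \<^const>\<open>mpc_instance\<close> the optimal input exists and is unique,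
  since the input weight is positive definite and the constraint set is a polyhedron.
\<close>

definition optimal_input :: "('n::finite, 'm::finite) mpc \<Rightarrow> real^'n \<Rightarrow> real^'m" where
  "optimal_input I x = (THE u0. \<exists>x0 x1. mpc_optimizer I x (x0, u0, x1))"

definition closed_loop :: "('n::finite, 'm::finite) mpc \<Rightarrow> real^'n \<Rightarrow> real^'n" where
  "closed_loop I x = plant I x (optimal_input I x)"

definition recursively_feasible :: "('n::finite, 'm::finite) mpc \<Rightarrow> bool" where
  "recursively_feasible I \<longleftrightarrow> closed_loop I ` feasible_states I \<subseteq> feasible_states I"

definition lyapunov_stable :: "('n::finite, 'm::finite) mpc \<Rightarrow> bool" where
  "lyapunov_stable I \<longleftrightarrow>
    (\<forall>\<epsilon>>0. \<exists>\<delta>>0. \<forall>x\<in>feasible_states I.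
      norm x < \<delta> \<longrightarrow> (\<forall>k. norm ((closed_loop I ^^ k) x) < \<epsilon>))"

text \<open>
  Stability is relative to the set of feasible states; if that set is the whole space,
  this is global asymptotic stability in the usual sense.
\<close>

definition globally_asymptotically_stable :: "('n::finite, 'm::finite) mpc \<Rightarrow> bool" where
  "globally_asymptotically_stable I \<longleftrightarrow>
    lyapunov_stable I \<and>
    (\<forall>x\<in>feasible_states I.
      (\<forall>k. (closed_loop I ^^ k) x \<in> feasible_states I) \<and>
      (\<lambda>k. (closed_loop I ^^ k) x) \<longlonglongrightarrow> 0)"


section \<open>Binary encoding of instances\<close>

fun binary_digits :: "nat \<Rightarrow> bool list" where
  "binary_digits n = (if n = 0 then [] else odd n # binary_digits (n div 2))"

declare binary_digits.simps [simp del]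

lemma horner_sum_binary_digits: "horner_sum of_bool 2 (binary_digits n) = n"
proof (induction n rule: binary_digits.induct)
  case (1 n)
  show ?case
  proof (cases "n = 0")
    case True
    then show ?thesis by (simp add: binary_digits.simps)
  next
    case False
    have "horner_sum of_bool 2 (binary_digits n) =
        of_bool (odd n) + 2 * horner_sum of_bool 2 (binary_digits (n div 2))"
      using False by (subst binary_digits.simps) simp
    also have "\<dots> = n mod 2 + 2 * (n div 2)"
      using 1 False by (simp add: mod_2_eq_odd)
    finally show ?thesis by simp
  qed
qed

text \<open>
  Self-delimiting words: every binary digit is preceded by the marker \<^const>\<open>True\<close>, and the
  end of the number is marked by \<^const>\<open>False\<close>.
\<close>

definition nat_word :: "nat \<Rightarrow> bool list" where
  "nat_word n = concat (map (\<lambda>d. [True, d]) (binary_digits n)) @ [False]"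

definition rat_word :: "rat \<Rightarrow> bool list" where
  "rat_word r = (case quotient_of r of (p, q) \<Rightarrow>
    (p < 0) # nat_word (nat \<bar>p\<bar>) @ nat_word (nat q))"

definition vec_word :: "rat^'n::enum \<Rightarrow> bool list" where
  "vec_word v = concat (map (\<lambda>i. rat_word (v $ i)) enum_class.enum)"

definition mat_word :: "rat^'n::enum^'m::enum \<Rightarrow> bool list" where
  "mat_word A = concat (map (\<lambda>i. vec_word (A $ i)) enum_class.enum)"

definition inequality_word :: "(rat^'n::enum) \<times> (rat^'m::enum) \<times> rat \<Rightarrow> bool list" where
  "inequality_word = (\<lambda>(a, b, c). vec_word a @ vec_word b @ rat_word c)"

definition mpc_word :: "('n::enum, 'm::enum) mpc \<Rightarrow> bool list" where
  "mpc_word I =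
    mat_word (plant_F I) @ mat_word (plant_G I) @
    mat_word (weight_Q I) @ mat_word (weight_R I) @ mat_word (weight_P I) @
    nat_word (length (inequalities I)) @ concat (map inequality_word (inequalities I))"

text \<open>All encodings are uniquely readable; in particular distinct instances have distinct codes.\<close>

lemma word_number_simps:
  "word_number [] = 1"
  "word_number (b # w) = of_bool b + 2 * word_number w"
  by (simp_all add: word_number_def)

lemma word_number_pos: "word_number w > 0"
  by (induction w) (simp_all add: word_number_simps)

lemma word_number_inject: "word_number v = word_number w \<longleftrightarrow> v = w"
proof
  show "word_number v = word_number w \<Longrightarrow> v = w"
  proof (induction v arbitrary: w)
    case Nil
    show ?case
    proof (cases w)
      case (Cons b w')
      then show ?thesis
        using Nil word_number_pos[of w'] by (simp add: word_number_simps)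
    qed simp
  next
    case (Cons a v)
    show ?case
    proof (cases w)
      case Nil
      then show ?thesis
        using Cons.prems word_number_pos[of v] by (simp add: word_number_simps)
    next
      case (Cons b w')
      with Cons.prems have
        eq: "of_bool a + 2 * word_number v = of_bool b + 2 * word_number w'"
        by (simp add: word_number_simps)
      have "even (of_bool a + 2 * word_number v) = even (of_bool b + 2 * word_number w')"
        by (simp only: eq)
      then have "a = b" by (cases a; cases b) simp_all
      with eq Cons.IH[of w'] Cons show ?thesis by simp
    qed
  qed
qed simp

lemma nat_word_append_inject:
  "nat_word m @ v = nat_word n @ w \<longleftrightarrow> m = n \<and> v = w"
proof
  have digits: "ds = es \<and> v = w"
    if "concat (map (\<lambda>d. [True, d]) ds) @ False # v = concat (map (\<lambda>d. [True, d]) es) @ False # w"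
    for ds es and v w :: "bool list"
    using that
  proof (induction ds arbitrary: es)
    case Nil then show ?case by (cases es) auto
  next
    case (Cons d ds) then show ?case by (cases es) auto
  qed
  assume "nat_word m @ v = nat_word n @ w"
  then have *: "binary_digits m = binary_digits n \<and> v = w"
    by (intro digits) (simp add: nat_word_def)
  then have "(horner_sum of_bool 2 (binary_digits m) :: nat) = horner_sum of_bool 2 (binary_digits n)"
    by simp
  then have "m = n"
    unfolding horner_sum_binary_digits .
  with * show "m = n \<and> v = w" by blast
qed auto

lemma rat_word_append_inject:
  "rat_word r @ v = rat_word s @ w \<longleftrightarrow> r = s \<and> v = w"
proof
  assume eq: "rat_word r @ v = rat_word s @ w"
  obtain p q where r: "quotient_of r = (p, q)" by fastforce
  obtain p' q' where s: "quotient_of s = (p', q')" by fastforce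
  have pos: "q > 0" "q' > 0" using r s by (auto dest: quotient_of_denom_pos)
  from eq have "(p < 0) = (p' < 0)" "nat \<bar>p\<bar> = nat \<bar>p'\<bar>" "nat q = nat q'" "v = w"
    by (simp_all add: rat_word_def r s nat_word_append_inject)
  then have "p = p'" "q = q'" "v = w" using pos by linarith+
  then show "r = s \<and> v = w" using quotient_of_inject[of r s] r s by simp
qed auto

lemma concat_map_append_inject:
  assumes "\<And>x y v w. x \<in> A \<Longrightarrow> y \<in> A \<Longrightarrow> f x @ v = f y @ w \<longleftrightarrow> x = y \<and> v = (w :: 'b list)"
    and "length xs = length ys" "set xs \<subseteq> A" "set ys \<subseteq> A"
  shows "concat (map f xs) @ v = concat (map f ys) @ w \<longleftrightarrow> xs = ys \<and> v = w"
  using assms(2-4)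
proof (induction xs ys rule: list_induct2)
  case (Cons x xs y ys)
  then show ?case using assms(1)[of x y] by auto
qed simp

lemma vec_word_append_inject:
  "vec_word a @ v = vec_word b @ w \<longleftrightarrow> a = b \<and> v = w"
proof -
  have "vec_word a @ v = vec_word b @ w \<longleftrightarrow>
      map (($) a) enum_class.enum = map (($) b) enum_class.enum \<and> v = w"
    unfolding vec_word_def
    using concat_map_append_inject[of UNIV rat_word "map (($) a) enum_class.enum"
        "map (($) b) enum_class.enum" v w]
    by (simp add: rat_word_append_inject o_def)
  then show ?thesis by (auto simp: vec_eq_iff UNIV_enum[symmetric])
qed

lemma mat_word_append_inject:
  "mat_word A @ v = mat_word B @ w \<longleftrightarrow> A = B \<and> v = w"
proof -
  have "mat_word A @ v = mat_word B @ w \<longleftrightarrow>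
      map (($) A) enum_class.enum = map (($) B) enum_class.enum \<and> v = w"
    unfolding mat_word_def
    using concat_map_append_inject[of UNIV vec_word "map (($) A) enum_class.enum"
        "map (($) B) enum_class.enum" v w]
    by (simp add: vec_word_append_inject o_def)
  then show ?thesis by (auto simp: vec_eq_iff UNIV_enum[symmetric])
qed

lemma mat_word_inject: "mat_word A = mat_word B \<longleftrightarrow> A = B"
  using mat_word_append_inject[of A "[]" B "[]"] by simp

lemma inequality_word_append_inject:
  "inequality_word p @ v = inequality_word q @ w \<longleftrightarrow> p = q \<and> v = w"
  by (cases p; cases q)
    (auto simp: inequality_word_def vec_word_append_inject rat_word_append_inject)

lemma mpc_word_inject: "mpc_word I = mpc_word J \<longleftrightarrow> I = J"
proof
  assume eq: "mpc_word I = mpc_word J"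
  then have len: "length (inequalities I) = length (inequalities J)"
    by (simp add: mpc_word_def mat_word_append_inject nat_word_append_inject)
  have "inequalities I = inequalities J"
    using eq concat_map_append_inject[OF _ len, of UNIV inequality_word "[]" "[]"]
    by (simp add: mpc_word_def mat_word_append_inject nat_word_append_inject
        inequality_word_append_inject)
  with eq have "plant_F I = plant_F J \<and> plant_G I = plant_G J \<and> weight_Q I = weight_Q J \<and>
      weight_R I = weight_R J \<and> weight_P I = weight_P J"
    by (simp add: mpc_word_def mat_word_append_inject mat_word_inject)
  with \<open>inequalities I = inequalities J\<close> show "I = J"
    by (simp add: mpc.equality)
qed simp


section \<open>The two classes of instances\<close>

definition identity_weight_instances :: "(3, 6) mpc set" where
  "identity_weight_instances =
    {I. mpc_instance I \<and> weight_Q I = mat 1 \<and> weight_R I = mat 1 \<and> weight_P I = mat 1}"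

definition everywhere_feasible_instances :: "(3, 6) mpc set" where
  "everywhere_feasible_instances =
    {I \<in> identity_weight_instances.
      feasible_states I = UNIV \<and> (\<forall>x. \<exists>!z. mpc_optimizer I x z)}"

end

(*
  Every continuous piecewise affine map f of R^3 with f 0 = 0 is a closed loop of the required form:
  write its coordinates as differences g - h of maxima of affine functions, add a multiple of the
  1-norm to both, and take the constraints g <= u, h <= v with F = 0 and u - v as the next state; the
  optimal inputs are then u = g and v = h.

  Two coordinates of such a map simulate a two-counter machine, the third is fuel, spent at rate one
  and gained only where the machine has halted and is restarted from its initial configuration exactly.
  If the machine halts, then a large amount of fuel is recovered in every cycle and the origin is not
  attractive; if it does not halt, every trajectory, including those that do not encode a configuration,
  runs out of fuel and reaches the origin.  The counters are 2^b and 2^-a in homogeneous coordinates, so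
  that gluing the finitely many rules costs only Lipschitz continuity.

  The input N of the machine enters a single inequality, through 2^N, so its code as a function of N is
  elementary.  Undecidability is a diagonal argument: a machine that is given the constants of its own
  code computes that code, asks the supposed decision procedure, and halts iff the answer is "stable".
*)

theory Submission
  imports Defs "HOL-Computational_Algebra.Primes" "HOL-Library.Infinite_Set"
begin

section \<open>Loop programs\<close>

text \<open>A reduction from halting would need the map from machines to instances to be recursive,
  decompositions into maxima of affine functions included. The diagonal argument avoids this: the
  machine is fixed first, and the constants describing its family of instances need only exist. The
  family varies in one right-hand side \<open>D * 2 ^ N + e\<close>, and binary digits turn this
  into an affine function of an iterate of \<open>1 + 4 * v\<close>. The constants are stored as
  prime exponents in \<open>N\<close>. Freezing everything but one number shapes the rest in two
  ways. The number can act only as a cap on the first coordinate, so the machine loads its input by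
  doubling until it meets the cap; for the cap to be a single inequality, one affine piece must
  agree with a convex part wherever loading may end, for all large \<open>N\<close> at once. And the
  fuel gained at a halt has coefficients that do not know \<open>N\<close>, although it must pay for
  a cycle whose length depends on \<open>N\<close>. The clock prime serves this purpose: the running
  time is at most quadratic in the final code \<open>n\<close>, while the first coordinate is then
  \<open>2 ^ n\<close>.\<close>

datatype instr = Inc nat | Loop nat "instr list"

instance instr :: countable
  by countable_datatype

type_synonym store = "nat \<Rightarrow> nat"

fun lstep :: "instr list \<times> store \<Rightarrow> instr list \<times> store" where
  "lstep ([], s) = ([], s)"
| "lstep (Inc r # k, s) = (k, s(r := Suc (s r)))"
| "lstep (Loop r B # k, s) =
    (if s r = 0 then (k, s) else (B @ Loop r B # k, s(r := s r - 1)))"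

text \<open>Quantifying over the continuation \<open>k\<close> makes runs composable and usable
  inside loop bodies.\<close>

definition runs :: "instr list \<Rightarrow> store \<Rightarrow> store \<Rightarrow> bool" where
  "runs P s s' \<longleftrightarrow> (\<forall>k. \<exists>n. (lstep ^^ n) (P @ k, s) = (k, s'))"

definition halts :: "instr list \<Rightarrow> store \<Rightarrow> bool" where
  "halts P s \<longleftrightarrow> (\<exists>n. fst ((lstep ^^ n) (P, s)) = [])"

lemma runs_Nil: "runs [] s s"
  unfolding runs_def by (auto intro: exI[of _ 0])

lemma runs_append:
  assumes "runs P s s1" "runs Q s1 s2"
  shows "runs (P @ Q) s s2"
  unfolding runs_def
proof
  fix k
  obtain m where m: "(lstep ^^ m) (P @ Q @ k, s) = (Q @ k, s1)"
    using assms(1) unfolding runs_def by blast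
  obtain n where n: "(lstep ^^ n) (Q @ k, s1) = (k, s2)"
    using assms(2) unfolding runs_def by blast
  have "(lstep ^^ (n + m)) ((P @ Q) @ k, s) = (k, s2)"
    using m n by (simp add: funpow_add)
  then show "\<exists>n. (lstep ^^ n) ((P @ Q) @ k, s) = (k, s2)" ..
qed

lemma runs_Cons:
  assumes "runs [i] s s1" "runs Q s1 s2"
  shows "runs (i # Q) s s2"
  using runs_append[OF assms] by simp

lemma runs_Inc: "runs [Inc r] s (s(r := Suc (s r)))"
  unfolding runs_def by (auto intro: exI[of _ 1])

lemma runs_Loop_0: "s r = 0 \<Longrightarrow> runs [Loop r B] s s"
  unfolding runs_def by (auto intro: exI[of _ 1])

text \<open>Body and remaining loop form one run here because the induction for minimisation starts
  in the middle of the body.\<close>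

lemma runs_Loop_unfold:
  assumes "s r \<noteq> 0" "runs (B @ [Loop r B]) (s(r := s r - 1)) s2"
  shows "runs [Loop r B] s s2"
  unfolding runs_def
proof
  fix k
  obtain m where m: "(lstep ^^ m) ((B @ [Loop r B]) @ k, s(r := s r - 1)) = (k, s2)"
    using assms(2) unfolding runs_def by blast
  have "(lstep ^^ (m + 1)) ([Loop r B] @ k, s) = (k, s2)"
    using m assms(1) by (simp add: funpow_add funpow_swap1)
  then show "\<exists>n. (lstep ^^ n) ([Loop r B] @ k, s) = (k, s2)" ..
qed

lemma runs_Loop_Suc:
  assumes "s r \<noteq> 0" "runs B (s(r := s r - 1)) s1" "runs [Loop r B] s1 s2"
  shows "runs [Loop r B] s s2"
  using assms(1) runs_append[OF assms(2,3)] by (rule runs_Loop_unfold)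

lemma runs_clear: "runs [Loop r []] s (s(r := 0))"
proof (induction "s r" arbitrary: s)
  case 0
  then have "s(r := 0) = s" by auto
  then show ?case using runs_Loop_0[of s r "[]"] 0 by simp
next
  case (Suc n)
  from Suc(2) have "runs [Loop r []] (s(r := n)) (s(r := n, r := 0))"
    by (intro Suc(1)) simp
  moreover have "s r - 1 = n" "s r \<noteq> 0" using Suc(2) by simp_all
  ultimately show ?case
    using runs_Loop_Suc[of s r "[]" "s(r := n)" "s(r := 0)"] runs_Nil by simp
qed

section \<open>Compilation of partial recursive functions into loop programs\<close>

definition copy :: "nat \<Rightarrow> nat \<Rightarrow> nat \<Rightarrow> instr list" where
  "copy a b t = [Loop b [], Loop t [], Loop a [Inc b, Inc t], Loop t [Inc a]]"

lemma runs_copy: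
  assumes "distinct [a, b, t]"
  shows "runs (copy a b t) s (s(b := s a, t := 0))"
proof -
  have 1: "runs [Loop a [Inc b, Inc t]] s (s(a := 0, b := s b + s a, t := s t + s a))" for s
  proof (induction "s a" arbitrary: s)
    case 0
    then have "s(a := 0, b := s b + s a, t := s t + s a) = s" by auto
    then show ?case using runs_Loop_0[of s a] 0 by metis
  next
    case (Suc n)
    let ?s = "s(a := n, b := Suc (s b), t := Suc (s t))"
    have n: "s a - 1 = n" using Suc(2) by simp
    have B: "runs [Inc b, Inc t] (s(a := s a - 1)) ?s"
      using runs_Cons[OF runs_Inc runs_Inc, of b t "s(a := n)"] assms
      unfolding n by simp
    have "runs [Loop a [Inc b, Inc t]] ?s (?s(a := 0, b := ?s b + ?s a, t := ?s t + ?s a))"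
      using assms by (intro Suc(1)) simp
    also have "?s(a := 0, b := ?s b + ?s a, t := ?s t + ?s a) = s(a := 0, b := s b + s a, t := s t + s a)"
      using assms Suc(2) by auto
    finally show ?case using runs_Loop_Suc[OF _ B] Suc(2) by (metis nat.distinct(1))
  qed
  have 2: "runs [Loop t [Inc a]] s (s(a := s a + s t, t := 0))" for s
  proof (induction "s t" arbitrary: s)
    case 0
    then have "s(a := s a + s t, t := 0) = s" by auto
    then show ?case using runs_Loop_0[of s t] 0 by metis
  next
    case (Suc n)
    let ?s = "s(a := Suc (s a), t := n)"
    have n: "s t - 1 = n" using Suc(2) by simp
    have B: "runs [Inc a] (s(t := s t - 1)) ?s"
      using runs_Inc[of a "s(t := n)"] assms
      unfolding n by (simp add: fun_upd_twist)
    have "runs [Loop t [Inc a]] ?s (?s(a := ?s a + ?s t, t := 0))"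
      using assms by (intro Suc(1)) simp
    also have "?s(a := ?s a + ?s t, t := 0) = s(a := s a + s t, t := 0)"
      using assms Suc(2) by auto
    finally show ?case using runs_Loop_Suc[OF _ B] Suc(2) by (metis nat.distinct(1))
  qed
  let ?s2 = "s(b := 0, t := 0)"
  let ?s3 = "?s2(a := 0, b := ?s2 b + ?s2 a, t := ?s2 t + ?s2 a)"
  have "runs (copy a b t) s (?s3(a := ?s3 a + ?s3 t, t := 0))"
    unfolding copy_def by (intro runs_Cons[OF runs_clear] runs_Cons[OF 1] 2)
  also have "?s3(a := ?s3 a + ?s3 t, t := 0) = s(b := s a, t := 0)"
    using assms by auto
  finally show ?thesis .
qed

text \<open>Registers from \<open>t\<close> on are scratch: they may hold anything before and after
  the run. Nothing is claimed where \<open>f\<close> has no value, which suffices since the decision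
  procedure is only consulted on an instance where it must answer.\<close>

definition implements :: "instr list \<Rightarrow> recf \<Rightarrow> nat list \<Rightarrow> nat \<Rightarrow> nat \<Rightarrow> bool" where
  "implements P f args out t \<longleftrightarrow>
    (\<forall>s y. computes f (map s args) y \<longrightarrow>
      (\<exists>s'. runs P s s' \<and> s' out = y \<and> (\<forall>r<t. r \<noteq> out \<longrightarrow> s' r = s r)))"

lemma implementsD:
  assumes "implements P f args out t" "computes f (map s args) y"
  obtains s' where "runs P s s'" "s' out = y" "\<And>r. r < t \<Longrightarrow> r \<noteq> out \<Longrightarrow> s' r = s r"
  using assms unfolding implements_def by blast

text \<open>The results occupy the fresh registers from \<open>t\<close> on; raising the scratch
  bound past them protects the earlier ones from the later programs.\<close>

lemma implement_list:
  fixes t :: nat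
  assumes "\<And>g args out t. g \<in> set gs \<Longrightarrow> set args \<subseteq> {..<t} \<Longrightarrow> out < t \<Longrightarrow> out \<notin> set args \<Longrightarrow>
      \<exists>P. implements P g args out t"
    and "set args \<subseteq> {..<t}"
  shows "\<exists>P. \<forall>s ys. list_all2 (\<lambda>g y. computes g (map s args) y) gs ys \<longrightarrow>
      (\<exists>s'. runs P s s' \<and> map s' [t..<t + length gs] = ys \<and> (\<forall>r<t. s' r = s r))"
  using assms
proof (induction gs rule: rev_induct)
  case Nil
  then show ?case by (auto intro!: exI[of _ "[]"] runs_Nil)
next
  case (snoc g gs)
  obtain P where P: "\<And>s ys. list_all2 (\<lambda>g y. computes g (map s args) y) gs ys \<Longrightarrow>
      \<exists>s'. runs P s s' \<and> map s' [t..<t + length gs] = ys \<and> (\<forall>r<t. s' r = s r)"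
    using snoc.IH[OF snoc.prems(1) snoc.prems(2)] by auto
  have "set args \<subseteq> {..<t + length gs + 1}" "t + length gs \<notin> set args"
    using snoc.prems(2) by fastforce+
  then obtain Q where Q: "implements Q g args (t + length gs) (t + length gs + 1)"
    using snoc.prems(1)[of g args "t + length gs + 1" "t + length gs"] by auto
  show ?case
  proof (rule exI[of _ "P @ Q"], intro allI impI)
    fix s ys
    assume "list_all2 (\<lambda>g y. computes g (map s args) y) (gs @ [g]) ys"
    then obtain zs y where ys: "ys = zs @ [y]" "list_all2 (\<lambda>g y. computes g (map s args) y) gs zs"
        "computes g (map s args) y"
      by (auto simp: list_all2_append1 list_all2_Cons1)
    obtain s1 where s1: "runs P s s1" "map s1 [t..<t + length gs] = zs" "\<forall>r<t. s1 r = s r"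
      using P[OF ys(2)] by blast
    have "map s1 args = map s args"
      using s1(3) snoc.prems(2) by (intro map_cong) auto
    with ys(3) have "computes g (map s1 args) y" by (simp only:)
    then obtain s2 where s2: "runs Q s1 s2" "s2 (t + length gs) = y"
        "\<And>r. r < t + length gs + 1 \<Longrightarrow> r \<noteq> t + length gs \<Longrightarrow> s2 r = s1 r"
      using implementsD[OF Q, of s1 y] by blast
    have "map s2 [t..<t + length gs] = map s1 [t..<t + length gs]"
      by (intro map_cong refl s2(3)) auto
    then show "\<exists>s'. runs (P @ Q) s s' \<and> map s' [t..<t + length (gs @ [g])] = ys \<and> (\<forall>r<t. s' r = s r)"
      using s1 s2 ys(1) runs_append[OF s1(1) s2(1)] by (intro exI[of _ s2]) auto
  qed
qed

lemma compile:
  "set args \<subseteq> {..<t} \<Longrightarrow> out < t \<Longrightarrow> out \<notin> set args \<Longrightarrow> \<exists>P. implements P f args out t"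
proof (induction f arbitrary: args out t)
  case Zero
  have "implements [Loop out []] Zero args out t"
    unfolding implements_def by (auto elim!: computes.cases intro!: exI runs_clear)
  then show ?case ..
next
  case Succ
  let ?P = "copy (hd args) out t @ [Inc out]"
  have "implements ?P Succ args out t"
    unfolding implements_def
  proof (intro allI impI)
    fix s y
    assume "computes Succ (map s args) y"
    then obtain a where a: "args = [a]" "y = Suc (s a)"
      by (auto elim!: computes.cases)
    have "runs ?P s (s(out := s a, t := 0, out := Suc (s a)))"
      using runs_append[OF runs_copy[of a out t s] runs_Inc[of out]] a Succ by simp
    then show "\<exists>s'. runs ?P s s' \<and> s' out = y \<and> (\<forall>r<t. r \<noteq> out \<longrightarrow> s' r = s r)"
      using a by fastforce
  qed
  then show ?case ..
next
  case (Proj i)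
  let ?P = "copy (args ! i) out t"
  have "implements ?P (Proj i) args out t"
    unfolding implements_def
  proof (intro allI impI)
    fix s y
    assume "computes (Proj i) (map s args) y"
    then have i: "i < length args" "y = s (args ! i)"
      by (auto elim!: computes.cases)
    then have "args ! i \<in> set args" by simp
    with Proj have "distinct [args ! i, out, t]" by auto
    then have "runs ?P s (s(out := y, t := 0))"
      using runs_copy[of "args ! i" out t s] i by simp
    then show "\<exists>s'. runs ?P s s' \<and> s' out = y \<and> (\<forall>r<t. r \<noteq> out \<longrightarrow> s' r = s r)"
      using Proj.prems by (intro exI[of _ "s(out := y, t := 0)"]) auto
  qed
  then show ?case ..
next
  case (Comp f gs)
  have "\<exists>P. \<forall>s ys. list_all2 (\<lambda>g y. computes g (map s args) y) gs ys \<longrightarrow>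
      (\<exists>s'. runs P s s' \<and> map s' [t..<t + length gs] = ys \<and> (\<forall>r<t. s' r = s r))"
    by (rule implement_list[OF Comp.IH(2) Comp.prems(1)])
  then obtain P where P: "\<And>s ys. list_all2 (\<lambda>g y. computes g (map s args) y) gs ys \<Longrightarrow>
      \<exists>s'. runs P s s' \<and> map s' [t..<t + length gs] = ys \<and> (\<forall>r<t. s' r = s r)"
    by blast
  obtain Q where Q: "implements Q f [t..<t + length gs] out (t + length gs)"
    using Comp.IH(1)[of "[t..<t + length gs]" "t + length gs" out] Comp.prems by fastforce
  have "implements (P @ Q) (Comp f gs) args out t"
    unfolding implements_def
  proof (intro allI impI)
    fix s y
    assume "computes (Comp f gs) (map s args) y"
    then obtain ys where ys: "list_all2 (\<lambda>g y. computes g (map s args) y) gs ys" "computes f ys y"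
      by (auto elim: computes.cases)
    obtain s1 where s1: "runs P s s1" "map s1 [t..<t + length gs] = ys" "\<forall>r<t. s1 r = s r"
      using P[OF ys(1)] by blast
    obtain s2 where s2: "runs Q s1 s2" "s2 out = y"
        "\<And>r. r < t + length gs \<Longrightarrow> r \<noteq> out \<Longrightarrow> s2 r = s1 r"
      using implementsD[OF Q, of s1 y] ys(2) s1(2) by auto
    show "\<exists>s'. runs (P @ Q) s s' \<and> s' out = y \<and> (\<forall>r<t. r \<noteq> out \<longrightarrow> s' r = s r)"
      using runs_append[OF s1(1) s2(1)] s1 s2 by (intro exI[of _ s2]) auto
  qed
  then show ?case ..
next
  case (PrimRec f g)
  define a where "a = hd args"
  define as where "as = tl args"
  show ?case
  proof (cases "args = []")
    case True
    have "implements [] (PrimRec f g) args out t"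
      unfolding implements_def using True by (auto elim: computes.cases)
    then show ?thesis ..
  next
    case False
    then have args: "args = a # as" by (simp add: a_def as_def)
    then have as: "set as \<subseteq> {..<t}" "a < t" "out \<noteq> a" "out \<notin> set as"
      using PrimRec.prems by auto
    have "t + 1 \<notin> set as" "set as \<subseteq> {..<t + 4}" using as by fastforce+
    then obtain P where P: "implements P f as (t + 1) (t + 4)"
      using PrimRec.IH(1)[of as "t + 4" "t + 1"] by auto
    have "t + 3 \<notin> set (t # (t + 1) # as)" "set (t # (t + 1) # as) \<subseteq> {..<t + 4}"
      using as by fastforce+
    then obtain Q where Q: "implements Q g (t # (t + 1) # as) (t + 3) (t + 4)"
      using PrimRec.IH(2)[of "t # (t + 1) # as" "t + 4" "t + 3"] by auto
    \<comment> \<open>Register \<open>t\<close> counts the recursion argument upwards,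
      \<open>t + 1\<close> holds the value reached, \<open>t + 2\<close> the number of rounds left,
      and \<open>t + 3\<close> receives the next value.\<close>
    let ?B = "Q @ copy (t + 3) (t + 1) (t + 4) @ [Inc t]"
    let ?P = "P @ copy a (t + 2) (t + 3) @ [Loop t []] @ [Loop (t + 2) ?B] @ copy (t + 1) out (t + 3)"
    have "implements ?P (PrimRec f g) args out t"
      unfolding implements_def
    proof (intro allI impI)
      fix s y
      assume comp: "computes (PrimRec f g) (map s args) y"
      have loop: "\<exists>s'. runs [Loop (t + 2) ?B] s s' \<and> s' (t + 1) = y \<and> (\<forall>r<t. s' r = s r)"
        if "computes (PrimRec f g) (s t # map s as) (s (t + 1))"
          "computes (PrimRec f g) ((s t + s (t + 2)) # map s as) y" for s
        using that
      proof (induction "s (t + 2)" arbitrary: s)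
        case 0
        then have "s (t + 1) = y" using computes_deterministic by fastforce
        with 0 show ?case by (auto intro!: exI[of _ s] runs_Loop_0)
      next
        case (Suc n)
        let ?s = "s(t + 2 := n)"
        have "computes (PrimRec f g) (Suc (s t + n) # map s as) y"
          using Suc(4) Suc(2)[symmetric] by simp
        \<comment> \<open>A primitive recursion has a value only if all earlier values exist. The
          value at the last argument is given, so the induction goes downwards from there.\<close>
        have "\<exists>x. computes (PrimRec f g) (Suc (s t) # map s as) x"
        proof -
          have "\<exists>x. computes (PrimRec f g) (m # map s as) x" if "m \<le> Suc (s t + n)" for m
            using that \<open>computes (PrimRec f g) (Suc (s t + n) # map s as) y\<close>
          proof (induction "Suc (s t + n) - m" arbitrary: m)
            case 0 then show ?case by (metis diff_is_0_eq le_antisym)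
          next
            case (Suc d)
            then have "\<exists>x. computes (PrimRec f g) (Suc m # map s as) x" by auto
            then show ?case by (auto elim: computes.cases)
          qed
          then show ?thesis by simp
        qed
        then obtain x where x0: "computes (PrimRec f g) (Suc (s t) # map s as) x" ..
        then obtain r where r: "computes (PrimRec f g) (s t # map s as) r"
            "computes g (s t # r # map s as) x"
          by (auto elim: computes.cases)
        note x = x0 r
        have "r = s (t + 1)" using computes_deterministic[OF x(2) Suc(3)] .
        have eqm: "map ?s as = map s as" using as by (intro map_cong) auto
        have "map ?s (t # (t + 1) # as) = s t # r # map s as"
          using eqm \<open>r = s (t + 1)\<close> by (simp only: list.map) simp
        then have "computes g (map ?s (t # (t + 1) # as)) x"
          using x(3) by (simp only:)
        then obtain s1 where s1: "runs Q ?s s1" "s1 (t + 3) = x"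
            "\<And>r. r < t + 4 \<Longrightarrow> r \<noteq> t + 3 \<Longrightarrow> s1 r = ?s r"
          using implementsD[OF Q] by metis
        let ?s2 = "s1(t + 1 := s1 (t + 3), t + 4 := 0)"
        let ?s3 = "?s2(t := Suc (?s2 t))"
        have B: "runs ?B ?s ?s3"
          by (intro runs_append[OF s1(1)] runs_append[OF runs_copy] runs_Inc) simp
        have s3: "?s3 t = Suc (s t)" "?s3 (t + 1) = x" "?s3 (t + 2) = n" "\<And>r. r < t \<Longrightarrow> ?s3 r = s r"
          using s1 by auto
        have eq3: "map ?s3 as = map s as" using as s3(4) by (intro map_cong) auto
        have c1: "computes (PrimRec f g) (?s3 t # map ?s3 as) (?s3 (t + 1))"
          using x(1) eq3 s3 by metis
        have c2: "computes (PrimRec f g) ((?s3 t + ?s3 (t + 2)) # map ?s3 as) y"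
          unfolding s3 eq3 using \<open>computes (PrimRec f g) (Suc (s t + n) # map s as) y\<close> by simp
        obtain s' where s': "runs [Loop (t + 2) ?B] ?s3 s'" "s' (t + 1) = y" "\<forall>r<t. s' r = ?s3 r"
          using Suc(1)[OF s3(3)[symmetric] c1 c2] by blast
        have n: "s (t + 2) - 1 = n" "s (t + 2) \<noteq> 0" using Suc(2) by simp_all
        have "runs [Loop (t + 2) ?B] s s'"
          using B s'(1) by (intro runs_Loop_Suc[of s "t + 2" ?B ?s3 s', OF n(2)]) (simp_all only: n)
        moreover have "\<forall>r<t. s' r = s r" using s'(3) s3(4) by simp
        ultimately show ?case using s'(2) by blast
      qed
      obtain x where x: "computes f (map s as) x"
      proof -
        have "\<exists>x. computes f (map s as) x" if "computes (PrimRec f g) (n # map s as) y" for n y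
          using that by (induction n arbitrary: y) (auto elim: computes.cases)
        then show ?thesis using comp args that by auto
      qed
      obtain s1 where s1: "runs P s s1" "s1 (t + 1) = x"
          "\<And>r. r < t + 4 \<Longrightarrow> r \<noteq> t + 1 \<Longrightarrow> s1 r = s r"
        using implementsD[OF P x] by metis
      let ?s2 = "s1(t + 2 := s1 a, t + 3 := 0, t := 0)"
      have s2: "?s2 t = 0" "?s2 (t + 1) = x" "?s2 (t + 2) = s a" "\<And>r. r < t \<Longrightarrow> ?s2 r = s r"
        using s1 as by auto
      have eq2: "map ?s2 as = map s as" using as s2(4) by (intro map_cong) auto
      have "computes (PrimRec f g) (?s2 t # map ?s2 as) (?s2 (t + 1))"
        unfolding s2 eq2 using x by (intro computes.prim_0)
      moreover have "computes (PrimRec f g) ((?s2 t + ?s2 (t + 2)) # map ?s2 as) y"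
        unfolding s2 eq2 using comp args by simp
      ultimately obtain s3 where s3: "runs [Loop (t + 2) ?B] ?s2 s3" "s3 (t + 1) = y" "\<forall>r<t. s3 r = ?s2 r"
        using loop by blast
      have "runs ?P s (s3(out := s3 (t + 1), t + 3 := 0))"
        using PrimRec.prems as
        by (intro runs_append[OF s1(1)] runs_append[OF runs_copy] runs_append[OF runs_clear]
            runs_append[OF s3(1)] runs_copy) auto
      then show "\<exists>s'. runs ?P s s' \<and> s' out = y \<and> (\<forall>r<t. r \<noteq> out \<longrightarrow> s' r = s r)"
        using s3 s2(4) PrimRec.prems
        by (intro exI[of _ "s3(out := s3 (t + 1), t + 3 := 0)"]) auto
    qed
    then show ?thesis ..
  qed
next
  case (Minim f)
  have "t + 1 \<notin> set (t # args)" "set (t # args) \<subseteq> {..<t + 2}"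
    using Minim.prems by fastforce+
  then obtain P where P: "implements P f (t # args) (t + 1) (t + 2)"
    using Minim.IH[of "t # args" "t + 2" "t + 1"] by auto
  \<comment> \<open>Register \<open>t\<close> is the candidate and \<open>t + 1\<close> the value of
    \<open>f\<close> there. The loop test consumes one unit of that value, which is harmless because
    \<open>P\<close> computes it afresh.\<close>
  let ?L = "[Loop (t + 1) (Inc t # P)]"
  let ?P = "[Loop t []] @ P @ ?L @ copy t out (t + 1)"
  have "implements ?P (Minim f) args out t"
    unfolding implements_def
  proof (intro allI impI)
    fix s y
    assume "computes (Minim f) (map s args) y"
    then have y: "computes f (y # map s args) 0" "\<And>m. m < y \<Longrightarrow> \<exists>v>0. computes f (m # map s args) v"
      by (auto elim: computes.cases)
    have loop: "\<exists>s2. runs (P @ ?L) s1 s2 \<and> s2 t = y \<and> (\<forall>r<t. s2 r = s r)"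
      if "s1 t \<le> y" "\<forall>r<t. s1 r = s r" for s1
      using that
    proof (induction "y - s1 t" arbitrary: s1)
      case 0
      have eq: "map s1 args = map s args" using 0 Minim.prems by (intro map_cong) auto
      have "y = s1 t" using 0 by simp
      then have "computes f (map s1 (t # args)) 0" using y(1) by (simp only: list.map eq)
      then obtain s2 where s2: "runs P s1 s2" "s2 (t + 1) = 0"
          "\<And>r. r < t + 2 \<Longrightarrow> r \<noteq> t + 1 \<Longrightarrow> s2 r = s1 r"
        using implementsD[OF P] by metis
      then have "runs (P @ ?L) s1 s2" by (intro runs_append[OF s2(1)] runs_Loop_0)
      then show ?case using s2 0 by (intro exI[of _ s2]) auto
    next
      case (Suc d)
      have eq: "map s1 args = map s args" using Suc Minim.prems by (intro map_cong) auto
      have "s1 t < y" using Suc(2) by simp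
      then obtain v where v: "v > 0" "computes f (s1 t # map s args) v"
        using y(2) by blast
      then have "computes f (map s1 (t # args)) v" by (simp only: list.map eq)
      then obtain s2 where s2: "runs P s1 s2" "s2 (t + 1) = v"
          "\<And>r. r < t + 2 \<Longrightarrow> r \<noteq> t + 1 \<Longrightarrow> s2 r = s1 r"
        using implementsD[OF P] by metis
      let ?s3 = "s2(t + 1 := v - 1)"
      let ?s4 = "?s3(t := Suc (?s3 t))"
      have s4: "?s4 t = Suc (s1 t)" "\<And>r. r < t \<Longrightarrow> ?s4 r = s r" using s2 Suc by auto
      have "d = y - ?s4 t" "?s4 t \<le> y" unfolding s4 using Suc(2) by simp_all
      then obtain s5 where s5: "runs (P @ ?L) ?s4 s5" "s5 t = y" "\<forall>r<t. s5 r = s r"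
        using Suc(1)[of ?s4] s4(2) by blast
      have "runs ((Inc t # P) @ ?L) ?s3 s5"
        using runs_Cons[OF runs_Inc s5(1)] by simp
      then have "runs ?L s2 s5"
        using s2(2) v(1) by (intro runs_Loop_unfold) simp_all
      then show ?case using runs_append[OF s2(1)] s5 by blast
    qed
    obtain s2 where s2: "runs (P @ ?L) (s(t := 0)) s2" "s2 t = y" "\<forall>r<t. s2 r = s r"
      using loop[of "s(t := 0)"] by auto
    have "runs ([Loop t []] @ (P @ ?L) @ copy t out (t + 1)) s (s2(out := s2 t, t + 1 := 0))"
      using Minim.prems by (intro runs_append[OF runs_clear] runs_append[OF s2(1)] runs_copy) auto
    then show "\<exists>s'. runs ?P s s' \<and> s' out = y \<and> (\<forall>r<t. r \<noteq> out \<longrightarrow> s' r = s r)"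
      using s2 Minim.prems by (intro exI[of _ "s2(out := s2 t, t + 1 := 0)"]) auto
  qed
  then show ?case ..
qed

text \<open>The empty continuation is absorbing, so any finite prefix of a run can be
  skipped.\<close>

lemma halts_funpow: "halts P s \<longleftrightarrow> (\<exists>m. fst ((lstep ^^ m) ((lstep ^^ n) (P, s))) = [])"
proof
  assume "halts P s"
  then obtain m where m: "fst ((lstep ^^ m) (P, s)) = []" unfolding halts_def by blast
  have stay: "fst ((lstep ^^ j) c) = []" if "fst c = []" for j c
    using that
  proof (induction j)
    case (Suc j)
    then show ?case by (cases "(lstep ^^ j) c") auto
  qed simp
  have "(lstep ^^ m) ((lstep ^^ n) (P, s)) = (lstep ^^ n) ((lstep ^^ m) (P, s))"
    by (simp add: add.commute flip: funpow_add comp_apply[of "_ ^^ _" "_ ^^ _"])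
  then show "\<exists>m. fst ((lstep ^^ m) ((lstep ^^ n) (P, s))) = []"
    using stay[OF m, of n] by metis
next
  assume "\<exists>m. fst ((lstep ^^ m) ((lstep ^^ n) (P, s))) = []"
  then obtain m where "fst ((lstep ^^ (m + n)) (P, s)) = []" by (auto simp: funpow_add)
  then show "halts P s" unfolding halts_def by blast
qed

lemma not_halts_forever:
  assumes "s r = 1"
  shows "\<not> halts [Loop r [Inc r]] s"
proof -
  let ?L = "Loop r [Inc r]"
  have "(lstep ^^ j) ([?L], s) \<in> {([?L], s), ([Inc r, ?L], s(r := 0))}" for j
    using assms by (induction j) (auto simp: fun_upd_idem)
  then show ?thesis unfolding halts_def by (metis empty_iff fst_conv insert_iff list.distinct(1))
qed

lemma program_for_recf:
  "\<exists>P. P \<noteq> [] \<and> (\<forall>s y. computes f (map s [0..<n]) y \<longrightarrow> (halts P s \<longleftrightarrow> y \<noteq> 0))"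
proof -
  have "\<exists>P. implements P f [0..<n] n (n + 1)"
    by (rule compile) auto
  then obtain P where P: "implements P f [0..<n] n (n + 1)" ..
  let ?L = "Loop (n + 1) [Inc (n + 1)]"
  \<comment> \<open>Register \<open>n + 1\<close> becomes a flag: it is set to 1 and cleared if the
    result in register \<open>n\<close> is nonzero. The last loop runs forever exactly if the flag
    is still set.\<close>
  let ?P = "P @ [Loop (n + 1) []] @ [Inc (n + 1)] @ [Loop n [Loop (n + 1) []]] @ [?L]"
  have "halts ?P s \<longleftrightarrow> y \<noteq> 0" if y: "computes f (map s [0..<n]) y" for s y
  proof -
    obtain s1 where s1: "runs P s s1" "s1 n = y"
      using implementsD[OF P y] by metis
    have loop: "runs [Loop n [Loop (n + 1) []]] s (s(n := 0, n + 1 := if s n = 0 then s (n + 1) else 0))" for s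
    proof (induction "s n" arbitrary: s)
      case 0
      then have "s(n := 0, n + 1 := if s n = 0 then s (n + 1) else 0) = s" by auto
      then show ?case using runs_Loop_0[of s n] 0 by metis
    next
      case (Suc m)
      let ?s = "s(n := m, n + 1 := 0)"
      have "s n - 1 = m" using Suc(2) by simp
      then have "runs [Loop (n + 1) []] (s(n := s n - 1)) ?s"
        using runs_clear[of "n + 1" "s(n := m)"] by simp
      moreover have "runs [Loop n [Loop (n + 1) []]] ?s (?s(n := 0, n + 1 := if ?s n = 0 then ?s (n + 1) else 0))"
        by (intro Suc(1)) simp
      moreover have "?s(n := 0, n + 1 := if ?s n = 0 then ?s (n + 1) else 0) =
          s(n := 0, n + 1 := if s n = 0 then s (n + 1) else 0)"
        using Suc(2) by auto
      ultimately show ?case using runs_Loop_Suc[of s n] Suc(2) by fastforce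
    qed
    let ?s2 = "s1(n + 1 := 0)"
    let ?s3 = "?s2(n + 1 := Suc (?s2 (n + 1)))"
    let ?s4 = "?s3(n := 0, n + 1 := if ?s3 n = 0 then ?s3 (n + 1) else 0)"
    have "runs (P @ [Loop (n + 1) []] @ [Inc (n + 1)] @ [Loop n [Loop (n + 1) []]]) s ?s4"
      by (intro runs_append[OF s1(1)] runs_append[OF runs_clear] runs_append[OF runs_Inc] loop)
    then obtain j where "(lstep ^^ j) (?P, s) = ([?L], ?s4)"
      unfolding runs_def by (metis append_assoc)
    then have halt: "halts ?P s \<longleftrightarrow> halts [?L] ?s4"
      using halts_funpow[of ?P s j] unfolding halts_def by simp
    show ?thesis
    proof (cases "y = 0")
      case True
      then have s4: "?s4 (n + 1) = 1" using s1(2) by simp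
      then have "\<not> halts [?L] ?s4" by (rule not_halts_forever)
      then show ?thesis using halt True by simp
    next
      case False
      then have "?s4 (n + 1) = 0" using s1(2) by simp
      then have "fst ((lstep ^^ 1) ([?L], ?s4)) = []" by simp
      then have "halts [?L] ?s4" unfolding halts_def by blast
      then show ?thesis using halt False by simp
    qed
  qed
  then show ?thesis by (intro exI[of _ ?P]) auto
qed

section \<open>Total recursive functions\<close>

definition recursive :: "nat \<Rightarrow> (nat list \<Rightarrow> nat) \<Rightarrow> bool" where
  "recursive n F \<longleftrightarrow> (\<exists>f. \<forall>xs. length xs = n \<longrightarrow> computes f xs (F xs))"

lemma recursive_cong:
  "recursive n F \<Longrightarrow> (\<And>xs. length xs = n \<Longrightarrow> F xs = G xs) \<Longrightarrow> recursive n G"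
  unfolding recursive_def by metis

lemma recursive_proj: "i < n \<Longrightarrow> recursive n (\<lambda>xs. xs ! i)"
  unfolding recursive_def by (intro exI[of _ "Proj i"]) (auto intro: computes.proj)

lemma recursive_comp:
  assumes "recursive m F" "\<And>i. i < m \<Longrightarrow> recursive n (G i)"
  shows "recursive n (\<lambda>xs. F (map (\<lambda>i. G i xs) [0..<m]))"
proof -
  obtain f where f: "\<And>ys. length ys = m \<Longrightarrow> computes f ys (F ys)"
    using assms(1) unfolding recursive_def by blast
  obtain g where g: "\<And>i xs. i < m \<Longrightarrow> length xs = n \<Longrightarrow> computes (g i) xs (G i xs)"
    using assms(2) unfolding recursive_def by metis
  have "computes (Comp f (map g [0..<m])) xs (F (map (\<lambda>i. G i xs) [0..<m]))" if "length xs = n" for xs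
    using g that by (intro computes.comp[OF _ f]) (auto simp: list_all2_conv_all_nth)
  then show ?thesis unfolding recursive_def by blast
qed

lemma recursive_comp1:
  assumes "recursive 1 (\<lambda>ys. h (ys ! 0))" "recursive n G"
  shows "recursive n (\<lambda>xs. h (G xs))"
  using recursive_comp[OF assms(1), of n "\<lambda>_. G"] assms(2) by simp

lemma recursive_comp2:
  assumes "recursive 2 (\<lambda>ys. h (ys ! 0) (ys ! 1))" "recursive n G" "recursive n H"
  shows "recursive n (\<lambda>xs. h (G xs) (H xs))"
  using recursive_comp[OF assms(1), of n "\<lambda>i. if i = 0 then G else H"] assms(2,3)
  by (simp add: numeral_2_eq_2)

lemma recursive_Suc:
  assumes "recursive n G"
  shows "recursive n (\<lambda>xs. Suc (G xs))"
proof (rule recursive_comp1[OF _ assms])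
  have "computes Succ ys (Suc (ys ! 0))" if "length ys = 1" for ys
    using that by (cases ys) (auto intro: computes.succ)
  then show "recursive 1 (\<lambda>ys. Suc (ys ! 0))" unfolding recursive_def by blast
qed

lemma recursive_const: "recursive n (\<lambda>xs. c)"
proof (induction c)
  case 0
  show ?case unfolding recursive_def by (blast intro: computes.zero)
qed (rule recursive_Suc)

lemma recursive_rec:
  assumes "recursive n G" "recursive (Suc (Suc n)) (\<lambda>ys. h (ys ! 0) (ys ! 1) (tl (tl ys)))"
  shows "recursive (Suc n) (\<lambda>xs. rec_nat (G (tl xs)) (\<lambda>m r. h m r (tl xs)) (xs ! 0))"
proof -
  obtain f where f: "\<And>ys. length ys = n \<Longrightarrow> computes f ys (G ys)"
    using assms(1) unfolding recursive_def by blast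
  obtain g where g: "\<And>ys. length ys = Suc (Suc n) \<Longrightarrow> computes g ys (h (ys ! 0) (ys ! 1) (tl (tl ys)))"
    using assms(2) unfolding recursive_def by blast
  have "computes (PrimRec f g) (m # xs) (rec_nat (G xs) (\<lambda>m r. h m r xs) m)" if "length xs = n" for m xs
  proof (induction m)
    case 0
    then show ?case using f[OF that] by (simp add: computes.prim_0)
  next
    case (Suc m)
    then show ?case
      using g[of "m # rec_nat (G xs) (\<lambda>m r. h m r xs) m # xs"] that
      by (auto intro: computes.prim_Suc)
  qed
  then have "computes (PrimRec f g) xs (rec_nat (G (tl xs)) (\<lambda>m r. h m r (tl xs)) (xs ! 0))"
    if "length xs = Suc n" for xs
    using that by (cases xs) auto
  then show ?thesis unfolding recursive_def by blast
qed

lemma recursive_rec1: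
  assumes "recursive 3 (\<lambda>ys. h (ys ! 0) (ys ! 1) (ys ! 2))" "recursive 1 (\<lambda>ys. g (ys ! 0))"
    "recursive n F" "recursive n G"
  shows "recursive n (\<lambda>xs. rec_nat (g (G xs)) (\<lambda>m r. h m r (G xs)) (F xs))"
proof (rule recursive_comp2[OF _ assms(3,4)])
  have "recursive 3 (\<lambda>ys. h (ys ! 0) (ys ! 1) (tl (tl ys) ! 0))"
    by (rule recursive_cong[OF assms(1)]) (auto simp: length_Suc_conv numeral_3_eq_3 numeral_2_eq_2)
  then have "recursive (Suc (Suc 1)) (\<lambda>ys. h (ys ! 0) (ys ! 1) (tl (tl ys) ! 0))"
    by (simp only: numeral_3_eq_3 One_nat_def)
  from recursive_rec[OF assms(2) this, simplified]
  show "recursive 2 (\<lambda>ys. rec_nat (g (ys ! 1)) (\<lambda>m r. h m r (ys ! 1)) (ys ! 0))"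
    unfolding numeral_2_eq_2 by (rule recursive_cong) (auto simp: length_Suc_conv)
qed

lemma recursive_add:
  assumes "recursive n F" "recursive n G"
  shows "recursive n (\<lambda>xs. F xs + G xs)"
proof -
  have "rec_nat b (\<lambda>m r. Suc r) a = a + b" for a b by (induction a) auto
  then show ?thesis
    using recursive_rec1[of "\<lambda>m r b. Suc r" "\<lambda>b. b", OF _ _ assms]
    by (simp add: recursive_Suc recursive_proj)
qed

lemma recursive_mult:
  assumes "recursive n F" "recursive n G"
  shows "recursive n (\<lambda>xs. F xs * G xs)"
proof -
  have "rec_nat 0 (\<lambda>m r. r + b) a = a * b" for a b by (induction a) auto
  then show ?thesis
    using recursive_rec1[of "\<lambda>m r b. r + b" "\<lambda>b. 0", OF _ _ assms]
    by (simp add: recursive_add recursive_const recursive_proj)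
qed

lemma recursive_funpow:
  assumes "recursive 1 (\<lambda>ys. h (ys ! 0))" "recursive n F" "recursive n G"
  shows "recursive n (\<lambda>xs. (h ^^ F xs) (G xs))"
proof -
  have "rec_nat b (\<lambda>m r. h r) a = (h ^^ a) b" for a b by (induction a) auto
  then show ?thesis
    using recursive_rec1[of "\<lambda>m r b. h r" "\<lambda>b. b", OF _ _ assms(2,3)]
      recursive_comp1[OF assms(1), of 3 "\<lambda>ys. ys ! 1"]
    by (simp add: recursive_proj)
qed

lemma recursive_diff:
  assumes "recursive n F" "recursive n G"
  shows "recursive n (\<lambda>xs. F xs - G xs)"
proof -
  have "rec_nat 0 (\<lambda>m r. m) a = a - 1" for a by (cases a) auto
  then have "recursive 1 (\<lambda>ys. ys ! 0 - 1)"
    using recursive_rec1[of "\<lambda>m r b. m" "\<lambda>b. 0" 1 "\<lambda>ys. ys ! 0" "\<lambda>ys. 0"]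
    by (simp add: recursive_const recursive_proj)
  moreover have "((\<lambda>a. a - 1) ^^ b) a = a - b" for a b :: nat by (induction b) auto
  ultimately show ?thesis
    using recursive_funpow[of "\<lambda>a. a - 1", OF _ assms(2,1)] by simp
qed

lemma recursive_power:
  assumes "recursive n F"
  shows "recursive n (\<lambda>xs. c ^ F xs)"
proof -
  have "((\<lambda>v. c * v) ^^ a) 1 = c ^ a" for a by (induction a) auto
  then show ?thesis
    using recursive_funpow[of "\<lambda>v. c * v" n F "\<lambda>xs. 1", OF _ assms]
    by (simp add: recursive_mult recursive_const recursive_proj)
qed

section \<open>Codes with one variable number\<close>

text \<open>A zero digit in front of a self-delimiting number adds the word
  \<open>[True, False]\<close>: the marker contributes 1, and the rest is shifted by two
  places.\<close>

definition grow :: "nat \<Rightarrow> nat \<Rightarrow> nat" where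
  "grow n C = ((\<lambda>v. 1 + 4 * v) ^^ n) C"

text \<open>The exponents 0 to 3 are the constants \<open>k, A, B, C\<close> from which the code of an instance is
  computed; the last one only serves to make the number large.\<close>

definition context_number :: "(nat \<Rightarrow> nat) \<Rightarrow> nat list \<Rightarrow> nat" where
  "context_number p xs = p 0 ^ (xs ! 0) * p 1 ^ (xs ! 1) * p 2 ^ (xs ! 2) * p 3 ^ (xs ! 3) * p 4 ^ (xs ! 4)"

lemma recursive_code:
  "recursive 5 (\<lambda>xs. xs ! 1 + xs ! 2 * grow (context_number p xs - xs ! 0) (xs ! 3))"
  unfolding grow_def context_number_def
  by (intro recursive_add recursive_mult recursive_funpow recursive_diff recursive_power
      recursive_proj recursive_const) auto

lemma word_number_append_left:
  "\<exists>A B. \<forall>w. word_number (v @ w) = A + B * word_number w"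
proof (induction v)
  case Nil
  show ?case by (intro exI[of _ 0] exI[of _ 1]) simp
next
  case (Cons b v)
  then obtain A B where "\<And>w. word_number (v @ w) = A + B * word_number w" by blast
  then show ?case
    by (intro exI[of _ "of_bool b + 2 * A"] exI[of _ "2 * B"]) (simp add: word_number_simps)
qed

lemma word_number_nat_word:
  assumes "0 < m"
  shows "word_number (nat_word m @ w) = 1 + 2 * of_bool (odd m) + 4 * word_number (nat_word (m div 2) @ w)"
  using assms unfolding nat_word_def
  by (subst binary_digits.simps) (simp add: word_number_simps)

lemma word_number_nat_word_pow2:
  assumes "0 < D"
  shows "word_number (nat_word (D * 2 ^ n) @ w) = grow n (word_number (nat_word D @ w))"
proof (induction n)
  case (Suc n)
  have "word_number (nat_word (D * 2 ^ Suc n) @ w) = 1 + 4 * word_number (nat_word (D * 2 ^ n) @ w)"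
    using assms by (subst word_number_nat_word) auto
  with Suc show ?case by (simp add: grow_def)
qed (simp add: grow_def)

text \<open>For every \<open>n\<close> the \<open>k\<close> lowest digits are those of
  \<open>e\<close>. Each of them contributes a fixed affine map, and \<open>A + B * _\<close> is
  their composition.\<close>

lemma word_number_nat_word_low_digits:
  assumes "0 < D"
  shows "e < 2 ^ k \<Longrightarrow> \<exists>A B. \<forall>n. word_number (nat_word (D * 2 ^ (n + k) + e) @ w) =
    A + B * word_number (nat_word (D * 2 ^ n) @ w)"
proof (induction k arbitrary: e)
  case 0
  then show ?case by (intro exI[of _ 0] exI[of _ 1]) simp
next
  case (Suc k)
  then have "e div 2 < 2 ^ k" by auto
  then obtain A B where AB: "\<And>n. word_number (nat_word (D * 2 ^ (n + k) + e div 2) @ w) =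
      A + B * word_number (nat_word (D * 2 ^ n) @ w)"
    using Suc.IH by blast
  have "word_number (nat_word (D * 2 ^ (n + Suc k) + e) @ w) =
      1 + 2 * of_bool (odd e) + 4 * A + 4 * B * word_number (nat_word (D * 2 ^ n) @ w)" for n
  proof -
    have "(D * 2 ^ (n + Suc k) + e) div 2 = D * 2 ^ (n + k) + e div 2" by simp
    moreover have "odd (D * 2 ^ (n + Suc k) + e) = odd e" by simp
    ultimately show ?thesis
      using assms AB[of n] by (subst word_number_nat_word) (auto simp: algebra_simps)
  qed
  then show ?case by blast
qed

lemma word_number_slot:
  assumes "0 < D"
  shows "\<exists>k A B C. \<forall>N\<ge>k. word_number (v @ nat_word (D * 2 ^ N + e) @ w) = A + B * grow (N - k) C"
proof -
  obtain A1 B1 where 1: "\<And>w. word_number (v @ w) = A1 + B1 * word_number w"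
    using word_number_append_left by metis
  \<comment> \<open>The offset \<open>e\<close> itself is a sufficient number of low digits.\<close>
  have "e < 2 ^ e" by simp
  then obtain A2 B2 where 2: "\<And>n. word_number (nat_word (D * 2 ^ (n + e) + e) @ w) =
      A2 + B2 * word_number (nat_word (D * 2 ^ n) @ w)"
    using word_number_nat_word_low_digits[OF assms] by blast
  have "word_number (v @ nat_word (D * 2 ^ N + e) @ w) =
      A1 + B1 * A2 + B1 * B2 * grow (N - e) (word_number (nat_word D @ w))" if "e \<le> N" for N
    using 1 2[of "N - e"] that word_number_nat_word_pow2[OF assms] by (simp add: algebra_simps)
  then show ?thesis by blast
qed

lemma mpc_word_slot:
  fixes I :: "nat \<Rightarrow> ('n::enum, 'm::enum) mpc"
  assumes "0 < D"
    and I: "\<And>N. I N = I0\<lparr>inequalities := L @ [(a, b, of_nat (D * 2 ^ N + e))]\<rparr>"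
  shows "\<exists>k A B C. \<forall>N\<ge>k. word_number (mpc_word (I N)) = A + B * grow (N - k) C"
proof -
  define v where "v = mat_word (plant_F I0) @ mat_word (plant_G I0) @ mat_word (weight_Q I0) @
    mat_word (weight_R I0) @ mat_word (weight_P I0) @ nat_word (Suc (length L)) @
    concat (map inequality_word L) @ vec_word a @ vec_word b @ [False]"
  \<comment> \<open>The varying number belongs to the last inequality, so only its denominator 1
    follows it in the word, and all that precedes it is the constant \<open>v\<close>.\<close>
  have "rat_word (of_nat n) = False # nat_word n @ nat_word 1" for n
    using quotient_of_int[of "int n"] by (simp add: rat_word_def)
  then have "mpc_word (I N) = v @ nat_word (D * 2 ^ N + e) @ nat_word 1" for N
    unfolding mpc_word_def I v_def by (simp add: inequality_word_def del: of_nat_add of_nat_mult)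
  then show ?thesis using word_number_slot[OF assms(1)] by presburger
qed

section \<open>Differences of maxima of affine functions\<close>

definition aff :: "(rat^'n) \<times> rat \<Rightarrow> real^'n \<Rightarrow> real" where
  "aff p x = real_vec (fst p) \<bullet> x + of_rat (snd p)"

definition max_aff :: "((rat^'n) \<times> rat) list \<Rightarrow> real^'n \<Rightarrow> real" where
  "max_aff P x = Max ((\<lambda>p. aff p x) ` set P)"

definition max_affine :: "(real^'n \<Rightarrow> real) \<Rightarrow> bool" where
  "max_affine g \<longleftrightarrow> (\<exists>P. P \<noteq> [] \<and> g = max_aff P)"

lemma max_aff_le_iff: "P \<noteq> [] \<Longrightarrow> max_aff P x \<le> t \<longleftrightarrow> (\<forall>p\<in>set P. aff p x \<le> t)"
  by (simp add: max_aff_def)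

lemma aff_le_max_aff: "p \<in> set P \<Longrightarrow> aff p x \<le> max_aff P x"
  by (simp add: max_aff_def)

lemma max_aff_attained: "P \<noteq> [] \<Longrightarrow> \<exists>p\<in>set P. max_aff P x = aff p x"
proof -
  assume "P \<noteq> []"
  then have "max_aff P x \<in> (\<lambda>p. aff p x) ` set P" unfolding max_aff_def by (intro Max_in) auto
  then show ?thesis by blast
qed

lemma max_aff_eqI:
  assumes "P \<noteq> []" "\<And>p. p \<in> set P \<Longrightarrow> aff p x \<le> t" "\<exists>p\<in>set P. aff p x = t"
  shows "max_aff P x = t"
proof (rule antisym)
  show "max_aff P x \<le> t" using assms(1,2) by (simp add: max_aff_le_iff)
  show "t \<le> max_aff P x" using assms(3) aff_le_max_aff[of _ P x] by blast
qed

lemma aff_add: "aff (p + q) x = aff p x + aff q x"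
  by (simp add: aff_def inner_vec_def of_rat_add sum.distrib algebra_simps)

lemma aff_scale: "aff (c *s fst p, c * snd p) x = of_rat c * aff p x"
  by (simp add: aff_def inner_vec_def of_rat_mult sum_distrib_left algebra_simps)

lemma max_affine_aff: "max_affine (aff p)"
  unfolding max_affine_def by (intro exI[of _ "[p]"]) (auto simp: max_aff_def fun_eq_iff)

lemma max_affine_add:
  assumes "max_affine g" "max_affine h"
  shows "max_affine (\<lambda>x. g x + h x)"
proof -
  obtain P Q where P: "P \<noteq> []" "g = max_aff P" and Q: "Q \<noteq> []" "h = max_aff Q"
    using assms unfolding max_affine_def by blast
  let ?R = "[p + q. p \<leftarrow> P, q \<leftarrow> Q]"
  have "?R \<noteq> []" using P Q by (cases P; cases Q) auto
  moreover have "max_aff ?R x = g x + h x" for x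
  proof (rule max_aff_eqI)
    show "aff r x \<le> g x + h x" if r: "r \<in> set ?R" for r
    proof -
      obtain p q where "p \<in> set P" "q \<in> set Q" "r = p + q" using r by auto
      then show ?thesis
        using aff_le_max_aff[of p P x] aff_le_max_aff[of q Q x] P Q by (simp only: aff_add add_mono)
    qed
    obtain p q where "p \<in> set P" "g x = aff p x" "q \<in> set Q" "h x = aff q x"
      using max_aff_attained[OF P(1)] max_aff_attained[OF Q(1)] P Q by metis
    moreover from this have "p + q \<in> set ?R" by auto
    ultimately show "\<exists>r\<in>set ?R. aff r x = g x + h x" by (metis aff_add)
  qed fact
  ultimately show ?thesis unfolding max_affine_def by (intro exI[of _ ?R]) (auto simp: fun_eq_iff)
qed

lemma max_affine_max:
  assumes "max_affine g" "max_affine h"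
  shows "max_affine (\<lambda>x. max (g x) (h x))"
proof -
  obtain P Q where P: "P \<noteq> []" "g = max_aff P" and Q: "Q \<noteq> []" "h = max_aff Q"
    using assms unfolding max_affine_def by blast
  have "max_aff (P @ Q) x = max (g x) (h x)" for x
    using P Q by (simp add: max_aff_def image_Un Max_Un)
  then show ?thesis
    unfolding max_affine_def using P by (intro exI[of _ "P @ Q"]) (auto simp: fun_eq_iff)
qed

lemma max_affine_scale:
  assumes "max_affine g" "c \<in> \<rat>" "0 \<le> c"
  shows "max_affine (\<lambda>x. c * g x)"
proof -
  obtain P where P: "P \<noteq> []" "g = max_aff P"
    using assms unfolding max_affine_def by blast
  obtain r where r: "c = of_rat r" using assms(2) Rats_cases by blast
  let ?R = "map (\<lambda>p. (r *s fst p, r * snd p)) P"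
  have "max_aff ?R x = c * g x" for x
  proof (rule max_aff_eqI)
    show "aff p x \<le> c * g x" if p: "p \<in> set ?R" for p
    proof -
      obtain q where "q \<in> set P" "p = (r *s fst q, r * snd q)" using p by auto
      then show ?thesis
        using aff_le_max_aff[of q P x] P assms(3) unfolding r by (simp add: aff_scale mult_left_mono)
    qed
    obtain p where "p \<in> set P" "g x = aff p x" using max_aff_attained[OF P(1)] P by metis
    then show "\<exists>p\<in>set ?R. aff p x = c * g x" unfolding r by (auto simp: aff_scale)
  qed (use P in simp)
  then show ?thesis
    unfolding max_affine_def using P by (intro exI[of _ ?R]) (auto simp: fun_eq_iff)
qed

definition dc :: "(real^'n \<Rightarrow> real) \<Rightarrow> bool" where
  "dc f \<longleftrightarrow> (\<exists>g h. max_affine g \<and> max_affine h \<and> (\<forall>x. f x = g x - h x))"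

lemma dcI: "max_affine g \<Longrightarrow> max_affine h \<Longrightarrow> (\<And>x. f x = g x - h x) \<Longrightarrow> dc f"
  unfolding dc_def by blast

lemma max_affine_const: "c \<in> \<rat> \<Longrightarrow> max_affine (\<lambda>x :: real^'n. c)"
proof (elim Rats_cases)
  fix r assume "c = of_rat r"
  then have "aff (0, r) = (\<lambda>x :: real^'n. c)" by (simp add: aff_def fun_eq_iff inner_vec_def)
  then show "max_affine (\<lambda>x :: real^'n. c)" by (metis max_affine_aff)
qed

lemma max_affine_coord: "max_affine (\<lambda>x. x $ i)"
proof -
  have "aff (axis i 1, 0) = (\<lambda>x. x $ i)"
    by (auto simp: aff_def fun_eq_iff inner_vec_def axis_def if_distrib[of "of_rat"]
        if_distrib[of "\<lambda>t. t * _"] cong: if_cong)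
  then show ?thesis using max_affine_aff by metis
qed

lemma dc_const: "c \<in> \<rat> \<Longrightarrow> dc (\<lambda>x. c)"
  by (rule dcI[OF max_affine_const[of c] max_affine_const[of 0]]) auto

lemma dc_coord: "dc (\<lambda>x. x $ i)"
  by (rule dcI[OF max_affine_coord[of i] max_affine_const[of 0]]) auto

lemma dc_add:
  assumes "dc f" "dc g"
  shows "dc (\<lambda>x. f x + g x)"
proof -
  obtain a b c d where *: "max_affine a" "max_affine b" "max_affine c" "max_affine d"
    "\<And>x. f x = a x - b x" "\<And>x. g x = c x - d x"
    using assms unfolding dc_def by blast
  show ?thesis by (rule dcI[OF max_affine_add[OF *(1,3)] max_affine_add[OF *(2,4)]]) (simp add: *)
qed

lemma dc_minus: "dc f \<Longrightarrow> dc (\<lambda>x. - f x)"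
  unfolding dc_def by (metis minus_diff_eq)

lemma dc_diff: "dc f \<Longrightarrow> dc g \<Longrightarrow> dc (\<lambda>x. f x - g x)"
  using dc_add[OF _ dc_minus] by force

text \<open>\<open>max (a - b) (c - d) = max (a + d) (c + b) - (b + d)\<close>.\<close>

lemma dc_max:
  assumes "dc f" "dc g"
  shows "dc (\<lambda>x. max (f x) (g x))"
proof -
  obtain a b c d where *: "max_affine a" "max_affine b" "max_affine c" "max_affine d"
    "\<And>x. f x = a x - b x" "\<And>x. g x = c x - d x"
    using assms unfolding dc_def by blast
  show ?thesis
    by (rule dcI[OF max_affine_max[OF max_affine_add[OF *(1,4)] max_affine_add[OF *(3,2)]]
          max_affine_add[OF *(2,4)]]) (simp add: * max_def)
qed

lemma dc_min: "dc f \<Longrightarrow> dc g \<Longrightarrow> dc (\<lambda>x. min (f x) (g x))"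
proof -
  assume "dc f" "dc g"
  then have "dc (\<lambda>x. - max (- f x) (- g x))" by (intro dc_minus dc_max)
  moreover have "(\<lambda>x. - max (- f x) (- g x)) = (\<lambda>x. min (f x) (g x))" by auto
  ultimately show ?thesis by simp
qed

lemma dc_abs: "dc f \<Longrightarrow> dc (\<lambda>x. \<bar>f x\<bar>)"
proof -
  assume "dc f"
  then have "dc (\<lambda>x. max (f x) (- f x))" by (intro dc_max dc_minus)
  moreover have "(\<lambda>x. max (f x) (- f x)) = (\<lambda>x. \<bar>f x\<bar>)" by auto
  ultimately show ?thesis by simp
qed

lemma dc_scale:
  assumes "c \<in> \<rat>" "dc f"
  shows "dc (\<lambda>x. c * f x)"
proof -
  have pos: "dc (\<lambda>x. c * f x)" if "0 \<le> c" "c \<in> \<rat>" for c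
  proof -
    obtain a b where *: "max_affine a" "max_affine b" "\<And>x. f x = a x - b x"
      using assms(2) unfolding dc_def by blast
    show ?thesis
      using that by (intro dcI[OF max_affine_scale[OF *(1)] max_affine_scale[OF *(2)]])
        (auto simp: * algebra_simps)
  qed
  show ?thesis
  proof (cases "0 \<le> c")
    case False
    then have "dc (\<lambda>x. - ((- c) * f x))" using assms(1) by (intro dc_minus pos) auto
    then show ?thesis by simp
  qed (use pos assms(1) in simp)
qed

lemma dc_sum: "finite A \<Longrightarrow> (\<And>i. i \<in> A \<Longrightarrow> dc (f i)) \<Longrightarrow> dc (\<lambda>x. \<Sum>i\<in>A. f i x)"
  by (induction A rule: finite_induct) (auto intro: dc_add dc_const)

lemmas dc_intros = dc_const dc_coord dc_add dc_minus dc_diff dc_max dc_min dc_abs dc_scale dc_sum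

text \<open>At \<open>u = g x\<close>, \<open>v = h x\<close> the partial derivatives of
  \<open>u^2 + v^2 + (u - v)^2\<close> are \<open>2 * (2 * u - v)\<close> and
  \<open>2 * (2 * v - u)\<close>. The last two inequalities make them nonnegative, so by convexity
  this point is optimal among all larger \<open>u\<close> and \<open>v\<close>.\<close>

definition balanced :: "(real^'n \<Rightarrow> real) \<Rightarrow> (real^'n \<Rightarrow> real) \<Rightarrow> bool" where
  "balanced g h \<longleftrightarrow> g 0 = 0 \<and> h 0 = 0 \<and> (\<forall>x. 0 \<le> g x \<and> 0 \<le> h x \<and> h x \<le> 2 * g x \<and> g x \<le> 2 * h x)"

definition norm_1 :: "real^('n::finite) \<Rightarrow> real" where
  "norm_1 x = (\<Sum>i\<in>UNIV. \<bar>x $ i\<bar>)"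

lemma max_affine_norm_1: "max_affine (norm_1 :: real^('n::finite) \<Rightarrow> real)"
proof -
  have abs: "max_affine (\<lambda>x :: real^'n. \<bar>x $ i\<bar>)" for i
  proof -
    have "aff (- axis i 1, 0) = (\<lambda>x :: real^'n. - (x $ i))"
      by (auto simp: aff_def fun_eq_iff inner_vec_def axis_def of_rat_minus if_distrib[of "of_rat"]
          if_distrib[of "\<lambda>t. - (t * _)"] sum_negf cong: if_cong)
    then have "max_affine (\<lambda>x :: real^'n. - (x $ i))" using max_affine_aff by metis
    with max_affine_coord[of i] have "max_affine (\<lambda>x :: real^'n. max (x $ i) (- (x $ i)))"
      by (rule max_affine_max)
    moreover have "(\<lambda>x::real^'n. max (x $ i) (- (x $ i))) = (\<lambda>x. \<bar>x $ i\<bar>)" by auto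
    ultimately show ?thesis by simp
  qed
  have "max_affine (\<lambda>x :: real^'n. \<Sum>i\<in>A. \<bar>x $ i\<bar>)" if "finite A" for A :: "'n set"
    using that by (induction A rule: finite_induct) (auto intro: abs max_affine_add max_affine_const)
  then show ?thesis unfolding norm_1_def[abs_def] by simp
qed

lemma max_affine_linear_growth:
  assumes "max_affine g"
  shows "\<exists>K::nat. \<forall>x. \<bar>g x - g 0\<bar> \<le> K * norm_1 x"
proof -
  obtain P where P: "P \<noteq> []" "g = max_aff P"
    using assms unfolding max_affine_def by blast
  define B where "B = (\<Sum>p\<in>set P. \<Sum>i\<in>UNIV. \<bar>real_vec (fst p) $ i\<bar>)"
  obtain K :: nat where K: "B \<le> K" using real_arch_simple by blast
  have lin: "\<bar>aff p x - aff p 0\<bar> \<le> K * norm_1 x" if p: "p \<in> set P" for p x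
  proof -
    have coeff: "\<bar>real_vec (fst p) $ i\<bar> \<le> K" for i
    proof -
      have "\<bar>real_vec (fst p) $ i\<bar> \<le> (\<Sum>i\<in>UNIV. \<bar>real_vec (fst p) $ i\<bar>)"
        by (rule member_le_sum) auto
      also have "\<dots> \<le> B"
        unfolding B_def by (rule member_le_sum[OF p]) (auto intro: sum_nonneg)
      finally show ?thesis using K by simp
    qed
    have "\<bar>aff p x - aff p 0\<bar> = \<bar>\<Sum>i\<in>UNIV. real_vec (fst p) $ i * x $ i\<bar>"
      by (simp add: aff_def inner_vec_def)
    also have "\<dots> \<le> (\<Sum>i\<in>UNIV. \<bar>real_vec (fst p) $ i * x $ i\<bar>)" by (rule sum_abs)
    also have "\<dots> \<le> (\<Sum>i\<in>UNIV. K * \<bar>x $ i\<bar>)"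
      by (intro sum_mono) (use coeff in \<open>simp add: abs_mult mult_right_mono\<close>)
    finally show ?thesis by (simp add: norm_1_def sum_distrib_left)
  qed
  have "\<bar>g x - g 0\<bar> \<le> K * norm_1 x" for x
  proof -
    obtain p q where "p \<in> set P" "g x = aff p x" "q \<in> set P" "g 0 = aff q 0"
      using max_aff_attained[OF P(1)] P by metis
    then show ?thesis
      using lin[of p x] lin[of q x] aff_le_max_aff[of p P 0] aff_le_max_aff[of q P x] P(2) by auto
  qed
  then show ?thesis by blast
qed

lemma max_affine_rational_at_0: "max_affine g \<Longrightarrow> g 0 \<in> \<rat>"
  using max_aff_attained[of _ 0] by (fastforce simp: max_affine_def aff_def)

lemma norm_1_nonneg: "0 \<le> norm_1 x"
  by (simp add: norm_1_def sum_nonneg)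

lemma dc_balanced:
  fixes f :: "real^'n \<Rightarrow> real"
  assumes "dc f" "f 0 = 0"
  shows "\<exists>g h. max_affine g \<and> max_affine h \<and> balanced g h \<and> (\<forall>x. f x = g x - h x)"
proof -
  obtain g h where gh: "max_affine g" "max_affine h" "\<And>x. f x = g x - h x"
    using assms unfolding dc_def by blast
  obtain K L :: nat where K: "\<And>x. \<bar>g x - g 0\<bar> \<le> K * norm_1 x" and L: "\<And>x. \<bar>h x - h 0\<bar> \<le> L * norm_1 x"
    using max_affine_linear_growth gh by metis
  have "g 0 = h 0" using gh(3)[of 0] assms(2) by simp
  \<comment> \<open>Put \<open>n = norm_1 x\<close>. Then \<open>g x + ?c x\<close> lies between
    \<open>(K + 2 * L) * n\<close> and \<open>(3 * K + 2 * L) * n\<close>, and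
    \<open>h x + ?c x\<close> between \<open>(2 * K + L) * n\<close> and
    \<open>(2 * K + 3 * L) * n\<close>; each is at most twice the other. The term
    \<open>- g 0\<close> makes both vanish at the origin.\<close>
  let ?c = "\<lambda>x. real (2 * K + 2 * L) * norm_1 x + - g 0"
  have c: "max_affine ?c"
    using max_affine_rational_at_0[OF gh(1)]
    by (intro max_affine_add max_affine_scale max_affine_norm_1 max_affine_const) auto
  have "balanced (\<lambda>x. g x + ?c x) (\<lambda>x. h x + ?c x)"
  proof -
    have "norm_1 (0 :: real^'n) = 0" by (simp add: norm_1_def)
    moreover have "0 \<le> g x + ?c x \<and> 0 \<le> h x + ?c x \<and> h x + ?c x \<le> 2 * (g x + ?c x) \<and>
        g x + ?c x \<le> 2 * (h x + ?c x)" for x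
    proof -
      have "0 \<le> K * norm_1 x" "0 \<le> L * norm_1 x" by (simp_all add: norm_1_nonneg)
      then show ?thesis using K[of x] L[of x] \<open>g 0 = h 0\<close> by (simp add: algebra_simps abs_le_iff)
    qed
    ultimately show ?thesis using \<open>g 0 = h 0\<close> by (simp add: balanced_def)
  qed
  then show ?thesis
    using max_affine_add[OF gh(1) c] max_affine_add[OF gh(2) c] gh(3)
    by (intro exI[of _ "\<lambda>x. g x + ?c x"] exI[of _ "\<lambda>x. h x + ?c x"]) auto
qed

text \<open>The sign is decided lexicographically by \<open>\<beta>\<close>,
  \<open>\<alpha>\<close>, \<open>\<gamma>\<close>: once \<open>\<eta>\<close> and \<open>S0\<close>
  are large, \<open>z\<close> outweighs \<open>S\<close> and \<open>S\<close> outweighs 1.\<close>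

lemma affine_eventual_sign:
  fixes \<alpha> \<beta> \<gamma> :: real
  shows "\<exists>S0\<ge>0. \<exists>\<eta>\<ge>0. (\<forall>S\<ge>S0. \<forall>z\<ge>\<eta> * S. 0 \<le> \<alpha> * S + \<beta> * z + \<gamma>) \<or>
    (\<forall>S\<ge>S0. \<forall>z\<ge>\<eta> * S. \<alpha> * S + \<beta> * z + \<gamma> \<le> 0)"
proof -
  have pos: "\<exists>S0\<ge>0. \<exists>\<eta>\<ge>0. \<forall>S\<ge>S0. \<forall>z\<ge>\<eta> * S. 0 \<le> \<alpha> * S + \<beta> * z + \<gamma>"
    if sgn: "\<beta> > 0 \<or> \<beta> = 0 \<and> (\<alpha> > 0 \<or> \<alpha> = 0 \<and> \<gamma> \<ge> 0)" for \<alpha> \<beta> \<gamma> :: real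
  proof -
    consider "\<beta> > 0" | "\<beta> = 0" "\<alpha> > 0" | "\<beta> = 0" "\<alpha> = 0" "\<gamma> \<ge> 0"
      using sgn by blast
    then show ?thesis
    proof cases
      case 1
      have "0 \<le> \<alpha> * S + \<beta> * z + \<gamma>" if S: "S \<ge> 1" "z \<ge> ((\<bar>\<alpha>\<bar> + \<bar>\<gamma>\<bar>) / \<beta>) * S" for S z
      proof -
        have "\<beta> * z \<ge> \<beta> * (((\<bar>\<alpha>\<bar> + \<bar>\<gamma>\<bar>) / \<beta>) * S)" using S 1 by (intro mult_left_mono) auto
        moreover have "\<beta> * (((\<bar>\<alpha>\<bar> + \<bar>\<gamma>\<bar>) / \<beta>) * S) = \<bar>\<alpha>\<bar> * S + \<bar>\<gamma>\<bar> * S"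
          using 1 by (simp add: distrib_right)
        ultimately have "\<beta> * z \<ge> \<bar>\<alpha>\<bar> * S + \<bar>\<gamma>\<bar> * S" by simp
        moreover have "\<bar>\<gamma>\<bar> * S \<ge> \<bar>\<gamma>\<bar> * 1" using S by (intro mult_left_mono) auto
        moreover have "- (\<alpha> * S) \<le> \<bar>\<alpha>\<bar> * S" using mult_right_mono[of "- \<alpha>" "\<bar>\<alpha>\<bar>" S] S by simp
        ultimately show ?thesis by linarith
      qed
      then show ?thesis
        using 1 by (intro exI[of _ 1] exI[of _ "(\<bar>\<alpha>\<bar> + \<bar>\<gamma>\<bar>) / \<beta>"] conjI allI impI) auto
    next
      case 2
      have "0 \<le> \<alpha> * S + \<gamma>" if "S \<ge> \<bar>\<gamma>\<bar> / \<alpha>" for S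
      proof -
        have "\<alpha> * S \<ge> \<alpha> * (\<bar>\<gamma>\<bar> / \<alpha>)" using that 2 by (intro mult_left_mono) auto
        then show ?thesis using 2 by simp
      qed
      then show ?thesis
        using 2 by (intro exI[of _ "\<bar>\<gamma>\<bar> / \<alpha>"] exI[of _ 0]) auto
    qed auto
  qed
  consider "\<beta> > 0 \<or> \<beta> = 0 \<and> (\<alpha> > 0 \<or> \<alpha> = 0 \<and> \<gamma> \<ge> 0)"
    | "- \<beta> > 0 \<or> - \<beta> = 0 \<and> (- \<alpha> > 0 \<or> - \<alpha> = 0 \<and> - \<gamma> \<ge> 0)" by argo
  then show ?thesis
  proof cases
    case 1
    from pos[OF this] show ?thesis by blast
  next
    case 2
    have neg: "0 \<le> - \<alpha> * S + - \<beta> * z + - \<gamma> \<longleftrightarrow> \<alpha> * S + \<beta> * z + \<gamma> \<le> 0" for S z by auto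
    from pos[OF 2] show ?thesis unfolding neg by blast
  qed
qed

text \<open>Over a ray of slope \<open>r\<close> the difference of two pieces eventually keeps its
  sign, so comparing the finitely many pieces one by one leaves a winner that does not depend on
  \<open>S\<close>. This independence is what allows the same inequality to act as the cap for every
  large \<open>N\<close>.\<close>

lemma max_affine_dominating_piece:
  fixes g :: "real^3 \<Rightarrow> real"
  assumes "max_affine g"
  shows "\<exists>p. (\<forall>x. aff p x \<le> g x) \<and>
    (\<exists>S0 \<eta>. \<forall>S\<ge>S0. \<forall>z\<ge>\<eta> * S. aff p (vector [S, r * S, z]) = g (vector [S, r * S, z]))"
proof -
  have "\<exists>p\<in>set P. \<exists>S0\<ge>0. \<exists>\<eta>\<ge>0. \<forall>S\<ge>S0. \<forall>z\<ge>\<eta> * S. \<forall>q\<in>set P.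
      aff q (vector [S, r * S, z]) \<le> aff p (vector [S, r * S, z])"
    if "P \<noteq> []" for P :: "((rat^3) \<times> rat) list"
    using that
  proof (induction P rule: list_nonempty_induct)
    case (single q)
    then show ?case by auto
  next
    case (cons q P)
    then obtain p S1 \<eta>1 where p: "p \<in> set P" "S1 \<ge> 0" "\<eta>1 \<ge> 0"
      "\<And>S z q. S \<ge> S1 \<Longrightarrow> z \<ge> \<eta>1 * S \<Longrightarrow> q \<in> set P \<Longrightarrow>
        aff q (vector [S, r * S, z]) \<le> aff p (vector [S, r * S, z])"
      by metis
    define \<alpha> where "\<alpha> = of_rat (fst p $ 1) + of_rat (fst p $ 2) * r - of_rat (fst q $ 1) - of_rat (fst q $ 2) * r"
    define \<beta> :: real where "\<beta> = of_rat (fst p $ 3) - of_rat (fst q $ 3)"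
    define \<gamma> :: real where "\<gamma> = of_rat (snd p) - of_rat (snd q)"
    have diff: "aff p (vector [S, r * S, z]) - aff q (vector [S, r * S, z]) = \<alpha> * S + \<beta> * z + \<gamma>" for S z
      by (simp add: aff_def inner_vec_def sum_3 \<alpha>_def \<beta>_def \<gamma>_def algebra_simps)
    obtain S2 \<eta>2 where s: "S2 \<ge> 0" "\<eta>2 \<ge> 0"
      and sign: "(\<forall>S\<ge>S2. \<forall>z\<ge>\<eta>2 * S. 0 \<le> \<alpha> * S + \<beta> * z + \<gamma>) \<or>
        (\<forall>S\<ge>S2. \<forall>z\<ge>\<eta>2 * S. \<alpha> * S + \<beta> * z + \<gamma> \<le> 0)"
      using affine_eventual_sign[of \<alpha> \<beta> \<gamma>] by blast
    define S0 \<eta> where "S0 = max S1 S2" and "\<eta> = max \<eta>1 \<eta>2"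
    have le: "\<eta>1 * S \<le> z \<and> \<eta>2 * S \<le> z" if "S \<ge> S0" "z \<ge> \<eta> * S" for S z
    proof -
      have "S \<ge> 0" using that p(2) by (simp add: S0_def)
      then have "\<eta>1 * S \<le> \<eta> * S" "\<eta>2 * S \<le> \<eta> * S"
        by (auto simp: \<eta>_def intro!: mult_right_mono)
      then show ?thesis using that by simp
    qed
    from sign show ?case
    proof
      assume "\<forall>S\<ge>S2. \<forall>z\<ge>\<eta>2 * S. 0 \<le> \<alpha> * S + \<beta> * z + \<gamma>"
      then have "\<forall>S\<ge>S0. \<forall>z\<ge>\<eta> * S. \<forall>q\<in>set (q # P).
          aff q (vector [S, r * S, z]) \<le> aff p (vector [S, r * S, z])"
        using p(4) le by (metis (no_types, lifting) S0_def diff diff_ge_0_iff_ge max.bounded_iff set_ConsD)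
      moreover have "p \<in> set (q # P)" "S0 \<ge> 0" "\<eta> \<ge> 0" using p s by (auto simp: S0_def \<eta>_def)
      ultimately show ?thesis by blast
    next
      assume *: "\<forall>S\<ge>S2. \<forall>z\<ge>\<eta>2 * S. \<alpha> * S + \<beta> * z + \<gamma> \<le> 0"
      have "\<forall>S\<ge>S0. \<forall>z\<ge>\<eta> * S. \<forall>q'\<in>set (q # P).
          aff q' (vector [S, r * S, z]) \<le> aff q (vector [S, r * S, z])"
      proof (intro allI impI ballI)
        fix S z q' assume that: "S \<ge> S0" "z \<ge> \<eta> * S" "q' \<in> set (q # P)"
        have "aff p (vector [S, r * S, z]) \<le> aff q (vector [S, r * S, z])"
        proof -
          have "\<alpha> * S + \<beta> * z + \<gamma> \<le> 0" using * le[OF that(1,2)] that(1) by (simp add: S0_def)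
          then show ?thesis using diff[of S z] by linarith
        qed
        moreover have "q' = q \<or> aff q' (vector [S, r * S, z]) \<le> aff p (vector [S, r * S, z])"
          using p(4)[of S z q'] le[OF that(1,2)] that by (auto simp: S0_def)
        ultimately show "aff q' (vector [S, r * S, z]) \<le> aff q (vector [S, r * S, z])" by auto
      qed
      moreover have "q \<in> set (q # P)" "S0 \<ge> 0" "\<eta> \<ge> 0" using p s by (auto simp: S0_def \<eta>_def)
      ultimately show ?thesis by blast
    qed
  qed
  then show ?thesis
    using assms unfolding max_affine_def
    by (metis (no_types, lifting) aff_le_max_aff max_aff_eqI)
qed

section \<open>Realisation as a closed loop\<close>

lemma six_split:
  "\<exists>(l :: 3 \<Rightarrow> 6) (r :: 3 \<Rightarrow> 6). inj l \<and> inj r \<and> range l \<inter> range r = {} \<and> range l \<union> range r = UNIV"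
proof -
  have "card (UNIV <+> UNIV :: (3 + 3) set) = card (UNIV :: 6 set)"
    by (subst card_Plus) auto
  then obtain f :: "3 + 3 \<Rightarrow> 6" where f: "bij_betw f (UNIV <+> UNIV) UNIV"
    using finite_same_card_bij[of "UNIV <+> UNIV :: (3 + 3) set" "UNIV :: 6 set"] by auto
  then have inj: "inj f" and surj: "surj f" by (auto simp: bij_betw_def)
  have un: "range (f \<circ> Inl) \<union> range (f \<circ> Inr) = UNIV"
  proof (rule UNIV_eq_I[symmetric])
    fix j
    obtain s where "j = f s" using surj by (metis surjD)
    then show "j \<in> range (f \<circ> Inl) \<union> range (f \<circ> Inr)"
      by (cases s) (metis UnCI comp_apply rangeI)+
  qed
  have "range (f \<circ> Inl) \<inter> range (f \<circ> Inr) = {}"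
  proof -
    have "f (Inl a) \<noteq> f (Inr b)" for a b using inj by (metis Inl_Inr_False injD)
    then show ?thesis by fastforce
  qed
  with un inj_compose[OF inj inj_Inl] inj_compose[OF inj inj_Inr] show ?thesis
    by blast
qed

definition input_split :: "(3 \<Rightarrow> 6) \<times> (3 \<Rightarrow> 6)" where
  "input_split = (SOME (l, r). inj l \<and> inj r \<and> range l \<inter> range r = {} \<and> range l \<union> range r = UNIV)"

definition lo :: "3 \<Rightarrow> 6" where "lo = fst input_split"

definition hi :: "3 \<Rightarrow> 6" where "hi = snd input_split"

lemma lo_hi: "inj lo" "inj hi" "range lo \<inter> range hi = {}" "range lo \<union> range hi = UNIV"
proof -
  have "\<exists>p :: (3 \<Rightarrow> 6) \<times> (3 \<Rightarrow> 6). (case p of (l, r) \<Rightarrow>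
      inj l \<and> inj r \<and> range l \<inter> range r = {} \<and> range l \<union> range r = UNIV)"
    using six_split by (simp only: split_paired_Ex split_conv)
  from someI_ex[OF this] have "case input_split of (l, r) \<Rightarrow>
      inj l \<and> inj r \<and> range l \<inter> range r = {} \<and> range l \<union> range r = UNIV"
    unfolding input_split_def .
  then show "inj lo" "inj hi" "range lo \<inter> range hi = {}" "range lo \<union> range hi = UNIV"
    by (simp_all add: lo_def hi_def split_beta)
qed

lemma lo_neq_hi: "lo i \<noteq> hi j"
  using lo_hi(3) by blast

lemma lo_eq_iff: "lo i = lo j \<longleftrightarrow> i = j"
  using lo_hi(1) by (auto dest: injD)

lemma hi_eq_iff: "hi i = hi j \<longleftrightarrow> i = j"
  using lo_hi(2) by (auto dest: injD)

lemma sum_lo_hi: "(\<Sum>j\<in>UNIV. f j) = (\<Sum>i\<in>UNIV. f (lo i)) + (\<Sum>i\<in>UNIV. f (hi i))"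
proof -
  have "(\<Sum>j\<in>UNIV. f j) = (\<Sum>j\<in>range lo \<union> range hi. f j)" by (simp add: lo_hi(4))
  also have "\<dots> = (\<Sum>j\<in>range lo. f j) + (\<Sum>j\<in>range hi. f j)"
    by (rule sum.union_disjoint) (simp_all add: lo_hi(3))
  finally show ?thesis by (simp add: sum.reindex lo_hi(1,2))
qed

definition input_matrix :: "rat^6^3" where
  "input_matrix = (\<chi> i j. if j = lo i then 1 else if j = hi i then -1 else 0)"

definition difference_mpc :: "((rat^3) \<times> (rat^6) \<times> rat) list \<Rightarrow> (3, 6) mpc" where
  "difference_mpc L = \<lparr>plant_F = 0, plant_G = input_matrix, weight_Q = mat 1, weight_R = mat 1,
    weight_P = mat 1, inequalities = L\<rparr>"

lemma real_mat_1: "real_mat (mat 1) = mat 1"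
  by (simp add: map_matrix_def mat_def vec_eq_iff)

lemma plant_difference_mpc: "plant (difference_mpc L) x u = (\<chi> i. u $ lo i - u $ hi i)"
proof -
  have "(real_mat input_matrix *v u) $ i = u $ lo i - u $ hi i" for i
    by (simp add: matrix_vector_mult_def sum_lo_hi map_matrix_def input_matrix_def lo_eq_iff
        hi_eq_iff lo_neq_hi lo_neq_hi[symmetric] if_distrib[of of_rat] if_distrib[of "\<lambda>t. t * _"]
        of_rat_minus cong: if_cong)
  moreover have "real_mat 0 *v x = 0"
    by (simp add: matrix_vector_mult_def map_matrix_def vec_eq_iff)
  ultimately show ?thesis by (simp add: plant_def difference_mpc_def vec_eq_iff)
qed

lemma cost_difference_mpc:
  "mpc_cost (difference_mpc L) (x, u, y) = x \<bullet> x + u \<bullet> u + y \<bullet> y"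
  by (simp add: mpc_cost_def difference_mpc_def real_mat_1)

text \<open>The squares of \<open>u - p\<close> and \<open>v - q\<close> make the minimum strict and
  so yield uniqueness of the optimizer. In the identity below, the two products are the first-order
  terms, with signs given by the balance conditions.\<close>

lemma difference_cost_bound:
  fixes p q u v :: real
  assumes "q \<le> 2 * p" "p \<le> 2 * q" "p \<le> u" "q \<le> v"
  shows "p\<^sup>2 + q\<^sup>2 + (p - q)\<^sup>2 + (u - p)\<^sup>2 + (v - q)\<^sup>2 \<le> u\<^sup>2 + v\<^sup>2 + (u - v)\<^sup>2"
proof -
  have "u\<^sup>2 + v\<^sup>2 + (u - v)\<^sup>2 - (p\<^sup>2 + q\<^sup>2 + (p - q)\<^sup>2 + (u - p)\<^sup>2 + (v - q)\<^sup>2) =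
      2 * (u - p) * (2 * p - q) + 2 * (v - q) * (2 * q - p) + ((u - p) - (v - q))\<^sup>2"
    by (simp add: power2_eq_square algebra_simps)
  moreover have "0 \<le> 2 * (u - p) * (2 * p - q)" "0 \<le> 2 * (v - q) * (2 * q - p)"
    using assms by auto
  ultimately show ?thesis using zero_le_power2[of "(u - p) - (v - q)"] by linarith
qed

locale realised_difference =
  fixes L :: "((rat^3) \<times> (rat^6) \<times> rat) list" and g h :: "3 \<Rightarrow> real^3 \<Rightarrow> real"
  assumes constraint_iff: "\<And>x u. (x, u) \<in> constraint_set (difference_mpc L) \<longleftrightarrow>
      (\<forall>i. g i x \<le> u $ lo i \<and> h i x \<le> u $ hi i)"
    and balanced: "\<And>i. balanced (g i) (h i)"
begin

abbreviation I where "I \<equiv> difference_mpc L"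

definition best :: "real^3 \<Rightarrow> real^6" where
  "best x = (\<chi> j. if j \<in> range lo then g (inv lo j) x else h (inv hi j) x)"

lemma best_simps: "best x $ lo i = g i x" "best x $ hi i = h i x"
  using lo_neq_hi[of _ i, symmetric] by (auto simp: best_def inv_f_f lo_hi)

lemma feasible_iff:
  "mpc_feasible I x (x0, u, x1) \<longleftrightarrow>
    x0 = x \<and> x1 = plant I x u \<and> (\<forall>i. g i x \<le> u $ lo i \<and> h i x \<le> u $ hi i)"
  by (auto simp: mpc_feasible_def constraint_iff)

lemma feasible_best: "mpc_feasible I x (x, best x, plant I x (best x))"
  by (simp add: feasible_iff best_simps)

lemma cost_best:
  assumes "mpc_feasible I x (x0, u, x1)"
  shows "mpc_cost I (x, best x, plant I x (best x)) + (u - best x) \<bullet> (u - best x) \<le> mpc_cost I (x0, u, x1)"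
proof -
  have u: "x0 = x" "x1 = plant I x u" "\<And>i. g i x \<le> u $ lo i" "\<And>i. h i x \<le> u $ hi i"
    using assms by (auto simp: feasible_iff)
  have "(g i x)\<^sup>2 + (h i x)\<^sup>2 + (g i x - h i x)\<^sup>2 + (u $ lo i - g i x)\<^sup>2 + (u $ hi i - h i x)\<^sup>2 \<le>
      (u $ lo i)\<^sup>2 + (u $ hi i)\<^sup>2 + (u $ lo i - u $ hi i)\<^sup>2" for i
    using balanced[of i] u by (intro difference_cost_bound) (auto simp: balanced_def)
  then have "(\<Sum>i\<in>UNIV. (g i x)\<^sup>2 + (h i x)\<^sup>2 + (g i x - h i x)\<^sup>2 + (u $ lo i - g i x)\<^sup>2 + (u $ hi i - h i x)\<^sup>2) \<le>
      (\<Sum>i\<in>UNIV. (u $ lo i)\<^sup>2 + (u $ hi i)\<^sup>2 + (u $ lo i - u $ hi i)\<^sup>2)"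
    by (intro sum_mono) auto
  then show ?thesis
    by (simp add: cost_difference_mpc plant_difference_mpc u inner_vec_def sum_lo_hi best_simps
        sum.distrib power2_eq_square)
qed

lemma optimizer_iff:
  "mpc_optimizer I x z \<longleftrightarrow> z = (x, best x, plant I x (best x))"
proof
  assume opt: "mpc_optimizer I x z"
  obtain x0 u x1 where z: "z = (x0, u, x1)" by (cases z)
  have feas: "mpc_feasible I x (x0, u, x1)"
    using opt by (simp add: mpc_optimizer_def is_arg_min_def z)
  have "\<not> mpc_cost I (x, best x, plant I x (best x)) < mpc_cost I (x0, u, x1)"
    using opt feasible_best by (auto simp: mpc_optimizer_def is_arg_min_def z)
  then have "(u - best x) \<bullet> (u - best x) \<le> 0" using cost_best[OF feas] by simp
  then have "u = best x" by (metis inner_ge_zero inner_eq_zero_iff order_antisym right_minus_eq)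
  then show "z = (x, best x, plant I x (best x))" using feas z by (simp add: feasible_iff)
next
  assume z: "z = (x, best x, plant I x (best x))"
  have "\<not> mpc_cost I y < mpc_cost I z" if "mpc_feasible I x y" for y
  proof -
    obtain x0 u x1 where y: "y = (x0, u, x1)" by (cases y)
    show ?thesis
      using cost_best[OF that[unfolded y]] inner_ge_zero[of "u - best x"] unfolding y z by linarith
  qed
  then show "mpc_optimizer I x z"
    using feasible_best by (auto simp: mpc_optimizer_def is_arg_min_def z)
qed

lemma closed_loop_eq: "closed_loop I x = (\<chi> i. g i x - h i x)"
proof -
  have "optimal_input I x = best x"
    unfolding optimal_input_def by (rule the_equality) (auto simp: optimizer_iff)
  then show ?thesis by (simp add: closed_loop_def plant_difference_mpc best_simps)
qed

lemma feasible_states_eq: "feasible_states I = UNIV"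
  using feasible_best by (auto simp: feasible_states_def)

lemma in_class: "I \<in> everywhere_feasible_instances"
proof -
  have sd: "pos_semidef (mat 1 :: real^3^3)" and pd: "pos_def (mat 1 :: real^6^6)"
    by (auto simp: pos_semidef_def pos_def_def transpose_mat)
  have "(0, 0) \<in> constraint_set I"
    using balanced by (auto simp: constraint_iff balanced_def)
  moreover have weights: "weight_Q I = mat 1" "weight_R I = mat 1" "weight_P I = mat 1"
    by (simp_all add: difference_mpc_def)
  ultimately have "mpc_instance I"
    using sd pd by (simp add: mpc_instance_def real_mat_1)
  moreover have "\<exists>!z. mpc_optimizer I x z" for x
    unfolding optimizer_iff by blast
  ultimately show ?thesis
    unfolding everywhere_feasible_instances_def identity_weight_instances_def
    by (simp add: feasible_states_eq weights)
qed

lemma stable_iff: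
  "globally_asymptotically_stable I \<longleftrightarrow>
    (\<forall>\<epsilon>>0. \<exists>\<delta>>0. \<forall>x. norm x < \<delta> \<longrightarrow> (\<forall>k. norm ((closed_loop I ^^ k) x) < \<epsilon>)) \<and>
    (\<forall>x. (\<lambda>k. (closed_loop I ^^ k) x) \<longlonglongrightarrow> 0)"
  by (simp add: globally_asymptotically_stable_def lyapunov_stable_def feasible_states_eq)

end

definition piece_inequality :: "6 \<Rightarrow> (rat^3) \<times> rat \<Rightarrow> (rat^3) \<times> (rat^6) \<times> rat" where
  "piece_inequality j p = (fst p, - axis j 1, - snd p)"

lemma real_vec_axis_inner: "real_vec (c *s axis j 1) \<bullet> u = of_rat c * u $ j"
  by (simp add: inner_vec_def axis_def if_distrib[of of_rat] if_distrib[of "\<lambda>t. c * t"]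
      if_distrib[of "\<lambda>t. t * _"] cong: if_cong)

lemma real_vec_scale_inner: "real_vec (c *s a) \<bullet> x = of_rat c * (real_vec a \<bullet> x)"
  by (simp add: inner_vec_def of_rat_mult sum_distrib_left mult.assoc)

lemma piece_inequality_iff:
  "(case piece_inequality j p of (a, b, c) \<Rightarrow> real_vec a \<bullet> x + real_vec b \<bullet> u \<le> of_rat c) \<longleftrightarrow>
    aff p x \<le> u $ j"
  using real_vec_axis_inner[of "-1" j u]
  by (simp add: piece_inequality_def aff_def of_rat_minus) linarith

text \<open>A positive multiple \<open>D\<close> clears the denominator of the constant \<open>snd p \<le> 0\<close>, so that the
  number \<open>N\<close> enters through the natural number \<open>D 2\<^sup>N + e\<close> alone.\<close>

lemma realise_capped:
  fixes g h :: "3 \<Rightarrow> real^3 \<Rightarrow> real" and p :: "(rat^3) \<times> rat"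
  assumes g: "\<And>i. max_affine (g i)" and h: "\<And>i. max_affine (h i)" and p: "snd p \<le> 0"
    and bal: "\<And>i N. balanced (g i) (\<lambda>x. if i = 1 then max (h 1 x) (aff p x - 2 ^ N) else h i x)"
  shows "\<exists>L D e a b. 0 < D \<and> (\<forall>N :: nat. realised_difference (L @ [(a, b, of_nat (D * 2 ^ N + e))]) g
    (\<lambda>i x. if i = 1 then max (h 1 x) (aff p x - 2 ^ N) else h i x))"
proof -
  obtain G H where G: "\<And>i. G i \<noteq> [] \<and> g i = max_aff (G i)" and H: "\<And>i. H i \<noteq> [] \<and> h i = max_aff (H i)"
    using g h unfolding max_affine_def by metis
  obtain n d where nd: "quotient_of (snd p) = (n, d)" by fastforce
  have d: "0 < d" and pnd: "snd p = of_int n / of_int d"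
    using quotient_of_denom_pos[OF nd] quotient_of_div[OF nd] by auto
  have n: "n \<le> 0" using p d pnd by (simp add: divide_le_0_iff)
  define D e where "D = nat d" and "e = nat (- n)"
  define L where "L = concat (map (\<lambda>i. map (piece_inequality (lo i)) (G i) @ map (piece_inequality (hi i)) (H i))
    (enum_class.enum :: 3 list))"
  define a b where "a = of_int d *s fst p" and "b = of_int (- d) *s axis (hi 1) (1 :: rat)"
  have D: "real D = of_int d" "real e = - of_int n" "0 < D" using d n by (auto simp: D_def e_def)
  have L_iff: "(\<forall>(a, b, c)\<in>set L. real_vec a \<bullet> x + real_vec b \<bullet> u \<le> of_rat c) \<longleftrightarrow>
      (\<forall>i. g i x \<le> u $ lo i \<and> h i x \<le> u $ hi i)" for x u
  proof -
    have "set L = (\<Union>i. piece_inequality (lo i) ` set (G i) \<union> piece_inequality (hi i) ` set (H i))"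
      by (simp add: L_def enum_UNIV)
    then have "(\<forall>t\<in>set L. case t of (a, b, c) \<Rightarrow> real_vec a \<bullet> x + real_vec b \<bullet> u \<le> of_rat c) \<longleftrightarrow>
        (\<forall>i. (\<forall>q\<in>set (G i). aff q x \<le> u $ lo i) \<and> (\<forall>q\<in>set (H i). aff q x \<le> u $ hi i))"
      by (simp only: ball_UN ball_Un ball_simps piece_inequality_iff UNIV_I simp_thms)
    then show ?thesis using G H by (simp add: max_aff_le_iff)
  qed
  have slot_iff: "real_vec a \<bullet> x + real_vec b \<bullet> u \<le> of_rat (of_nat (D * 2 ^ N + e)) \<longleftrightarrow>
      aff p x - 2 ^ N \<le> u $ hi 1" for x u N
  proof -
    have "of_rat (snd p) = (of_int n / of_int d :: real)"
      unfolding pnd by (simp add: of_rat_divide)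
    then have aff_p: "of_int d * aff p x = of_int d * (real_vec (fst p) \<bullet> x) + of_int n"
      using d by (simp add: aff_def algebra_simps)
    have fa: "real_vec a \<bullet> x = of_int d * (real_vec (fst p) \<bullet> x)"
      using real_vec_scale_inner[of "of_int d" "fst p" x] by (simp add: a_def)
    have fb: "real_vec b \<bullet> u = - of_int d * u $ hi 1"
      unfolding b_def real_vec_axis_inner by (simp add: of_rat_minus)
    have fc: "of_rat (of_nat (D * 2 ^ N + e)) = of_int d * 2 ^ N - (of_int n :: real)"
      using D by (simp add: of_rat_add of_rat_mult of_rat_power)
    have "real_vec a \<bullet> x + real_vec b \<bullet> u \<le> of_rat (of_nat (D * 2 ^ N + e)) \<longleftrightarrow>
        of_int d * (aff p x - 2 ^ N) \<le> of_int d * u $ hi 1"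
      unfolding fa fb fc right_diff_distrib aff_p by linarith
    also have "\<dots> \<longleftrightarrow> aff p x - 2 ^ N \<le> u $ hi 1" using d by (simp add: mult_le_cancel_left)
    finally show ?thesis .
  qed
  have "realised_difference (L @ [(a, b, of_nat (D * 2 ^ N + e))]) g
      (\<lambda>i x. if i = 1 then max (h 1 x) (aff p x - 2 ^ N) else h i x)" for N
  proof (unfold_locales, goal_cases)
    case (1 x u)
    have "(x, u) \<in> constraint_set (difference_mpc (L @ [(a, b, of_nat (D * 2 ^ N + e))])) \<longleftrightarrow>
        (\<forall>i. g i x \<le> u $ lo i \<and> h i x \<le> u $ hi i) \<and> aff p x - 2 ^ N \<le> u $ hi 1"
      unfolding L_iff[symmetric] slot_iff[symmetric]
      by (auto simp: constraint_set_def difference_mpc_def simp del: of_nat_add of_nat_mult)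
    then show ?case by (auto split: if_splits)
  qed (rule bal)
  then show ?thesis using D(3) by blast
qed

section \<open>Fuel\<close>

text \<open>
  A three-dimensional map simulates a sequence \<open>(u n, w n)\<close> in its first two coordinates.  The third
  coordinate is fuel: it decreases by one in every step, and it is lost at once if it does not
  exceed \<open>\<eta>\<close> times the size of the other two.  Only where the map resets to \<open>(u 0, w 0)\<close>
  exactly can fuel be gained (the gain is \<open>B\<close>), so that garbage cannot survive.
\<close>

locale fuel_map =
  fixes f :: "real^3 \<Rightarrow> real^3" and B :: "real^3 \<Rightarrow> real" and u w :: "nat \<Rightarrow> real" and \<eta> :: real
  assumes f12: "\<And>x. 0 \<le> f x $ 1 \<and> f x $ 1 \<le> max 0 (x $ 3) \<and> 0 \<le> f x $ 2 \<and> f x $ 2 \<le> max 0 (x $ 3)"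
    and f3: "\<And>x. f x $ 3 = max 0 (min (x $ 3 - 1) (2 * x $ 3 - 2 * \<eta> * (\<bar>x $ 1\<bar> + \<bar>x $ 2\<bar>))) + B x"
    and B_nonneg: "\<And>x. 0 \<le> B x"
    and B_low: "\<And>x. x $ 3 \<le> 1 \<Longrightarrow> B x = 0"
    and B_reset: "\<And>x. 0 < B x \<Longrightarrow> f x $ 1 = u 0 \<and> f x $ 2 = w 0"
begin

lemma zero_low: "x $ 3 \<le> 0 \<Longrightarrow> f x = 0"
  using f12[of x] f3[of x] B_low[of x] by (simp add: vec_eq_iff forall_3)

lemma f3_no_gain: "B x = 0 \<Longrightarrow> f x $ 3 \<le> max 0 (x $ 3 - 1)"
  unfolding f3[of x] using min.cobounded1[of "x $ 3 - 1"] by (auto intro: max.mono)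

lemma funpow_zero: "(f ^^ k) 0 = 0"
  using zero_low[of 0] by (induction k) simp_all

text \<open>A state of norm below 1 has less than one unit of fuel and gains none, so its fuel is
  gone after one step and the state is 0 after two. The state in between has coordinates bounded by
  the old fuel, hence by the old norm.\<close>

lemma stable:
  "\<forall>\<epsilon>>0. \<exists>\<delta>>0. \<forall>x. norm x < \<delta> \<longrightarrow> (\<forall>k. norm ((f ^^ k) x) < \<epsilon>)"
proof (intro allI impI)
  fix \<epsilon> :: real assume "\<epsilon> > 0"
  have "norm ((f ^^ k) x) < \<epsilon>" if x: "norm x < min 1 (\<epsilon> / 2)" for x k
  proof -
    have z: "\<bar>x $ 3\<bar> \<le> norm x" by (rule component_le_norm_cart)
    then have B: "B x = 0" using x by (intro B_low) auto
    then have f0: "f x $ 3 = 0" using f3[of x] z x by auto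
    have "norm (f x) \<le> (\<Sum>i\<in>UNIV. \<bar>f x $ i\<bar>)" by (rule norm_le_l1_cart)
    also have "\<dots> \<le> 2 * norm x"
    proof -
      have "max 0 (x $ 3) \<le> norm x" using z by auto
      then have "f x $ 1 \<le> norm x" "f x $ 2 \<le> norm x" using f12[of x] by linarith+
      then show ?thesis using f12[of x] f0 by (simp add: sum_3)
    qed
    finally have fx: "norm (f x) < \<epsilon>" using x by simp
    have "f (f x) = 0" by (rule zero_low) (simp add: f0)
    then have "(f ^^ Suc (Suc j)) x = 0" for j
      by (simp only: funpow_Suc_right comp_apply funpow_zero)
    then show ?thesis
      using x fx \<open>\<epsilon> > 0\<close> by (cases k rule: nat.exhaust; cases "k - 1") auto
  qed
  then show "\<exists>\<delta>>0. \<forall>x. norm x < \<delta> \<longrightarrow> (\<forall>k. norm ((f ^^ k) x) < \<epsilon>)"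
    using \<open>\<epsilon> > 0\<close> by (intro exI[of _ "min 1 (\<epsilon> / 2)"]) auto
qed

definition dies :: "real^3 \<Rightarrow> bool" where
  "dies x \<longleftrightarrow> (\<exists>k. (f ^^ k) x = 0)"

lemma dies_step: "dies (f x) \<Longrightarrow> dies x"
  unfolding dies_def by (metis funpow_Suc_right comp_apply)

lemma dies_low: "x $ 3 \<le> 0 \<Longrightarrow> dies x"
  using zero_low[of x] unfolding dies_def by (intro exI[of _ 1]) simp

lemma dies_tendsto: "dies x \<Longrightarrow> (\<lambda>k. (f ^^ k) x) \<longlonglongrightarrow> 0"
proof -
  assume "dies x"
  then obtain k where "(f ^^ k) x = 0" unfolding dies_def by blast
  then have "(f ^^ (n + k)) x = 0" for n by (simp add: funpow_add funpow_zero)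
  then have "(\<lambda>n. (f ^^ (n + k)) x) \<longlonglongrightarrow> 0" by simp
  then show ?thesis by (rule LIMSEQ_offset)
qed

text \<open>Without a gain an orbit loses a unit of fuel per step and dies. A gain puts it exactly
  at the start of the simulated sequence; from there it either follows the sequence, which never
  offers a gain, or drops below the fuel threshold. Either way it dies.\<close>

lemma attractive:
  assumes no_gain: "\<And>n x. x $ 1 = u n \<Longrightarrow> x $ 2 = w n \<Longrightarrow> B x = 0"
    and follow: "\<And>n x. x $ 1 = u n \<Longrightarrow> x $ 2 = w n \<Longrightarrow> x $ 3 > \<eta> * (\<bar>x $ 1\<bar> + \<bar>x $ 2\<bar>) \<Longrightarrow>
      f x $ 1 = u (Suc n) \<and> f x $ 2 = w (Suc n)"
  shows "(\<lambda>k. (f ^^ k) x) \<longlonglongrightarrow> 0"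
proof -
  have run: "dies x" if "x $ 1 = u n" "x $ 2 = w n" "x $ 3 \<le> real m" for m n x
    using that
  proof (induction m arbitrary: n x)
    case (Suc m)
    have "B x = 0" using Suc.prems by (intro no_gain)
    then have le: "f x $ 3 \<le> max 0 (x $ 3 - 1)" by (rule f3_no_gain)
    show ?case
    proof (cases "x $ 3 > \<eta> * (\<bar>x $ 1\<bar> + \<bar>x $ 2\<bar>)")
      case True
      then have "f x $ 1 = u (Suc n)" "f x $ 2 = w (Suc n)" using follow Suc.prems by blast+
      moreover have "f x $ 3 \<le> real m" using le Suc.prems(3) by simp
      ultimately show ?thesis by (rule dies_step[OF Suc.IH])
    next
      case False
      then have "f x $ 3 = 0" using f3[of x] \<open>B x = 0\<close> by auto
      then show ?thesis by (intro dies_step[OF dies_low]) auto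
    qed
  qed (simp add: dies_low)
  have "dies x" if "x $ 3 \<le> real m" for m x
    using that
  proof (induction m arbitrary: x)
    case (Suc m)
    show ?case
    proof (cases "B x = 0")
      case True
      then have "f x $ 3 \<le> max 0 (x $ 3 - 1)" by (rule f3_no_gain)
      then have "f x $ 3 \<le> real m" using Suc.prems by simp
      then show ?thesis by (rule dies_step[OF Suc.IH])
    next
      case False
      then have "f x $ 1 = u 0 \<and> f x $ 2 = w 0" using B_nonneg[of x] by (intro B_reset) auto
      moreover obtain n where "f x $ 3 \<le> real n" using real_arch_simple by blast
      ultimately show ?thesis using dies_step[OF run[of "f x" 0 n]] by auto
    qed
  qed (simp add: dies_low)
  moreover obtain m where "x $ 3 \<le> real m" using real_arch_simple by blast
  ultimately show ?thesis by (intro dies_tendsto) auto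
qed

text \<open>A cycle of \<open>T + 1\<close> steps spends \<open>T + 1\<close> units of fuel, and the
  gain in its last step returns them. The orbit is therefore back at the start with at least
  \<open>z0\<close> units after every cycle.\<close>

lemma not_attractive:
  assumes no_gain: "\<And>n x. n < T \<Longrightarrow> x $ 1 = u n \<Longrightarrow> x $ 2 = w n \<Longrightarrow> B x = 0"
    and follow: "\<And>n x. n < T \<Longrightarrow> x $ 1 = u n \<Longrightarrow> x $ 2 = w n \<Longrightarrow>
      x $ 3 > \<eta> * (\<bar>x $ 1\<bar> + \<bar>x $ 2\<bar>) \<Longrightarrow> f x $ 1 = u (Suc n) \<and> f x $ 2 = w (Suc n)"
    and gain: "\<And>x. x $ 1 = u T \<Longrightarrow> x $ 2 = w T \<Longrightarrow> B x \<ge> min (real T + 1) (x $ 3 - Z)"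
    and "0 \<le> \<eta>"
  shows "\<exists>x. \<not> (\<lambda>k. (f ^^ k) x) \<longlonglongrightarrow> 0"
proof -
  define b where "b = (\<Sum>n\<le>T. \<eta> * (\<bar>u n\<bar> + \<bar>w n\<bar>))"
  have b: "\<eta> * (\<bar>u n\<bar> + \<bar>w n\<bar>) \<le> b" if "n \<le> T" for n
    unfolding b_def using \<open>0 \<le> \<eta>\<close> that by (intro member_le_sum) auto
  have "0 \<le> b" unfolding b_def using \<open>0 \<le> \<eta>\<close> by (intro sum_nonneg) auto
  \<comment> \<open>During a cycle at least \<open>z0 - T = 2 * b + |Z| + T + 2\<close> units are
    left. The part \<open>2 * b\<close> keeps the minimum in the fuel law equal to
    \<open>x $ 3 - 1\<close>; the rest makes \<open>x $ 3 - Z\<close> at least \<open>T + 1\<close>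
    when the gain is due.\<close>
  define z0 where "z0 = 2 * b + \<bar>Z\<bar> + 2 * real T + 2"
  have spend: "f x $ 3 = x $ 3 - 1 + B x"
    if "n \<le> T" "x $ 1 = u n" "x $ 2 = w n" "x $ 3 \<ge> z0 - real T" for n x
  proof -
    have "2 * x $ 3 - 2 * \<eta> * (\<bar>x $ 1\<bar> + \<bar>x $ 2\<bar>) \<ge> x $ 3 - 1" "x $ 3 \<ge> 1"
      using b[OF that(1)] that \<open>0 \<le> b\<close> by (auto simp: z0_def)
    then show ?thesis using f3[of x] by auto
  qed
  have run: "(f ^^ n) x $ 1 = u n \<and> (f ^^ n) x $ 2 = w n \<and> (f ^^ n) x $ 3 = x $ 3 - real n"
    if x: "x $ 1 = u 0" "x $ 2 = w 0" "x $ 3 \<ge> z0" and "n \<le> T" for n x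
    using \<open>n \<le> T\<close>
  proof (induction n)
    case (Suc n)
    let ?y = "(f ^^ n) x"
    have y: "?y $ 1 = u n" "?y $ 2 = w n" "?y $ 3 = x $ 3 - real n" using Suc by auto
    have "?y $ 3 \<ge> z0 - real T" using y x Suc.prems by simp
    moreover have "?y $ 3 > \<eta> * (\<bar>?y $ 1\<bar> + \<bar>?y $ 2\<bar>)"
      using y x Suc.prems b[of n] \<open>0 \<le> b\<close> by (auto simp: z0_def)
    ultimately show ?case
      using spend[of n ?y] no_gain[of n ?y] follow[of n ?y] y Suc.prems by simp
  qed (use x in simp)
  have cycle: "(f ^^ Suc T) x $ 1 = u 0 \<and> (f ^^ Suc T) x $ 2 = w 0 \<and> (f ^^ Suc T) x $ 3 \<ge> z0"
    if x: "x $ 1 = u 0" "x $ 2 = w 0" "x $ 3 \<ge> z0" for x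
  proof -
    let ?y = "(f ^^ T) x"
    have y: "?y $ 1 = u T" "?y $ 2 = w T" "?y $ 3 = x $ 3 - real T" using run[OF x, of T] by auto
    have B: "B ?y \<ge> real T + 1"
      using gain[OF y(1,2)] y(3) x \<open>0 \<le> b\<close> by (auto simp: z0_def)
    then have "f ?y $ 1 = u 0 \<and> f ?y $ 2 = w 0" by (intro B_reset) auto
    moreover have "f ?y $ 3 \<ge> z0" using spend[of T ?y] y x B by simp
    ultimately show ?thesis by simp
  qed
  define x :: "real^3" where "x = vector [u 0, w 0, z0]"
  have cycles: "(f ^^ (Suc T * n)) x $ 1 = u 0 \<and> (f ^^ (Suc T * n)) x $ 2 = w 0 \<and>
      (f ^^ (Suc T * n)) x $ 3 \<ge> z0" for n
  proof (induction n)
    case (Suc n)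
    have "(f ^^ (Suc T * Suc n)) x = (f ^^ Suc T) ((f ^^ (Suc T * n)) x)"
      by (simp only: mult_Suc_right funpow_add comp_apply)
    with cycle Suc show ?case by metis
  qed (simp add: x_def)
  have "\<not> (\<lambda>k. (f ^^ k) x) \<longlonglongrightarrow> 0"
  proof
    assume "(\<lambda>k. (f ^^ k) x) \<longlonglongrightarrow> 0"
    moreover have "strict_mono (\<lambda>n. Suc T * n)" by (intro strict_monoI) (simp add: add_less_le_mono)
    ultimately have "((\<lambda>k. (f ^^ k) x) \<circ> (\<lambda>n. Suc T * n)) \<longlonglongrightarrow> 0"
      by (rule LIMSEQ_subseq_LIMSEQ)
    then have "(\<lambda>n. (f ^^ (Suc T * n)) x $ 3) \<longlonglongrightarrow> 0 $ (3::3)"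
      unfolding comp_def by (rule tendsto_vec_nth)
    then have "z0 \<le> 0 $ (3::3)"
      using cycles by (intro LIMSEQ_le_const[of _ "0 $ 3" z0]) auto
    then show False using \<open>0 \<le> b\<close> by (simp add: z0_def)
  qed
  then show ?thesis by blast
qed

end

section \<open>Two-counter machines\<close>

datatype 's rule = Rule (src: 's) (amin: nat) (amax: "nat option") (bmin: nat) (bmax: "nat option")
  (tgt: 's) (da: int) (db: int)

fun applies :: "'s rule \<Rightarrow> 's \<times> nat \<times> nat \<Rightarrow> bool" where
  "applies \<rho> (q, a, b) \<longleftrightarrow> q = src \<rho> \<and> amin \<rho> \<le> a \<and> (\<forall>n. amax \<rho> = Some n \<longrightarrow> a \<le> n) \<and>
    bmin \<rho> \<le> b \<and> (\<forall>n. bmax \<rho> = Some n \<longrightarrow> b \<le> n)"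

fun act :: "'s rule \<Rightarrow> 's \<times> nat \<times> nat \<Rightarrow> 's \<times> nat \<times> nat" where
  "act \<rho> (q, a, b) = (tgt \<rho>, nat (int a + da \<rho>), nat (int b + db \<rho>))"

definition safe :: "'s rule \<Rightarrow> bool" where
  "safe \<rho> \<longleftrightarrow> 0 \<le> int (amin \<rho>) + da \<rho> \<and> 0 \<le> int (bmin \<rho>) + db \<rho>"

text \<open>This set contains all continuations that occur in a run from the argument, loops in
  progress included. It is finite, which gives the counter machine finitely many states.\<close>

fun conts :: "instr list \<Rightarrow> instr list set" where
  "conts [] = {[]}"
| "conts (Inc r # k) = insert (Inc r # k) (conts k)"
| "conts (Loop r B # k) = insert (Loop r B # k) (conts k \<union> (\<lambda>j. j @ Loop r B # k) ` conts B)"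

lemma conts_self: "k \<in> conts k"
  by (induction k rule: conts.induct) auto

lemma finite_conts: "finite (conts k)"
  by (induction k rule: conts.induct) auto

lemma conts_Inc: "Inc r # j \<in> conts k \<Longrightarrow> j \<in> conts k"
proof (induction k arbitrary: j rule: conts.induct)
  case (3 r' B k)
  then consider "Inc r # j \<in> conts k" | i where "i \<in> conts B" "Inc r # j = i @ Loop r' B # k"
    by auto
  then show ?case
  proof cases
    case 2
    then obtain i' where "i = Inc r # i'" "j = i' @ Loop r' B # k" by (cases i) auto
    with 2 3 show ?thesis by auto
  qed (use 3 in auto)
qed (auto simp: conts_self)

lemma conts_Loop:
  "Loop r C # j \<in> conts k \<Longrightarrow> j \<in> conts k \<and> C @ Loop r C # j \<in> conts k"
proof (induction k arbitrary: j rule: conts.induct)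
  case (3 r' B k)
  then consider "Loop r C # j = Loop r' B # k" | "Loop r C # j \<in> conts k"
    | i where "i \<in> conts B" "Loop r C # j = i @ Loop r' B # k"
    by auto
  then show ?case
  proof cases
    case 1
    then show ?thesis by (auto simp: conts_self)
  next
    case (3 i)
    show ?thesis
    proof (cases i)
      case Nil
      with 3 show ?thesis by (auto simp: conts_self)
    next
      case (Cons x i')
      with 3 have i: "i = Loop r C # i'" "j = i' @ Loop r' B # k" by auto
      with "3.IH"(2)[of i'] 3 have "i' \<in> conts B" "C @ Loop r C # i' \<in> conts B" by auto
      then show ?thesis using i by force
    qed
  qed (use 3 in auto)
qed auto

fun registers_below :: "nat \<Rightarrow> instr list \<Rightarrow> bool" where
  "registers_below n [] \<longleftrightarrow> True"
| "registers_below n (Inc r # k) \<longleftrightarrow> r < n \<and> registers_below n k"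
| "registers_below n (Loop r B # k) \<longleftrightarrow> r < n \<and> registers_below n B \<and> registers_below n k"

lemma registers_below_append:
  "registers_below n (j @ k) \<longleftrightarrow> registers_below n j \<and> registers_below n k"
  by (induction j rule: conts.induct) auto

lemma registers_below_mono: "registers_below m k \<Longrightarrow> m \<le> n \<Longrightarrow> registers_below n k"
  by (induction k rule: conts.induct) simp_all

lemma registers_below_ex: "\<exists>n. registers_below n k"
proof (induction k rule: conts.induct)
  case (2 r k)
  then obtain n where "registers_below n k" ..
  then show ?case
    using registers_below_mono[of n k "max (Suc r) n"] by (intro exI[of _ "max (Suc r) n"]) auto
next
  case (3 r B k)
  then obtain m n where "registers_below m k" "registers_below n B" by blast
  then show ?case
    using registers_below_mono[of m k "max (Suc r) (max m n)"]
      registers_below_mono[of n B "max (Suc r) (max m n)"]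
    by (intro exI[of _ "max (Suc r) (max m n)"]) auto
qed auto

lemma registers_below_conts: "registers_below n k \<Longrightarrow> j \<in> conts k \<Longrightarrow> registers_below n j"
proof (induction k arbitrary: j rule: conts.induct)
  case (3 r B k)
  from "3.prems"(2) consider "j = Loop r B # k" | "j \<in> conts k"
    | i where "i \<in> conts B" "j = i @ Loop r B # k"
    by auto
  then show ?case
  proof cases
    case 1
    then show ?thesis using "3.prems"(1) by simp
  next
    case 2
    then show ?thesis using "3.IH"(1) "3.prems"(1) by simp
  next
    case (3 i)
    have "registers_below n i" using "3.IH"(2)[OF _ 3(1)] "3.prems"(1) by simp
    then show ?thesis using 3(2) "3.prems"(1) by (simp add: registers_below_append)
  qed
qed auto

section \<open>Prime codes of stores and the rules of the counter machine\<close>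

definition pr :: "nat \<Rightarrow> nat" where
  "pr = enumerate {p. prime p}"

lemma prime_pr: "prime (pr n)"
  using enumerate_in_set[OF primes_infinite, of n] by (simp add: pr_def)

lemma pr_less_iff: "pr m < pr n \<longleftrightarrow> m < n"
  using strict_mono_less[OF strict_mono_enumerate[OF primes_infinite]] by (simp add: pr_def)

lemma pr_eq_iff: "pr m = pr n \<longleftrightarrow> m = n"
  using pr_less_iff[of m n] pr_less_iff[of n m] by (metis less_irrefl linorder_neqE_nat)

lemma pr_ge_2: "2 \<le> pr n"
  using prime_ge_2_nat[OF prime_pr] .

lemma pr_pos: "0 < pr n"
  using pr_ge_2[of n] by simp

lemma pr_nonzero: "pr n \<noteq> 0"
  using pr_pos[of n] by simp

text \<open>\<open>Ld\<close> loads the input, \<open>M k\<close> executes the continuation \<open>k\<close> with its store coded as the second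
  counter, \<open>R c k\<close> moves \<open>c\<close> times the first counter back to the second one.\<close>

datatype mstate = Ld | M "instr list" | R nat "instr list"

instance mstate :: countable
  by countable_datatype

type_synonym config = "mstate \<times> nat \<times> nat"

locale machine =
  fixes P :: "instr list" and nr :: nat
  assumes P_nonempty: "P \<noteq> []" and below: "registers_below nr P"
begin

text \<open>
  A store is coded by a product of prime powers.  In addition every step multiplies by the clock
  prime \<open>cl\<close>, which exceeds all other primes in use: the code strictly increases.
\<close>

abbreviation cl :: nat where "cl \<equiv> pr nr"

definition code :: "nat \<Rightarrow> store \<Rightarrow> nat" where
  "code t s = cl ^ t * (\<Prod>r<nr. pr r ^ s r)"

text \<open>Let \<open>n\<close> be the code in the second counter. An increment moves
  \<open>n\<close> to the first counter, and \<open>R\<close> brings it back multiplied. A loop test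
  is a division by \<open>pr r\<close> that adds \<open>cl\<close> to the first counter for each
  \<open>pr r\<close> removed. With no remainder, the result is the quotient times
  \<open>cl\<close>. A remainder \<open>i\<close> is enlarged to \<open>cl * i\<close>, and
  \<open>R (pr r)\<close> undoes the division, which gives \<open>cl * n\<close>.\<close>

fun M_rules :: "instr list \<Rightarrow> mstate rule set" where
  "M_rules [] = {}"
| "M_rules (Inc r # k) =
    {Rule (M (Inc r # k)) 0 None 1 None (M (Inc r # k)) 1 (-1),
     Rule (M (Inc r # k)) 0 None 0 (Some 0) (R (pr r * cl) k) 0 0}"
| "M_rules (Loop r B # k) =
    {Rule (M (Loop r B # k)) 0 None (pr r) None (M (Loop r B # k)) (int cl) (- int (pr r)),
     Rule (M (Loop r B # k)) 0 None 0 (Some 0) (R 1 (B @ Loop r B # k)) 0 0} \<union>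
    (\<lambda>i. Rule (M (Loop r B # k)) 0 None i (Some i) (R (pr r) k) 0 (int ((cl - 1) * i))) ` {1..<pr r}"

definition R_rules :: "nat \<Rightarrow> instr list \<Rightarrow> mstate rule set" where
  "R_rules c k =
    {Rule (R c k) 1 None 0 None (R c k) (-1) (int c), Rule (R c k) 0 (Some 0) 0 None (M k) 0 0}"

definition load_rule :: "mstate rule" where
  "load_rule = Rule Ld 1 (Some 1) 0 None Ld 0 1"

text \<open>The multipliers that occur are \<open>1\<close>, \<open>pr r\<close> and
  \<open>pr r * cl\<close> for \<open>r < nr\<close>; all of them are at most
  \<open>cl * cl\<close>.\<close>

definition rules :: "mstate rule set" where
  "rules = insert load_rule ((\<Union>k\<in>conts P. M_rules k) \<union> (\<Union>k\<in>conts P. \<Union>c\<le>cl * cl. R_rules c k))"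

definition states :: "mstate set" where
  "states = insert Ld (M ` conts P \<union> (\<lambda>(c, k). R c k) ` ({..cl * cl} \<times> conts P))"

lemma finite_rules: "finite rules"
proof -
  have "finite (M_rules k)" for k by (induction k rule: M_rules.induct) auto
  then show ?thesis by (auto simp: rules_def R_rules_def finite_conts)
qed

lemma finite_states: "finite states"
  by (auto simp: states_def finite_conts)

lemma M_rules_src: "\<rho> \<in> M_rules k \<Longrightarrow> src \<rho> = M k \<and> k \<noteq> []"
  by (induction k rule: M_rules.induct) auto

lemma src_not_final: "\<rho> \<in> rules \<Longrightarrow> src \<rho> \<noteq> M []"
  by (auto simp: rules_def load_rule_def R_rules_def dest: M_rules_src)

lemma safe_rules: "\<rho> \<in> rules \<Longrightarrow> safe \<rho>"
proof -
  have "safe \<rho>" if "\<rho> \<in> M_rules k" for k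
    using that by (induction k rule: M_rules.induct) (auto simp: safe_def)
  then show "\<rho> \<in> rules \<Longrightarrow> safe \<rho>"
    by (auto simp: rules_def load_rule_def R_rules_def safe_def)
qed

lemma tgt_rules:
  assumes "\<rho> \<in> rules"
  shows "tgt \<rho> \<in> states"
proof -
  have M: "tgt \<rho> \<in> states" if \<rho>: "\<rho> \<in> M_rules k" and k: "k \<in> conts P" for k
    using \<rho>
  proof (cases k rule: M_rules.cases)
    case (2 r j)
    then have "r < nr" using registers_below_conts[OF below k] by simp
    then have "pr r * cl \<le> cl * cl" using pr_less_iff[of r nr] by simp
    then show ?thesis using \<rho> 2 k conts_Inc[of r j P] by (auto simp: states_def image_iff)
  next
    case (3 r B j)
    then have "r < nr" using registers_below_conts[OF below k] by simp
    then have "pr r \<le> cl" using pr_less_iff[of r nr] by simp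
    then have "pr r \<le> cl * cl" by (meson le_square order_trans)
    moreover have "1 \<le> cl * cl" using pr_pos[of nr] by simp
    ultimately show ?thesis using \<rho> 3 k conts_Loop[of r B j P] by (auto simp: states_def image_iff)
  qed auto
  show ?thesis
    using assms M by (auto simp: rules_def load_rule_def R_rules_def states_def)
qed

lemma deterministic:
  assumes "\<rho> \<in> rules" "\<rho>' \<in> rules" "applies \<rho> c" "applies \<rho>' c"
  shows "\<rho> = \<rho>'"
proof (cases c)
  case (fields q a b)
  show ?thesis
  proof (cases q)
    case Ld
    then show ?thesis using assms fields
      by (auto simp: rules_def R_rules_def dest: M_rules_src)
  next
    case (M k)
    have "\<sigma> \<in> M_rules k" if \<sigma>: "\<sigma> \<in> rules" "src \<sigma> = M k" for \<sigma>
    proof -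
      obtain j where "\<sigma> \<in> M_rules j"
        using \<sigma> by (auto simp: rules_def R_rules_def load_rule_def)
      then show ?thesis using M_rules_src[of \<sigma> j] \<sigma>(2) by simp
    qed
    then have \<rho>: "\<rho> \<in> M_rules k" "\<rho>' \<in> M_rules k" using assms fields M by auto
    have ab: "bmin \<rho> \<le> b" "bmin \<rho>' \<le> b"
      "\<forall>n. bmax \<rho> = Some n \<longrightarrow> b \<le> n" "\<forall>n. bmax \<rho>' = Some n \<longrightarrow> b \<le> n"
      using assms(3,4) fields by auto
    show ?thesis
    proof (cases k rule: M_rules.cases)
      case (2 r j)
      then show ?thesis using \<rho> ab by auto
    next
      case (3 r B j)
      have "pr r \<noteq> 0" by (rule pr_nonzero)
      have cases: "\<sigma> = Rule (M k) 0 None (pr r) None (M k) (int cl) (- int (pr r)) \<and> pr r \<le> b \<or>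
          \<sigma> = Rule (M k) 0 None 0 (Some 0) (R 1 (B @ k)) 0 0 \<and> b = 0 \<or>
          \<sigma> = Rule (M k) 0 None b (Some b) (R (pr r) j) 0 (int ((cl - 1) * b)) \<and> 0 < b \<and> b < pr r"
        if "\<sigma> \<in> M_rules k" "bmin \<sigma> \<le> b" "\<forall>n. bmax \<sigma> = Some n \<longrightarrow> b \<le> n" for \<sigma>
        using that unfolding 3 by (auto simp: Suc_le_eq)
      show ?thesis
        using cases[OF \<rho>(1) ab(1,3)] cases[OF \<rho>(2) ab(2,4)] \<open>pr r \<noteq> 0\<close>
        by (elim disjE conjE) (simp_all only: not_le not_less0 refl le_zero_eq less_irrefl)
    qed (use \<rho> in auto)
  next
    case (R n k)
    have "\<sigma> \<in> R_rules n k" if \<sigma>: "\<sigma> \<in> rules" "src \<sigma> = R n k" for \<sigma>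
      using \<sigma> by (auto simp: rules_def R_rules_def load_rule_def dest: M_rules_src)
    then have "\<rho> \<in> R_rules n k" "\<rho>' \<in> R_rules n k" using assms fields R by auto
    then show ?thesis using assms(3,4) fields
      by (auto simp: R_rules_def)
  qed
qed

text \<open>The last loading step depends on the input \<open>N\<close> and is therefore not an instance of a rule.\<close>

definition nxt :: "nat \<Rightarrow> config \<Rightarrow> config" where
  "nxt N c = (if c = (Ld, 1, N) then (M P, 0, N)
    else act (THE \<rho>. \<rho> \<in> rules \<and> applies \<rho> c) c)"

lemma nxt_rule:
  assumes "\<rho> \<in> rules" "applies \<rho> c" "c \<noteq> (Ld, 1, N)"
  shows "nxt N c = act \<rho> c"
proof -
  have "(THE \<rho>. \<rho> \<in> rules \<and> applies \<rho> c) = \<rho>"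
    using assms deterministic by blast
  then show ?thesis using assms(3) by (simp add: nxt_def)
qed

text \<open>The cap is tuned to loading with first counter 1, and the reset to halting with first
  counter 0; the invariant guarantees these values.\<close>

definition good :: "nat \<Rightarrow> config \<Rightarrow> bool" where
  "good N = (\<lambda>(q, a, b). q \<in> states \<and> (q = Ld \<longrightarrow> a = 1 \<and> b \<le> N) \<and> (q = M [] \<longrightarrow> a = 0))"

lemma good_start: "good N (Ld, 1, 0)"
  by (simp add: good_def states_def)

lemma rule_exists:
  assumes "good N c" "fst c \<noteq> M []"
  shows "\<exists>\<rho>\<in>rules. applies \<rho> c"
proof (cases c)
  case (fields q a b)
  show ?thesis
  proof (cases q)
    case Ld
    then have "applies load_rule c" using assms fields by (simp add: good_def load_rule_def)
    then show ?thesis by (auto simp: rules_def)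
  next
    case (M k)
    then have "k \<in> conts P" "k \<noteq> []" using assms fields by (auto simp: good_def states_def)
    have "\<exists>\<rho>\<in>M_rules k. applies \<rho> c"
    proof (cases k rule: M_rules.cases)
      case (2 r j)
      then show ?thesis using fields M by (cases "b = 0") auto
    next
      case (3 r B j)
      consider "b = 0" | "b \<ge> pr r" | "b \<in> {1..<pr r}" by fastforce
      then show ?thesis using fields M 3 by cases auto
    qed (use \<open>k \<noteq> []\<close> in auto)
    then show ?thesis using \<open>k \<in> conts P\<close> by (auto simp: rules_def)
  next
    case (R n k)
    then have "k \<in> conts P" "n \<le> cl * cl" using assms fields by (auto simp: good_def states_def)
    moreover have "\<exists>\<rho>\<in>R_rules n k. applies \<rho> c"
      using fields R by (cases "a = 0") (auto simp: R_rules_def)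
    ultimately show ?thesis unfolding rules_def by blast
  qed
qed

lemma good_nxt:
  assumes "good N c" "fst c \<noteq> M []"
  shows "good N (nxt N c)"
proof (cases "c = (Ld, 1, N)")
  case True
  then show ?thesis using P_nonempty by (simp add: nxt_def good_def states_def conts_self)
next
  case False
  obtain \<rho> where \<rho>: "\<rho> \<in> rules" "applies \<rho> c" using rule_exists[OF assms] by blast
  have eq: "nxt N c = act \<rho> c" using nxt_rule[OF \<rho> False] .
  obtain q a b where c: "c = (q, a, b)" by (cases c)
  show ?thesis
  proof (cases "\<rho> = load_rule")
    case True
    then show ?thesis using eq \<rho> c assms False by (auto simp: load_rule_def good_def)
  next
    case False
    have "tgt \<rho> \<noteq> Ld"
    proof -
      have "tgt \<rho> \<noteq> Ld" if "\<rho> \<in> M_rules k" for k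
        using that by (induction k rule: M_rules.induct) auto
      then show ?thesis using False \<rho>(1) by (auto simp: rules_def R_rules_def)
    qed
    moreover have "nat (int a + da \<rho>) = 0" if "tgt \<rho> = M []"
    proof -
      have "tgt \<rho> \<noteq> M []" if "\<rho> \<in> M_rules k" for k
        using that by (induction k rule: M_rules.induct) auto
      then show ?thesis using that \<rho> c by (auto simp: rules_def R_rules_def load_rule_def)
    qed
    ultimately show ?thesis using eq c tgt_rules[OF \<rho>(1)] by (simp add: good_def)
  qed
qed

section \<open>Runs of the counter machine and their length\<close>

definition reach :: "nat \<Rightarrow> config \<Rightarrow> nat \<Rightarrow> config \<Rightarrow> bool" where
  "reach N c n c' \<longleftrightarrow> (nxt N ^^ n) c = c' \<and> (\<forall>i<n. fst ((nxt N ^^ i) c) \<noteq> M [])"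

lemma reach_0: "reach N c 0 c"
  by (simp add: reach_def)

lemma reach_step:
  assumes "\<rho> \<in> rules" "applies \<rho> (q, a, b)" "(q, a, b) \<noteq> (Ld, 1, N)"
    and "q' = tgt \<rho>" "int a' = int a + da \<rho>" "int b' = int b + db \<rho>"
  shows "reach N (q, a, b) 1 (q', a', b')"
  using nxt_rule[OF assms(1-3)] assms(2,4) src_not_final[OF assms(1)]
  by (auto simp: reach_def simp flip: assms(5,6))

lemma reach_trans:
  assumes "reach N c m c'" "reach N c' n c''"
  shows "reach N c (m + n) c''"
proof -
  have shift: "(nxt N ^^ (i + m)) c = (nxt N ^^ i) c'" for i
    using assms(1) by (simp add: reach_def funpow_add)
  have "fst ((nxt N ^^ i) c) \<noteq> M []" if "i < m + n" for i
  proof (cases "i < m")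
    case True
    then show ?thesis using assms(1) by (simp add: reach_def)
  next
    case False
    then show ?thesis using shift[of "i - m"] assms(2) that by (simp add: reach_def)
  qed
  then show ?thesis
    using shift[of n] assms(2) by (simp add: reach_def add.commute)
qed

lemma reach_self_loop:
  assumes "\<rho> \<in> rules" "src \<rho> \<noteq> Ld" "tgt \<rho> = src \<rho>"
    and "\<And>i. i < n \<Longrightarrow> applies \<rho> (src \<rho>, f i, g i)"
    and "\<And>i. i < n \<Longrightarrow> int (f (Suc i)) = int (f i) + da \<rho> \<and> int (g (Suc i)) = int (g i) + db \<rho>"
  shows "reach N (src \<rho>, f 0, g 0) n (src \<rho>, f n, g n)"
  using assms(4,5)
proof (induction n)
  case 0
  show ?case by (rule reach_0)
next
  case (Suc n)
  have "reach N (src \<rho>, f n, g n) 1 (src \<rho>, f (Suc n), g (Suc n))"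
    using Suc.prems[of n] assms by (intro reach_step[of \<rho>]) auto
  moreover have "reach N (src \<rho>, f 0, g 0) n (src \<rho>, f n, g n)"
    using Suc by simp
  ultimately show ?case using reach_trans[of N _ n _ 1] by simp
qed

lemma reach_R:
  assumes "k \<in> conts P" "c \<le> cl * cl"
  shows "reach N (R c k, a, b) (a + 1) (M k, 0, b + c * a)"
proof -
  let ?\<rho> = "Rule (R c k) 1 None 0 None (R c k) (-1) (int c)"
  let ?\<sigma> = "Rule (R c k) 0 (Some 0) 0 None (M k) 0 0"
  have in_rules: "?\<rho> \<in> rules" "?\<sigma> \<in> rules"
    using assms unfolding rules_def R_rules_def by blast+
  have "reach N (src ?\<rho>, a - 0, b + c * 0) a (src ?\<rho>, a - a, b + c * a)"
    by (rule reach_self_loop[OF in_rules(1)]) auto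
  moreover have "reach N (R c k, 0, b + c * a) 1 (M k, 0, b + c * a)"
    by (rule reach_step[OF in_rules(2)]) auto
  ultimately have "reach N (R c k, a - 0, b + c * 0) (a + 1) (M k, 0, b + c * a)"
    by (intro reach_trans[where m = a and n = 1]) simp_all
  then show ?thesis by simp
qed

lemma reach_Inc:
  assumes "Inc r # k \<in> conts P"
  shows "reach N (M (Inc r # k), 0, n) (2 * n + 2) (M k, 0, pr r * cl * n)"
proof -
  let ?\<rho> = "Rule (M (Inc r # k)) 0 None 1 None (M (Inc r # k)) 1 (-1)"
  let ?\<sigma> = "Rule (M (Inc r # k)) 0 None 0 (Some 0) (R (pr r * cl) k) 0 0"
  have in_rules: "?\<rho> \<in> rules" "?\<sigma> \<in> rules"
    using assms unfolding rules_def by force+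
  have "r < nr" using registers_below_conts[OF below assms] by simp
  then have le: "pr r * cl \<le> cl * cl" using pr_less_iff[of r nr] by simp
  have "reach N (src ?\<rho>, 0, n - 0) n (src ?\<rho>, n, n - n)"
    by (rule reach_self_loop[OF in_rules(1), where f = "\<lambda>i. i" and g = "\<lambda>i. n - i"]) auto
  then have 1: "reach N (M (Inc r # k), 0, n) n (M (Inc r # k), n, 0)" by simp
  have 2: "reach N (M (Inc r # k), n, 0) 1 (R (pr r * cl) k, n, 0)"
    by (rule reach_step[OF in_rules(2)]) auto
  have 3: "reach N (R (pr r * cl) k, n, 0) (n + 1) (M k, 0, 0 + pr r * cl * n)"
    by (rule reach_R[OF conts_Inc[OF assms] le])
  have "reach N (M (Inc r # k), 0, n) (n + 1 + (n + 1)) (M k, 0, 0 + pr r * cl * n)"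
    by (rule reach_trans[OF reach_trans[OF 1 2] 3])
  then show ?thesis by (simp add: mult_2)
qed

lemma reach_Loop_drain:
  assumes "Loop r B # k \<in> conts P"
  shows "reach N (M (Loop r B # k), 0, pr r * m + i) m (M (Loop r B # k), cl * m, i)"
proof -
  let ?\<rho> = "Rule (M (Loop r B # k)) 0 None (pr r) None (M (Loop r B # k)) (int cl) (- int (pr r))"
  have in_rules: "?\<rho> \<in> rules"
    using assms unfolding rules_def by force
  have "reach N (src ?\<rho>, cl * 0, pr r * (m - 0) + i) m (src ?\<rho>, cl * m, pr r * (m - m) + i)"
  proof (rule reach_self_loop[OF in_rules, where f = "\<lambda>j. cl * j" and g = "\<lambda>j. pr r * (m - j) + i"])
    fix j assume "j < m"
    then have "m - j = Suc (m - Suc j)" by simp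
    then show "applies ?\<rho> (src ?\<rho>, cl * j, pr r * (m - j) + i)"
      and "int (cl * Suc j) = int (cl * j) + da ?\<rho> \<and>
        int (pr r * (m - Suc j) + i) = int (pr r * (m - j) + i) + db ?\<rho>"
      by simp_all
  qed auto
  then show ?thesis by simp
qed

lemma reach_Loop_0:
  assumes "Loop r B # k \<in> conts P" "\<not> pr r dvd n"
  shows "\<exists>t\<ge>1. t \<le> (cl + 1) * n + 2 \<and> reach N (M (Loop r B # k), 0, n) t (M k, 0, cl * n)"
proof -
  define m i where "m = n div pr r" and "i = n mod pr r"
  have n: "n = pr r * m + i" by (simp add: m_def i_def)
  have i: "i \<in> {1..<pr r}" using assms(2) pr_pos[of r] by (auto simp: i_def mod_greater_zero_iff_not_dvd Suc_le_eq)
  let ?\<sigma> = "Rule (M (Loop r B # k)) 0 None i (Some i) (R (pr r) k) 0 (int ((cl - 1) * i))"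
  have in_rules: "?\<sigma> \<in> rules"
    using assms i unfolding rules_def by force
  have "r < nr" using registers_below_conts[OF below assms(1)] by simp
  then have "pr r \<le> cl" using pr_less_iff[of r nr] by simp
  then have le: "pr r \<le> cl * cl" by (meson le_square order_trans)
  have cli: "i + (cl - 1) * i = cl * i" using pr_pos[of nr] by (cases cl) auto
  have 2: "reach N (M (Loop r B # k), cl * m, i) 1 (R (pr r) k, cl * m, cl * i)"
    by (rule reach_step[OF in_rules]) (auto simp del: of_nat_mult simp flip: cli)
  have 3: "reach N (R (pr r) k, cl * m, cl * i) (cl * m + 1) (M k, 0, cl * i + pr r * (cl * m))"
    using conts_Loop[OF assms(1)] le by (intro reach_R) auto
  have "reach N (M (Loop r B # k), 0, n) (m + 1 + (cl * m + 1)) (M k, 0, cl * i + pr r * (cl * m))"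
    unfolding n by (intro reach_trans[OF reach_trans[OF reach_Loop_drain[OF assms(1)] 2] 3])
  moreover have "cl * i + pr r * (cl * m) = cl * n" by (simp add: n algebra_simps)
  moreover have "m + 1 + (cl * m + 1) \<le> (cl + 1) * n + 2"
  proof -
    have "m \<le> n" by (simp add: m_def)
    then have "(cl + 1) * m \<le> (cl + 1) * n" by (rule mult_le_mono2)
    then show ?thesis by (simp add: algebra_simps)
  qed
  ultimately show ?thesis by (intro exI[of _ "m + 1 + (cl * m + 1)"]) auto
qed

lemma reach_Loop_Suc:
  assumes "Loop r B # k \<in> conts P"
  shows "\<exists>t\<ge>1. t \<le> (cl + 1) * (pr r * m) + 2 \<and>
    reach N (M (Loop r B # k), 0, pr r * m) t (M (B @ Loop r B # k), 0, cl * m)"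
proof -
  let ?\<sigma> = "Rule (M (Loop r B # k)) 0 None 0 (Some 0) (R 1 (B @ Loop r B # k)) 0 0"
  have in_rules: "?\<sigma> \<in> rules"
    using assms unfolding rules_def by force
  have 2: "reach N (M (Loop r B # k), cl * m, 0) 1 (R 1 (B @ Loop r B # k), cl * m, 0)"
    by (rule reach_step[OF in_rules]) auto
  have "1 \<le> cl * cl" using pr_pos[of nr] by simp
  then have 3: "reach N (R 1 (B @ Loop r B # k), cl * m, 0) (cl * m + 1)
      (M (B @ Loop r B # k), 0, 0 + 1 * (cl * m))"
    using conts_Loop[OF assms(1)] by (intro reach_R) auto
  have "reach N (M (Loop r B # k), 0, pr r * m + 0) (m + 1 + (cl * m + 1))
      (M (B @ Loop r B # k), 0, 0 + 1 * (cl * m))"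
    by (rule reach_trans[OF reach_trans[OF reach_Loop_drain[OF assms(1), of N m 0] 2] 3])
  moreover have "m + 1 + (cl * m + 1) \<le> (cl + 1) * (pr r * m) + 2"
  proof -
    have "m \<le> pr r * m" using pr_pos[of r] by simp
    then have "(cl + 1) * m \<le> (cl + 1) * (pr r * m)" by (rule mult_le_mono2)
    then show ?thesis by (simp add: algebra_simps)
  qed
  ultimately show ?thesis by (intro exI[of _ "m + 1 + (cl * m + 1)"]) auto
qed

lemma code_pos: "0 < code t s"
  by (simp add: code_def pr_pos prod_pos)

lemma code_upd:
  assumes "r < nr"
  shows "code (Suc t) (s(r := Suc (s r))) = pr r * cl * code t s"
proof -
  have r: "r \<in> {..<nr}" using assms by simp
  have "(\<Prod>i\<in>{..<nr} - {r}. pr i ^ (s(r := Suc (s r))) i) = (\<Prod>i\<in>{..<nr} - {r}. pr i ^ s i)"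
    by (intro prod.cong) auto
  then show ?thesis
    unfolding code_def prod.remove[OF finite_lessThan r] by simp
qed

lemma pr_dvd_code_iff:
  assumes "r < nr"
  shows "pr r dvd code t s \<longleftrightarrow> s r \<noteq> 0"
proof
  assume "pr r dvd code t s"
  then have "pr r dvd cl ^ t \<or> pr r dvd (\<Prod>i<nr. pr i ^ s i)"
    unfolding code_def by (simp add: prime_dvd_mult_iff prime_pr)
  moreover have "\<not> pr r dvd cl ^ t"
    using prime_dvd_power[OF prime_pr, of r cl t] primes_dvd_imp_eq[OF prime_pr prime_pr, of r nr] assms
    by (auto simp: pr_eq_iff)
  ultimately obtain i where i: "i < nr" "pr r dvd pr i ^ s i"
    by (auto simp: prime_dvd_prod_iff prime_pr)
  then have "pr r dvd pr i" using prime_dvd_power[OF prime_pr] by blast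
  then have "i = r" using primes_dvd_imp_eq[OF prime_pr prime_pr] by (metis pr_eq_iff)
  with i show "s r \<noteq> 0"
    by (metis power_0 nat_dvd_1_iff_1 prime_pr not_prime_1)
next
  assume "s r \<noteq> 0"
  then have "pr r dvd pr r ^ s r" by simp
  also have "\<dots> dvd (\<Prod>i<nr. pr i ^ s i)"
    using assms by (intro dvd_prodI) auto
  finally show "pr r dvd code t s" by (simp add: code_def)
qed

text \<open>Moving a code between the counters takes linearly many steps in its size. The code rises
  even when a register is decremented, since the clock prime exceeds the prime divided out.\<close>

lemma macro_step:
  assumes "k \<in> conts P" "k \<noteq> []" "lstep (k, s) = (k', s')"
  shows "\<exists>n\<ge>1. n \<le> (cl + 3) * code t s \<and>
      reach N (M k, 0, code t s) n (M k', 0, code (Suc t) s')"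
    and "code t s < code (Suc t) s'" and "k' \<in> conts P"
proof -
  have cl2: "2 \<le> cl" by (rule pr_ge_2)
  have c1: "1 \<le> code t s" using code_pos[of t s] by simp
  have "(\<exists>n\<ge>1. n \<le> (cl + 3) * code t s \<and> reach N (M k, 0, code t s) n (M k', 0, code (Suc t) s')) \<and>
      code t s < code (Suc t) s' \<and> k' \<in> conts P"
  proof (cases k rule: M_rules.cases)
    case (2 r j)
    have r: "r < nr" using registers_below_conts[OF below assms(1)] 2 by simp
    have k': "k' = j" "s' = s(r := Suc (s r))" using assms(3) 2 by auto
    have eq: "code (Suc t) s' = pr r * cl * code t s" using code_upd[OF r] k' by simp
    have "2 * code t s + 2 \<le> (cl + 3) * code t s"
    proof -
      have "2 * code t s + 2 \<le> 4 * code t s" using c1 by simp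
      also have "\<dots> \<le> (cl + 3) * code t s" using cl2 by (intro mult_le_mono1) simp
      finally show ?thesis .
    qed
    moreover have "code t s < code (Suc t) s'"
    proof -
      have "1 < pr r * cl" using pr_ge_2[of r] cl2 using less_1_mult[of "pr r" cl] by simp
      then show ?thesis using c1 unfolding eq by (simp add: code_pos)
    qed
    ultimately show ?thesis
      using reach_Inc[of r j N "code t s"] conts_Inc[of r j P] assms(1) 2 k' eq
      by (auto intro!: exI[of _ "2 * code t s + 2"])
  next
    case (3 r B j)
    have r: "r < nr" using registers_below_conts[OF below assms(1)] 3 by simp
    have bound: "(cl + 1) * code t s + 2 \<le> (cl + 3) * code t s"
      using c1 by (simp add: algebra_simps)
    show ?thesis
    proof (cases "s r = 0")
      case True
      have k': "k' = j" "s' = s" using assms(3) 3 True by auto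
      have eq: "code (Suc t) s' = cl * code t s" by (simp add: code_def k')
      have "\<not> pr r dvd code t s" using pr_dvd_code_iff[OF r] True by simp
      from reach_Loop_0[OF _ this, of B j N] obtain n where
        "n \<ge> 1" "n \<le> (cl + 1) * code t s + 2" "reach N (M k, 0, code t s) n (M j, 0, cl * code t s)"
        using assms(1) 3 by auto
      moreover have "code t s < cl * code t s" using cl2 c1 by simp
      ultimately show ?thesis
        using bound k' eq conts_Loop[of r B j P] assms(1) 3 by (auto intro!: exI[of _ n])
    next
      case False
      have k': "k' = B @ k" "s' = s(r := s r - 1)" using assms(3) 3 False by auto
      have "s = s'(r := Suc (s' r))" using k' False by auto
      define m where "m = code t s'"
      have m: "pr r * m = code t s"
      proof -
        have "cl * code t s = pr r * cl * code t s'"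
          using code_upd[OF r, of t s'] \<open>s = s'(r := Suc (s' r))\<close> by (simp add: code_def)
        then show ?thesis using pr_pos[of nr] by (simp add: m_def)
      qed
      have eq: "code (Suc t) s' = cl * m" by (simp add: code_def m_def)
      from reach_Loop_Suc[of r B j m N] obtain n where
        "n \<ge> 1" "n \<le> (cl + 1) * code t s + 2" "reach N (M k, 0, code t s) n (M (B @ k), 0, cl * m)"
        using assms(1) 3 m by auto
      moreover have "code t s < cl * m"
        unfolding m[symmetric] using pr_less_iff[of r nr] r code_pos[of t s'] by (simp add: m_def)
      ultimately show ?thesis
        using bound k' eq conts_Loop[of r B j P] assms(1) 3 by (auto intro!: exI[of _ n])
    qed
  qed (use assms in auto)
  then show "\<exists>n\<ge>1. n \<le> (cl + 3) * code t s \<and>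
      reach N (M k, 0, code t s) n (M k', 0, code (Suc t) s')"
    and "code t s < code (Suc t) s'" and "k' \<in> conts P" by auto
qed

text \<open>As the code rises in every step of the program, the linear costs add up to at most a
  quadratic in the last code: \<open>c^2 + c\<close> is at most \<open>(c + 1)^2\<close>. The lower
  bound \<open>j\<close> on the length turns an infinite run of the program into one of the counter
  machine.\<close>

lemma macro_run:
  assumes "\<And>i. i < j \<Longrightarrow> fst ((lstep ^^ i) (P, s)) \<noteq> []" "(lstep ^^ j) (P, s) = (k, s')"
  shows "k \<in> conts P \<and> code 0 s \<le> code j s' \<and>
    (\<exists>n\<ge>j. n \<le> (cl + 3) * (code j s')\<^sup>2 \<and> reach N (M P, 0, code 0 s) n (M k, 0, code j s'))"
  using assms
proof (induction j arbitrary: k s')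
  case 0
  then have "k = P" "s' = s" by simp_all
  then show ?case using conts_self reach_0 by (simp only:) blast
next
  case (Suc j)
  obtain k1 s1 where 1: "(lstep ^^ j) (P, s) = (k1, s1)" by (cases "(lstep ^^ j) (P, s)")
  have "k1 \<noteq> []" using Suc.prems(1)[of j] 1 by simp
  have IH: "k1 \<in> conts P" "code 0 s \<le> code j s1" using Suc.IH[OF _ 1] Suc.prems(1) by auto
  obtain n where n: "n \<ge> j" "n \<le> (cl + 3) * (code j s1)\<^sup>2" "reach N (M P, 0, code 0 s) n (M k1, 0, code j s1)"
    using Suc.IH[OF _ 1] Suc.prems(1) by auto
  have step: "lstep (k1, s1) = (k, s')" using Suc.prems(2) 1 by simp
  note ms = macro_step[OF IH(1) \<open>k1 \<noteq> []\<close> step]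
  obtain m where m: "m \<ge> 1" "m \<le> (cl + 3) * code j s1" "reach N (M k1, 0, code j s1) m (M k, 0, code (Suc j) s')"
    using ms(1)[where t = j and N = N] by blast
  have lt: "code j s1 < code (Suc j) s'" by (rule ms(2))
  have "n + m \<le> (cl + 3) * (code (Suc j) s')\<^sup>2"
  proof -
    have "n + m \<le> (cl + 3) * ((code j s1)\<^sup>2 + code j s1)" using n(2) m(2) by (simp add: algebra_simps)
    also have "(code j s1)\<^sup>2 + code j s1 \<le> (Suc (code j s1))\<^sup>2" by (simp add: power2_eq_square)
    also have "\<dots> \<le> (code (Suc j) s')\<^sup>2" using lt by (intro power_mono) auto
    finally show ?thesis by simp
  qed
  moreover have "n + m \<ge> Suc j" using n m by simp
  ultimately show ?case
    using reach_trans[OF n(3) m(3)] ms(3) IH(2) lt by (auto intro!: exI[of _ "n + m"])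
qed

lemma reach_load: "reach N (Ld, 1, 0) (N + 1) (M P, 0, N)"
proof -
  have "reach N (Ld, 1, 0) i (Ld, 1, i)" if "i \<le> N" for i
    using that
  proof (induction i)
    case (Suc i)
    have "reach N (Ld, 1, i) 1 (Ld, 1, Suc i)"
      using Suc by (intro reach_step[of load_rule]) (auto simp: rules_def load_rule_def)
    with Suc show ?case using reach_trans[where m = i and n = 1] by auto
  qed (simp add: reach_0)
  then have "reach N (Ld, 1, 0) N (Ld, 1, N)" by simp
  moreover have "reach N (Ld, 1, N) 1 (M P, 0, N)" by (simp add: reach_def nxt_def)
  ultimately show ?thesis by (rule reach_trans)
qed

lemma machine_halts:
  assumes "halts P s" "code 0 s = N"
  shows "\<exists>T n. 1 \<le> n \<and> T + 1 \<le> (cl + 6) * n\<^sup>2 \<and> reach N (Ld, 1, 0) T (M [], 0, n)"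
proof -
  obtain j where j: "fst ((lstep ^^ j) (P, s)) = []" "\<And>i. i < j \<Longrightarrow> fst ((lstep ^^ i) (P, s)) \<noteq> []"
    using assms(1) exists_least_iff[of "\<lambda>n. fst ((lstep ^^ n) (P, s)) = []"]
    unfolding halts_def by blast
  obtain s' where s': "(lstep ^^ j) (P, s) = ([], s')" using j(1) by (metis prod.collapse)
  define n where "n = code j s'"
  from macro_run[OF j(2) s', of N] obtain m where
    m: "m \<le> (cl + 3) * n\<^sup>2" "reach N (M P, 0, N) m (M [], 0, n)" "N \<le> n"
    using assms(2) by (auto simp: n_def)
  have "1 \<le> n" using code_pos[of j s'] by (simp add: n_def)
  then have "n \<le> n\<^sup>2" "1 \<le> n\<^sup>2" by (simp_all add: power2_eq_square)
  \<comment> \<open>Loading and the final unit contribute \<open>N\<close>, 1 and 1, each at most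
    the square of \<open>n\<close>; hence \<open>cl + 3\<close> becomes
    \<open>cl + 6\<close>.\<close>
  have "N + 1 + m + 1 \<le> n\<^sup>2 + 2 * n\<^sup>2 + (cl + 3) * n\<^sup>2"
    using m \<open>n \<le> n\<^sup>2\<close> \<open>1 \<le> n\<^sup>2\<close> by linarith
  also have "\<dots> = (cl + 6) * n\<^sup>2" by (simp add: algebra_simps)
  finally show ?thesis
    using reach_trans[OF reach_load m(2)] \<open>1 \<le> n\<close> by blast
qed

lemma machine_runs_forever:
  assumes "\<not> halts P s" "code 0 s = N"
  shows "fst ((nxt N ^^ n) (Ld, 1, 0)) \<noteq> M []"
proof -
  obtain k s' where ks: "(lstep ^^ Suc n) (P, s) = (k, s')" by fastforce
  have "\<And>i. fst ((lstep ^^ i) (P, s)) \<noteq> []" using assms(1) by (auto simp: halts_def)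
  from macro_run[OF this ks, of N] obtain m where
    m: "Suc n \<le> m" "reach N (M P, 0, N) m (M k, 0, code (Suc n) s')"
    using assms(2) by auto
  have "reach N (Ld, 1, 0) (N + 1 + m) (M k, 0, code (Suc n) s')"
    by (rule reach_trans[OF reach_load m(2)])
  then show ?thesis using m(1) by (simp add: reach_def)
qed

lemma good_run:
  assumes "\<And>i. i < n \<Longrightarrow> fst ((nxt N ^^ i) (Ld, 1, 0)) \<noteq> M []"
  shows "good N ((nxt N ^^ n) (Ld, 1, 0))"
  using assms by (induction n) (simp_all add: good_start[simplified] good_nxt)

end

section \<open>The planar gadget\<close>

text \<open>
  The configuration \<open>(q, a, b)\<close> is encoded by \<open>S = 2\<^sup>b\<close> and \<open>W = S (2 q + 2\<^sup>-\<^sup>a)\<close>: states are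
  sectors of the plane, and both rule actions and violations of guards are of order \<open>S\<close>.
\<close>

fun pt_S :: "'s \<times> nat \<times> nat \<Rightarrow> real" where
  "pt_S (q, a, b) = 2 ^ b"

fun pt_W :: "('s \<Rightarrow> nat) \<Rightarrow> 's \<times> nat \<times> nat \<Rightarrow> real" where
  "pt_W ix (q, a, b) = 2 ^ b * (2 * real (ix q) + (1 / 2) ^ a)"

text \<open>An absent upper bound counts as infinite, and the corresponding power of 1/2 is
  0.\<close>

definition low :: "nat option \<Rightarrow> real" where
  "low n = (case n of None \<Rightarrow> 0 | Some n \<Rightarrow> (1 / 2) ^ n)"

text \<open>A sum of hinge functions, one for each guard. Since \<open>W / S\<close> decreases in
  \<open>a\<close>, the lower bound on \<open>a\<close> limits \<open>W\<close> from above and the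
  upper bound limits it from below. These two terms also punish points in the sector of another
  state.\<close>

definition pen :: "('s \<Rightarrow> nat) \<Rightarrow> 's rule \<Rightarrow> real \<Rightarrow> real \<Rightarrow> real" where
  "pen ix \<rho> S W = max 0 (W - (2 * real (ix (src \<rho>)) + (1 / 2) ^ amin \<rho>) * S) +
    max 0 ((2 * real (ix (src \<rho>)) + low (amax \<rho>)) * S - W) +
    max 0 (2 ^ bmin \<rho> - S) + max 0 (low (bmax \<rho>) * S - 1)"

definition val_S :: "'s rule \<Rightarrow> real \<Rightarrow> real" where
  "val_S \<rho> S = 2 powi db \<rho> * S"

text \<open>At a configuration of the source state,
  \<open>W - 2 * real (ix (src \<rho>)) * S\<close> is \<open>2 ^ b * (1 / 2) ^ a\<close>. The rule
  rescales this part and moves it to the sector of the target, so its action is linear in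
  \<open>(S, W)\<close>.\<close>

definition val_W :: "('s \<Rightarrow> nat) \<Rightarrow> 's rule \<Rightarrow> real \<Rightarrow> real \<Rightarrow> real" where
  "val_W ix \<rho> S W = 2 powi db \<rho> *
    (2 * real (ix (tgt \<rho>)) * S + 2 powi (- da \<rho>) * (W - 2 * real (ix (src \<rho>)) * S))"

lemma pen_ge:
  "W - (2 * real (ix (src \<rho>)) + (1 / 2) ^ amin \<rho>) * S \<le> pen ix \<rho> S W"
  "(2 * real (ix (src \<rho>)) + low (amax \<rho>)) * S - W \<le> pen ix \<rho> S W"
  "2 ^ bmin \<rho> - S \<le> pen ix \<rho> S W"
  "low (bmax \<rho>) * S - 1 \<le> pen ix \<rho> S W"
  by (simp_all add: pen_def)

lemma half_power_le_iff: "(1 / 2 :: real) ^ m \<le> (1 / 2) ^ n \<longleftrightarrow> n \<le> m"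
  using power_decreasing_iff[of "1 / 2 :: real" m n] by simp

lemma low_nonneg: "0 \<le> low n"
  by (simp add: low_def split: option.split)

lemma pen_applies:
  assumes "applies \<rho> c"
  shows "pen ix \<rho> (pt_S c) (pt_W ix c) = 0"
proof -
  obtain q a b where c: "c = (q, a, b)" by (cases c)
  have 1: "(1 / 2 :: real) ^ a \<le> (1 / 2) ^ amin \<rho>" using assms c by (simp add: half_power_le_iff)
  have 2: "low (amax \<rho>) \<le> (1 / 2) ^ a"
    using assms c by (auto simp: low_def half_power_le_iff split: option.split)
  have 3: "(2 :: real) ^ bmin \<rho> \<le> 2 ^ b" using assms c by simp
  have 4: "low (bmax \<rho>) * 2 ^ b \<le> 1"
    using assms c by (auto simp: low_def field_simps split: option.split)
  have q: "q = src \<rho>" using assms c by simp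
  have "(2::real) ^ b * (1 / 2) ^ a \<le> 2 ^ b * (1 / 2) ^ amin \<rho>" "2 ^ b * low (amax \<rho>) \<le> 2 ^ b * (1 / 2) ^ a"
    using 1 2 by (auto intro: mult_left_mono)
  then show ?thesis using 3 4 by (simp add: pen_def c q algebra_simps)
qed

lemma val_act:
  assumes "applies \<rho> c" "safe \<rho>"
  shows "val_S \<rho> (pt_S c) = pt_S (act \<rho> c)" "val_W ix \<rho> (pt_S c) (pt_W ix c) = pt_W ix (act \<rho> c)"
proof -
  obtain q a b where c: "c = (q, a, b)" by (cases c)
  have ge: "0 \<le> int a + da \<rho>" "0 \<le> int b + db \<rho>" and q: "q = src \<rho>"
    using assms c by (auto simp: safe_def)
  have b: "(2::real) powi db \<rho> * 2 ^ b = 2 ^ nat (int b + db \<rho>)"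
  proof -
    have "(2::real) powi (db \<rho> + int b) = 2 powi db \<rho> * 2 powi int b" by (rule power_int_add) simp
    moreover have "(2::real) powi (db \<rho> + int b) = 2 ^ nat (int b + db \<rho>)"
      using ge(2) by (simp add: power_int_def add.commute)
    ultimately show ?thesis by simp
  qed
  have half: "(1 / 2 :: real) ^ n = 2 powi (- int n)" for n
    by (simp add: power_int_minus power_divide inverse_eq_divide)
  have a: "(2::real) powi (- da \<rho>) * (1 / 2) ^ a = (1 / 2) ^ nat (int a + da \<rho>)"
  proof -
    have "(2::real) powi (- da \<rho> + - int a) = 2 powi (- da \<rho>) * 2 powi (- int a)"
      by (rule power_int_add) simp
    moreover have "- da \<rho> + - int a = - int (nat (int a + da \<rho>))" using ge(1) by simp
    ultimately show ?thesis by (simp only: half)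
  qed
  show "val_S \<rho> (pt_S c) = pt_S (act \<rho> c)" by (simp add: val_S_def c b)
  have "val_W ix \<rho> (pt_S c) (pt_W ix c) =
      (2 powi db \<rho> * 2 ^ b) * (2 * real (ix (tgt \<rho>)) + 2 powi (- da \<rho>) * (1 / 2) ^ a)"
    by (simp add: val_W_def c q algebra_simps)
  then show "val_W ix \<rho> (pt_S c) (pt_W ix c) = pt_W ix (act \<rho> c)" by (simp only: a b) (simp add: c)
qed

text \<open>In units of \<open>S\<close>, the sector of state \<open>i\<close> is the interval from
  \<open>2 * i\<close> to \<open>2 * i + 1\<close>. Distinct sectors are a unit apart, so one
  widened by 1/2 on both sides still has distance 1/2 from any other.\<close>

lemma pen_other_state:
  assumes "j \<noteq> ix (src \<rho>)" "0 < S" "(2 * real j - 1 / 2) * S \<le> W" "W \<le> (2 * real j + 3 / 2) * S"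
  shows "1 / 2 * S \<le> pen ix \<rho> S W"
proof (cases "ix (src \<rho>) < j")
  case True
  then have "2 * real (ix (src \<rho>)) + 3 / 2 \<le> 2 * real j - 1 / 2" by linarith
  then have "(2 * real (ix (src \<rho>)) + 3 / 2) * S \<le> W"
    using assms by (meson mult_right_mono less_imp_le order_trans)
  moreover have "(1 / 2) ^ amin \<rho> * S \<le> 1 * S"
    using assms(2) by (intro mult_right_mono) (auto simp: power_le_one)
  ultimately show ?thesis using pen_ge(1)[of W ix \<rho> S] by (simp add: algebra_simps)
next
  case False
  then have "2 * real j + 3 / 2 \<le> 2 * real (ix (src \<rho>)) - 1 / 2" using assms(1) by linarith
  then have "W \<le> (2 * real (ix (src \<rho>)) - 1 / 2) * S"
    using assms by (meson mult_right_mono less_imp_le order_trans)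
  moreover have "0 \<le> low (amax \<rho>) * S" using assms(2) low_nonneg by simp
  ultimately show ?thesis using pen_ge(2)[of ix \<rho> S W] by (simp add: algebra_simps)
qed

text \<open>Counter values are isolated on the exponential scale: a violated guard is missed by a
  fixed fraction of \<open>2 ^ b\<close> that depends on the guard alone. The exponent
  \<open>e\<close> covers all four cases.\<close>

lemma pen_same_state:
  "\<exists>c>0. \<forall>a b. \<not> applies \<rho> (src \<rho>, a, b) \<longrightarrow>
    c * 2 ^ b \<le> pen ix \<rho> (pt_S (src \<rho>, a, b)) (pt_W ix (src \<rho>, a, b))"
proof -
  define up where "up x = (case x of None \<Rightarrow> 0 | Some n \<Rightarrow> Suc n)" for x :: "nat option"
  define e where "e = amin \<rho> + up (amax \<rho>) + up (bmax \<rho>)"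
  have bound: "(1 / 2) ^ e * 2 ^ b \<le> pen ix \<rho> (pt_S (src \<rho>, a, b)) (pt_W ix (src \<rho>, a, b))"
    (is "_ \<le> ?pen") if not: "\<not> applies \<rho> (src \<rho>, a, b)" for a b
  proof -
    have e: "(1 / 2 :: real) ^ e * 2 ^ b \<le> (1 / 2) ^ m * 2 ^ b" if "m \<le> e" for m
      using that by (intro mult_right_mono) (simp_all add: half_power_le_iff)
    have fin: "(1 / 2) ^ e * 2 ^ b \<le> ?pen" if "(1 / 2) ^ m * 2 ^ b \<le> ?pen" "m \<le> e" for m
      by (rule order_trans[OF e[OF that(2)] that(1)])
    from not consider "a < amin \<rho>" | n where "amax \<rho> = Some n" "n < a" | "b < bmin \<rho>"
      | n where "bmax \<rho> = Some n" "n < b" by fastforce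
    then show ?thesis
    proof cases
      case 1
      then have "Suc a \<le> amin \<rho>" by simp
      then have "(1 / 2 :: real) ^ amin \<rho> \<le> (1 / 2) ^ Suc a" by (simp only: half_power_le_iff)
      then have "(1 / 2 :: real) ^ amin \<rho> * 2 ^ b \<le> ((1 / 2) ^ a - (1 / 2) ^ amin \<rho>) * 2 ^ b"
        by (intro mult_right_mono) auto
      also have "\<dots> \<le> ?pen" using pen_ge(1)[of "pt_W ix (src \<rho>, a, b)" ix \<rho> "2 ^ b"]
        by (simp add: algebra_simps)
      finally show ?thesis by (rule fin) (simp add: e_def)
    next
      case (2 n)
      then have "Suc n \<le> a" by simp
      then have "(1 / 2 :: real) ^ a \<le> (1 / 2) ^ Suc n" by (simp only: half_power_le_iff)
      then have "(1 / 2 :: real) ^ Suc n * 2 ^ b \<le> ((1 / 2) ^ n - (1 / 2) ^ a) * 2 ^ b"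
        by (intro mult_right_mono) auto
      also have "\<dots> \<le> ?pen" using pen_ge(2)[of ix \<rho> "2 ^ b" "pt_W ix (src \<rho>, a, b)"] 2
        by (simp add: algebra_simps low_def)
      finally show ?thesis by (rule fin) (simp add: e_def up_def 2)
    next
      case 3
      then have "(2 :: real) ^ Suc b \<le> 2 ^ bmin \<rho>" by (intro power_increasing) auto
      then have "2 ^ b \<le> ?pen" using pen_ge(3)[of \<rho> "2 ^ b" ix "pt_W ix (src \<rho>, a, b)"] by simp
      then show ?thesis by (intro fin[of 0]) simp_all
    next
      case (4 n)
      then have "(2 :: real) ^ Suc n \<le> 2 ^ b" by (intro power_increasing) auto
      then have "(1 / 2 :: real) ^ n * 2 ^ Suc n \<le> (1 / 2) ^ n * 2 ^ b"
        by (intro mult_left_mono) auto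
      also have "(1 / 2 :: real) ^ n * 2 ^ Suc n = 2" by (simp add: power_divide)
      finally have "2 \<le> (1 / 2 :: real) ^ n * 2 ^ b" .
      then have "(1 / 2 :: real) ^ Suc n * 2 ^ b \<le> (1 / 2) ^ n * 2 ^ b - 1"
        unfolding power_Suc by linarith
      also have "\<dots> \<le> ?pen" using pen_ge(4)[of \<rho> "2 ^ b" ix "pt_W ix (src \<rho>, a, b)"] 4
        by (simp add: low_def)
      finally show ?thesis by (rule fin) (simp add: e_def up_def 4)
    qed
  qed
  then show ?thesis by (intro exI[of _ "(1 / 2) ^ e"]) auto
qed

text \<open>A rule has to be silent in two places: in the widened sectors of other states, which
  cover the region around the final state where resets occur, and at exact configurations violating
  its guards. Elsewhere in its own sector nothing is required, since garbage is left to the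
  fuel.\<close>

definition misses :: "('s \<Rightarrow> nat) \<Rightarrow> 's rule \<Rightarrow> real \<Rightarrow> real \<Rightarrow> bool" where
  "misses ix \<rho> S W \<longleftrightarrow>
    (\<exists>j. j \<noteq> ix (src \<rho>) \<and> 0 < S \<and> (2 * real j - 1 / 2) * S \<le> W \<and> W \<le> (2 * real j + 3 / 2) * S) \<or>
    (\<exists>a b. \<not> applies \<rho> (src \<rho>, a, b) \<and> S = pt_S (src \<rho>, a, b) \<and> W = pt_W ix (src \<rho>, a, b))"

lemma misses_pos: "misses ix \<rho> S W \<Longrightarrow> 0 < S"
  by (auto simp: misses_def)

lemma misses_config:
  assumes "inj ix" "\<not> applies \<rho> c"
  shows "misses ix \<rho> (pt_S c) (pt_W ix c)"
proof -
  obtain q a b where c: "c = (q, a, b)" by (cases c)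
  show ?thesis
  proof (cases "q = src \<rho>")
    case True
    then show ?thesis using assms(2) unfolding misses_def c by blast
  next
    case False
    then have "ix q \<noteq> ix (src \<rho>)" using assms(1) by (auto dest: injD)
    moreover have "(2 * real (ix q) - 1 / 2) * 2 ^ b \<le> (2 * real (ix q) + (1 / 2) ^ a) * 2 ^ b"
      by (intro mult_right_mono) (auto intro: order_trans[of _ 0])
    moreover have "(2 * real (ix q) + (1 / 2) ^ a) * 2 ^ b \<le> (2 * real (ix q) + 3 / 2) * 2 ^ b"
      using power_le_one[of "1 / 2 :: real" a] by (intro mult_right_mono) auto
    ultimately show ?thesis
      unfolding misses_def c by (intro disjI1 exI[of _ "ix q"]) (simp add: mult.commute)
  qed
qed

lemma pen_misses:
  assumes "finite Rs"
  shows "\<exists>c>0. \<forall>\<rho>\<in>Rs. \<forall>S W. misses ix \<rho> S W \<longrightarrow> c * S \<le> pen ix \<rho> S W"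
  using assms
proof (induction Rs rule: finite_induct)
  case empty
  show ?case by (auto intro: exI[of _ 1])
next
  case (insert \<rho> Rs)
  obtain c1 where c1: "c1 > 0" "\<forall>\<rho>\<in>Rs. \<forall>S W. misses ix \<rho> S W \<longrightarrow> c1 * S \<le> pen ix \<rho> S W"
    using insert by blast
  obtain c2 where c2: "c2 > 0" "\<And>a b. \<not> applies \<rho> (src \<rho>, a, b) \<Longrightarrow>
      c2 * 2 ^ b \<le> pen ix \<rho> (pt_S (src \<rho>, a, b)) (pt_W ix (src \<rho>, a, b))"
    using pen_same_state by blast
  define c where "c = min c1 (min c2 (1 / 2))"
  have le: "c * S \<le> c1 * S" "c * S \<le> c2 * S" "c * S \<le> 1 / 2 * S" if "0 < S" for S
    using that by (auto simp: c_def intro!: mult_right_mono)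
  have "c * S \<le> pen ix \<sigma> S W" if m: "misses ix \<sigma> S W" and \<sigma>: "\<sigma> \<in> insert \<rho> Rs" for \<sigma> S W
  proof (cases "\<sigma> \<in> Rs")
    case True
    then show ?thesis using c1(2) m le(1)[OF misses_pos[OF m]] by fastforce
  next
    case False
    then have [simp]: "\<sigma> = \<rho>" using \<sigma> by simp
    from m consider j where "j \<noteq> ix (src \<rho>)" "0 < S" "(2 * real j - 1 / 2) * S \<le> W" "W \<le> (2 * real j + 3 / 2) * S"
      | a b where "\<not> applies \<rho> (src \<rho>, a, b)" "S = pt_S (src \<rho>, a, b)" "W = pt_W ix (src \<rho>, a, b)"
      unfolding misses_def by auto
    then show ?thesis
    proof cases
      case 1
      have "1 / 2 * S \<le> pen ix \<rho> S W" by (rule pen_other_state) (fact 1)+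
      then show ?thesis using le(3)[OF 1(2)] by simp
    next
      case (2 a b)
      have "0 < S" using 2(2) by simp
      have "c2 * S \<le> pen ix \<rho> S W" using c2(2)[OF 2(1)] unfolding 2(2,3) by simp
      then show ?thesis using le(2)[OF \<open>0 < S\<close>] by simp
    qed
  qed
  moreover have "c > 0" using c1 c2 by (simp add: c_def)
  ultimately show ?case by blast
qed

lemma val_le:
  assumes "finite Rs"
  shows "\<exists>C::nat. \<forall>\<rho>\<in>Rs. \<forall>S W. 0 \<le> S \<longrightarrow> \<bar>W\<bar> \<le> D * S \<longrightarrow>
    val_S \<rho> S \<le> real C * S \<and> val_W ix \<rho> S W \<le> real C * S"
  using assms
proof (induction Rs rule: finite_induct)
  case empty
  show ?case by simp
next
  case (insert \<rho> Rs)
  obtain C1 :: nat where C1: "\<And>\<rho> S W. \<rho> \<in> Rs \<Longrightarrow> 0 \<le> S \<Longrightarrow> \<bar>W\<bar> \<le> D * S \<Longrightarrow>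
      val_S \<rho> S \<le> real C1 * S \<and> val_W ix \<rho> S W \<le> real C1 * S"
    using insert by blast
  define A :: real where "A = 2 powi db \<rho> * (2 * real (ix (tgt \<rho>)) + 2 powi (- da \<rho>) * (\<bar>D\<bar> + 2 * real (ix (src \<rho>))))"
  have pos: "0 < (2::real) powi n" for n by simp
  obtain C2 :: nat where C2: "max (2 powi db \<rho>) A \<le> C2" using real_arch_simple by blast
  have C2': "val_S \<rho> S \<le> real C2 * S \<and> val_W ix \<rho> S W \<le> real C2 * S" if S: "0 \<le> S" "\<bar>W\<bar> \<le> D * S" for S W
  proof
    show "val_S \<rho> S \<le> real C2 * S"
      unfolding val_S_def using C2 S by (intro mult_right_mono) auto
    have "W \<le> \<bar>D\<bar> * S" using S mult_right_mono[of D "\<bar>D\<bar>" S] by linarith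
    moreover have "0 \<le> 2 * real (ix (src \<rho>)) * S" using S by simp
    ultimately have "W - 2 * real (ix (src \<rho>)) * S \<le> (\<bar>D\<bar> + 2 * real (ix (src \<rho>))) * S"
      by (simp add: algebra_simps)
    then have "2 powi (- da \<rho>) * (W - 2 * real (ix (src \<rho>)) * S) \<le> 2 powi (- da \<rho>) * ((\<bar>D\<bar> + 2 * real (ix (src \<rho>))) * S)"
      by (intro mult_left_mono) auto
    then have "val_W ix \<rho> S W \<le> 2 powi db \<rho> *
        (2 * real (ix (tgt \<rho>)) * S + 2 powi (- da \<rho>) * ((\<bar>D\<bar> + 2 * real (ix (src \<rho>))) * S))"
      unfolding val_W_def by (intro mult_left_mono add_left_mono) auto
    also have "\<dots> = A * S" by (simp add: A_def algebra_simps)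
    also have "\<dots> \<le> real C2 * S" using C2 S by (intro mult_right_mono) auto
    finally show "val_W ix \<rho> S W \<le> real C2 * S" .
  qed
  have "val_S \<sigma> S \<le> real (C1 + C2) * S \<and> val_W ix \<sigma> S W \<le> real (C1 + C2) * S"
    if "\<sigma> \<in> insert \<rho> Rs" "0 \<le> S" "\<bar>W\<bar> \<le> D * S" for \<sigma> S W
  proof -
    have "real C1 * S \<le> real (C1 + C2) * S" "real C2 * S \<le> real (C1 + C2) * S"
      using that(2) by (auto intro!: mult_right_mono)
    moreover have "val_S \<sigma> S \<le> real C1 * S \<and> val_W ix \<sigma> S W \<le> real C1 * S \<or>
        val_S \<sigma> S \<le> real C2 * S \<and> val_W ix \<sigma> S W \<le> real C2 * S"
      using C1[of \<sigma> S W] C2'[of S W] that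
      by blast
    ultimately show ?thesis by linarith
  qed
  then show ?case by blast
qed

lemma conts_Nil: "[] \<in> conts k"
  by (induction k rule: conts.induct) auto

context machine
begin

text \<open>When \<open>S\<close> is capped at the end of the loading phase, \<open>W = (2 + 1/2) S\<close> is doubled while \<open>S\<close> is
  not; this turns the state 1 with first counter 1 into the state 2 with first counter 0.\<close>

definition ix :: "mstate \<Rightarrow> nat" where
  "ix q = (if q = Ld then 1 else if q = M P then 2 else 3 + to_nat q)"

lemma inj_ix: "inj ix"
  by (auto simp: inj_def ix_def)

lemma ix_Ld: "ix Ld = 1" and ix_start: "ix (M P) = 2" and ix_ge_2: "q \<noteq> Ld \<Longrightarrow> 2 \<le> ix q"
  by (auto simp: ix_def)

text \<open>The slope of a cone that contains the sectors of all states and also the widened sector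
  of the final state, which reaches up to \<open>2 * ix (M []) + 3 / 2\<close>.\<close>

definition width :: real where
  "width = 2 * real (Max (ix ` states)) + 2"

lemma ix_le: "q \<in> states \<Longrightarrow> real (ix q) \<le> real (Max (ix ` states))"
  using finite_states by simp

lemma final_state: "M [] \<in> states"
  by (auto simp: states_def conts_Nil)

lemma pt_W_bounds:
  "2 * real (ix q) * 2 ^ b \<le> pt_W ix (q, a, b)" "pt_W ix (q, a, b) \<le> (2 * real (ix q) + 1) * 2 ^ b"
  using mult_left_mono[of "(1 / 2 :: real) ^ a" 1 "2 ^ b"] power_le_one[of "1 / 2 :: real" a]
  by (simp_all add: algebra_simps)

lemma pt_W_nonneg: "0 \<le> pt_W ix c"
  by (cases c) auto

lemma pt_S_ge_1: "1 \<le> pt_S c"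
  by (cases c) auto

lemma pt_W_le_width: "fst c \<in> states \<Longrightarrow> \<bar>pt_W ix c\<bar> \<le> width * pt_S c"
proof -
  assume c: "fst c \<in> states"
  obtain q a b where [simp]: "c = (q, a, b)" by (cases c)
  have "(2 * real (ix q) + 1) * 2 ^ b \<le> width * 2 ^ b"
    using ix_le[of q] c by (intro mult_right_mono) (auto simp: width_def)
  then show ?thesis using pt_W_bounds(2)[of q a b] pt_W_nonneg[of c] by simp
qed

text \<open>On the cone a rule's value is at most \<open>C * S\<close>, and a missed rule has
  penalty at least \<open>c * S\<close>; so the factor \<open>K\<close>, at least
  \<open>C / c\<close>, silences every missed rule.\<close>

lemma gate_constants:
  "\<exists>K C :: nat. (\<forall>\<rho>\<in>rules. \<forall>S W. misses ix \<rho> S W \<longrightarrow> \<bar>W\<bar> \<le> width * S \<longrightarrow>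
      val_S \<rho> S \<le> real K * pen ix \<rho> S W \<and> val_W ix \<rho> S W \<le> real K * pen ix \<rho> S W) \<and>
    (\<forall>\<rho>\<in>rules. \<forall>S W. 0 \<le> S \<longrightarrow> \<bar>W\<bar> \<le> width * S \<longrightarrow>
      val_S \<rho> S \<le> real C * S \<and> val_W ix \<rho> S W \<le> real C * S)"
proof -
  obtain c where c: "c > 0" "\<And>\<rho> S W. \<rho> \<in> rules \<Longrightarrow> misses ix \<rho> S W \<Longrightarrow> c * S \<le> pen ix \<rho> S W"
    using pen_misses[OF finite_rules] by blast
  obtain C :: nat where C: "\<And>\<rho> S W. \<rho> \<in> rules \<Longrightarrow> 0 \<le> S \<Longrightarrow> \<bar>W\<bar> \<le> width * S \<Longrightarrow>
      val_S \<rho> S \<le> real C * S \<and> val_W ix \<rho> S W \<le> real C * S"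
    using val_le[OF finite_rules] by blast
  obtain K :: nat where K: "real C / c \<le> real K" using real_arch_simple by blast
  have "real C * S \<le> real K * pen ix \<rho> S W" if "\<rho> \<in> rules" "misses ix \<rho> S W" for \<rho> S W
  proof -
    have "real C * S = real C / c * (c * S)" using c(1) by simp
    also have "\<dots> \<le> real K * pen ix \<rho> S W"
      using K c that misses_pos[OF that(2)] by (intro mult_mono) auto
    finally show ?thesis .
  qed
  moreover have "val_S \<rho> S \<le> real C * S \<and> val_W ix \<rho> S W \<le> real C * S"
    if "\<rho> \<in> rules" "misses ix \<rho> S W" "\<bar>W\<bar> \<le> width * S" for \<rho> S W
    using C[OF that(1) _ that(3)] misses_pos[OF that(2)] by simp
  ultimately have "val_S \<rho> S \<le> real K * pen ix \<rho> S W \<and> val_W ix \<rho> S W \<le> real K * pen ix \<rho> S W"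
    if "\<rho> \<in> rules" "misses ix \<rho> S W" "\<bar>W\<bar> \<le> width * S" for \<rho> S W
    using that by (meson order_trans)
  with C show ?thesis by blast
qed

end

section \<open>The three coordinates of the simulating map\<close>

locale gadget = machine +
  fixes K C :: nat
  assumes gate: "\<And>\<rho> S W. \<rho> \<in> rules \<Longrightarrow> misses ix \<rho> S W \<Longrightarrow> \<bar>W\<bar> \<le> width * S \<Longrightarrow>
      val_S \<rho> S \<le> real K * pen ix \<rho> S W \<and> val_W ix \<rho> S W \<le> real K * pen ix \<rho> S W"
    and growth: "\<And>\<rho> S W. \<rho> \<in> rules \<Longrightarrow> 0 \<le> S \<Longrightarrow> \<bar>W\<bar> \<le> width * S \<Longrightarrow>
      val_S \<rho> S \<le> real C * S \<and> val_W ix \<rho> S W \<le> real C * S"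
begin

text \<open>A cycle has at most \<open>(cl + 6) * n^2\<close> steps, and \<open>n^2 + 4\<close> is
  at most \<open>4 * 2 ^ n\<close> for positive \<open>n\<close>. So
  \<open>kb * (2 ^ n - 1)\<close>, the gain at a halt with plenty of fuel, covers the cycle.\<close>

definition kb :: nat where
  "kb = 4 * (cl + 6)"

definition final_pen :: "real^3 \<Rightarrow> real" where
  "final_pen x = \<bar>x $ 2 - (2 * real (ix (M [])) + 1) * x $ 1\<bar>"

text \<open>This exceeds the first bracket of \<open>gain\<close> by \<open>3 * x $ 1 + kb\<close>.
  Hence, where that bracket is positive, it is above 5/2 and the reset terms saturate at 1 and 5/2,
  the coordinates of \<open>(Ld, 1, 0)\<close>. At nonfinal configurations
  \<open>final_pen x\<close> is at least \<open>x $ 1\<close>, and the terms vanish.\<close>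

definition reset :: "real^3 \<Rightarrow> real" where
  "reset x = real (kb + 3) * x $ 1 - real (2 * (kb + 3)) * final_pen x"

definition phi_S :: "real^3 \<Rightarrow> real" where
  "phi_S x = (\<Sum>\<rho>\<in>rules. max 0 (val_S \<rho> (x $ 1) - real K * pen ix \<rho> (x $ 1) (x $ 2))) +
    max 0 (min 1 (reset x))"

definition phi_W :: "real^3 \<Rightarrow> real" where
  "phi_W x = (\<Sum>\<rho>\<in>rules. max 0 (val_W ix \<rho> (x $ 1) (x $ 2) - real K * pen ix \<rho> (x $ 1) (x $ 2))) +
    max 0 (min (5 / 2) (reset x))"

text \<open>A gain requires more than 3 units of fuel, so clamping by the fuel leaves the reset
  values 1 and 5/2 intact and there is no gain near the origin.\<close>

definition gain :: "real^3 \<Rightarrow> real" where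
  "gain x = max 0 (min (real kb * (x $ 1 - 1) - real (2 * (kb + 3)) * final_pen x) (x $ 3 - 3))"

definition next_S :: "real^3 \<Rightarrow> real" where
  "next_S x = min (phi_S x) (max 0 (x $ 3))"

definition next_W :: "real^3 \<Rightarrow> real" where
  "next_W x = min (phi_W x) (max 0 (x $ 3))"

definition next_fuel :: "nat \<Rightarrow> real^3 \<Rightarrow> real" where
  "next_fuel \<eta> x =
    max 0 (min (x $ 3 - 1) (2 * x $ 3 - 2 * real \<eta> * (\<bar>x $ 1\<bar> + \<bar>x $ 2\<bar>))) + gain x"

lemma low_rational: "low n \<in> \<rat>"
  by (auto simp: low_def split: option.split)

lemma powi_rational: "2 powi n \<in> (\<rat> :: real set)"
  by (simp add: power_int_def)

lemma dc_pen: "dc (\<lambda>x :: real^3. pen ix \<rho> (x $ 1) (x $ 2))"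
  unfolding pen_def by (intro dc_intros Rats_add Rats_mult low_rational) auto

lemma dc_final_pen: "dc final_pen"
  unfolding final_pen_def[abs_def] by (intro dc_intros) auto

lemma dc_reset: "dc reset"
  unfolding reset_def[abs_def] by (intro dc_intros dc_final_pen) auto

lemma dc_next_S: "dc next_S"
  unfolding next_S_def[abs_def] phi_S_def[abs_def] val_S_def
  by (intro dc_intros dc_pen dc_reset finite_rules powi_rational) auto

lemma dc_next_W: "dc next_W"
  unfolding next_W_def[abs_def] phi_W_def[abs_def] val_W_def
  by (intro dc_intros dc_pen dc_reset finite_rules powi_rational Rats_mult) auto

lemma dc_next_fuel: "dc (next_fuel \<eta>)"
proof -
  have "dc gain"
    unfolding gain_def[abs_def] by (intro dc_intros dc_final_pen) auto
  moreover have "dc (\<lambda>x :: real^3. max 0 (min (x $ 3 - 1) (2 * x $ 3 - 2 * real \<eta> * (\<bar>x $ 1\<bar> + \<bar>x $ 2\<bar>))))"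
    by (intro dc_intros) auto
  ultimately show ?thesis
    unfolding next_fuel_def[abs_def] by (intro dc_add)
qed

lemma phi_nonneg: "0 \<le> phi_S x" "0 \<le> phi_W x"
  by (simp_all add: phi_S_def phi_W_def sum_nonneg)

lemma next_zero: "next_S 0 = 0" "next_W 0 = 0" "next_fuel \<eta> 0 = 0"
  using phi_nonneg[of 0] by (simp_all add: next_S_def next_W_def next_fuel_def gain_def final_pen_def)

lemma final_pen_nonneg: "0 \<le> final_pen x"
  by (simp add: final_pen_def)

text \<open>The final ray with first counter 0 is the upper edge of its sector; every other sector
  keeps distance at least \<open>S\<close> from it.\<close>

lemma final_pen_config:
  assumes "fst c \<noteq> M []" "x $ 1 = pt_S c" "x $ 2 = pt_W ix c"
  shows "x $ 1 \<le> final_pen x"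
proof -
  obtain q a b where c: "c = (q, a, b)" by (cases c)
  have ne: "ix q \<noteq> ix (M [])" using assms(1) inj_ix c by (auto dest: injD)
  show ?thesis
  proof (cases "ix q < ix (M [])")
    case True
    then have "(2 * real (ix q) + 1) * 2 ^ b \<le> (2 * real (ix (M [])) - 1) * 2 ^ b"
      by (intro mult_right_mono) auto
    then have "x $ 2 \<le> (2 * real (ix (M [])) - 1) * x $ 1"
      using pt_W_bounds(2)[of q a b] assms c by simp
    then show ?thesis using assms(2) pt_S_ge_1[of c] by (simp add: final_pen_def algebra_simps)
  next
    case False
    then have "ix (M []) + 1 \<le> ix q" using ne by simp
    then have "2 * real (ix (M [])) + 2 \<le> 2 * real (ix q)" by linarith
    then have le: "(2 * real (ix (M [])) + 2) * 2 ^ b \<le> (2 * real (ix q)) * 2 ^ b"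
      by (intro mult_right_mono) auto
    have x: "x $ 1 = 2 ^ b" "x $ 2 = pt_W ix (q, a, b)" using assms(2,3) c by simp_all
    have "(2 * real (ix (M [])) + 2) * x $ 1 \<le> x $ 2"
      unfolding x by (rule order_trans[OF le pt_W_bounds(1)])
    then show ?thesis by (simp add: final_pen_def algebra_simps)
  qed
qed

lemma gain_zero:
  assumes "fst c \<noteq> M []" "x $ 1 = pt_S c" "x $ 2 = pt_W ix c"
  shows "gain x = 0"
proof -
  have "real kb * (x $ 1 - 1) \<le> real (2 * (kb + 3)) * x $ 1"
    using pt_S_ge_1[of c] assms(2) by (intro mult_mono) auto
  also have "\<dots> \<le> real (2 * (kb + 3)) * final_pen x"
    using final_pen_config[OF assms] by (intro mult_left_mono) auto
  finally show ?thesis by (simp add: gain_def)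
qed

lemma gain_final:
  assumes "x $ 1 = pt_S (M [], 0, n)" "x $ 2 = pt_W ix (M [], 0, n)"
  shows "gain x = max 0 (min (real kb * (2 ^ n - 1)) (x $ 3 - 3))"
proof -
  have "final_pen x = 0" using assms by (simp add: final_pen_def algebra_simps)
  then show ?thesis using assms(1) by (simp add: gain_def)
qed

lemma phi_rule:
  assumes "fst c \<in> states" "fst c \<noteq> M []" "\<rho> \<in> rules" "applies \<rho> c" "x $ 1 = pt_S c" "x $ 2 = pt_W ix c"
  shows "phi_S x = pt_S (act \<rho> c)" "phi_W x = pt_W ix (act \<rho> c)"
proof -
  have "reset x \<le> 0"
  proof -
    have "real (kb + 3) * x $ 1 \<le> real (2 * (kb + 3)) * final_pen x"
      using final_pen_config[OF assms(2,5,6)] pt_S_ge_1[of c] assms(5) by (intro mult_mono) auto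
    then show ?thesis by (simp add: reset_def)
  qed
  have width: "\<bar>x $ 2\<bar> \<le> width * x $ 1" using pt_W_le_width[OF assms(1)] assms(5,6) by simp
  have other: "max 0 (val_S \<sigma> (x $ 1) - real K * pen ix \<sigma> (x $ 1) (x $ 2)) = 0 \<and>
      max 0 (val_W ix \<sigma> (x $ 1) (x $ 2) - real K * pen ix \<sigma> (x $ 1) (x $ 2)) = 0"
    if "\<sigma> \<in> rules" "\<sigma> \<noteq> \<rho>" for \<sigma>
  proof -
    have "\<not> applies \<sigma> c" using deterministic[OF that(1) assms(3) _ assms(4)] that(2) by blast
    then have "misses ix \<sigma> (x $ 1) (x $ 2)" using misses_config[OF inj_ix] assms(5,6) by simp
    from gate[OF that(1) this width] show ?thesis by simp
  qed
  have pen0: "pen ix \<rho> (x $ 1) (x $ 2) = 0" using pen_applies[OF assms(4)] assms(5,6) by simp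
  have val: "val_S \<rho> (x $ 1) = pt_S (act \<rho> c)" "val_W ix \<rho> (x $ 1) (x $ 2) = pt_W ix (act \<rho> c)"
    using val_act[OF assms(4) safe_rules[OF assms(3)]] assms(5,6) by simp_all
  have "(\<Sum>\<sigma>\<in>rules. max 0 (val_S \<sigma> (x $ 1) - real K * pen ix \<sigma> (x $ 1) (x $ 2))) =
      (\<Sum>\<sigma>\<in>rules. if \<sigma> = \<rho> then pt_S (act \<rho> c) else 0)"
    using other pen0 val(1) pt_S_ge_1[of "act \<rho> c"] by (intro sum.cong) auto
  also have "\<dots> = pt_S (act \<rho> c)" using assms(3) finite_rules by simp
  finally show "phi_S x = pt_S (act \<rho> c)" using \<open>reset x \<le> 0\<close> by (simp add: phi_S_def)
  have "(\<Sum>\<sigma>\<in>rules. max 0 (val_W ix \<sigma> (x $ 1) (x $ 2) - real K * pen ix \<sigma> (x $ 1) (x $ 2))) =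
      (\<Sum>\<sigma>\<in>rules. if \<sigma> = \<rho> then pt_W ix (act \<rho> c) else 0)"
    using other pen0 val(2) pt_W_nonneg[of "act \<rho> c"] by (intro sum.cong) auto
  also have "\<dots> = pt_W ix (act \<rho> c)" using assms(3) finite_rules by simp
  finally show "phi_W x = pt_W ix (act \<rho> c)" using \<open>reset x \<le> 0\<close> by (simp add: phi_W_def)
qed

text \<open>The reset is exact on the whole region where the bracket of \<open>gain\<close> is
  positive, not just at final configurations. Positivity forces \<open>final_pen x\<close> below
  half of \<open>x $ 1\<close>; the point then lies in the widened final sector, where every rule is
  missed.\<close>

lemma phi_reset:
  assumes "0 < real kb * (x $ 1 - 1) - real (2 * (kb + 3)) * final_pen x"
  shows "phi_S x = 1" "phi_W x = 5 / 2"
proof -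
  have "0 \<le> real (2 * (kb + 3)) * final_pen x" using final_pen_nonneg by simp
  then have "0 < real kb * (x $ 1 - 1)" using assms by linarith
  then have S: "1 < x $ 1" by (simp add: zero_less_mult_iff)
  have "real kb * (x $ 1 - 1) \<le> real (kb + 3) * x $ 1" using S by (intro mult_mono) auto
  moreover have "real (kb + 3) * (2 * final_pen x) = real (2 * (kb + 3)) * final_pen x" by simp
  ultimately have "real (kb + 3) * (2 * final_pen x) \<le> real (kb + 3) * x $ 1" using assms by linarith
  moreover have "0 < real (kb + 3)" by simp
  ultimately have near: "final_pen x \<le> x $ 1 / 2" by (simp only: mult_le_cancel_left_pos)
  let ?j = "ix (M [])"
  have W: "(2 * real ?j + 1 / 2) * x $ 1 \<le> x $ 2" "x $ 2 \<le> (2 * real ?j + 3 / 2) * x $ 1"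
  proof -
    have "x $ 2 - (2 * real ?j + 1) * x $ 1 \<le> x $ 1 / 2" "(2 * real ?j + 1) * x $ 1 - x $ 2 \<le> x $ 1 / 2"
      using near unfolding final_pen_def by linarith+
    then show "(2 * real ?j + 1 / 2) * x $ 1 \<le> x $ 2" "x $ 2 \<le> (2 * real ?j + 3 / 2) * x $ 1"
      by (simp_all add: algebra_simps)
  qed
  have "0 \<le> (2 * real ?j + 1 / 2) * x $ 1" using S by simp
  moreover have "(2 * real ?j + 3 / 2) * x $ 1 \<le> width * x $ 1"
    using ix_le[OF final_state] S by (intro mult_right_mono) (auto simp: width_def)
  ultimately have width: "\<bar>x $ 2\<bar> \<le> width * x $ 1" using W by linarith
  have zero: "max 0 (val_S \<sigma> (x $ 1) - real K * pen ix \<sigma> (x $ 1) (x $ 2)) = 0 \<and>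
      max 0 (val_W ix \<sigma> (x $ 1) (x $ 2) - real K * pen ix \<sigma> (x $ 1) (x $ 2)) = 0"
    if "\<sigma> \<in> rules" for \<sigma>
  proof -
    have "?j \<noteq> ix (src \<sigma>)" using src_not_final[OF that] inj_ix by (auto dest: injD)
    moreover have "(2 * real ?j - 1 / 2) * x $ 1 \<le> x $ 2"
      using W(1) S by (simp add: algebra_simps)
    ultimately have "misses ix \<sigma> (x $ 1) (x $ 2)"
      unfolding misses_def using W(2) S by (intro disjI1 exI[of _ ?j]) auto
    from gate[OF that this width] show ?thesis by simp
  qed
  have "5 / 2 \<le> reset x"
  proof -
    have "reset x \<ge> real (kb + 3) * x $ 1 - real kb * (x $ 1 - 1)" using assms by (simp add: reset_def)
    then show ?thesis using S by (simp add: algebra_simps)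
  qed
  then show "phi_S x = 1" "phi_W x = 5 / 2" using zero by (simp_all add: phi_S_def phi_W_def)
qed

text \<open>The cap on the first coordinate: \<open>\<kappa>\<close> vanishes where loading ends and dominates elsewhere.\<close>

definition capped :: "(real^3 \<Rightarrow> real) \<Rightarrow> nat \<Rightarrow> nat \<Rightarrow> real^3 \<Rightarrow> real^3" where
  "capped \<kappa> \<eta> N x = vector [min (next_S x) (2 ^ N + \<kappa> x), next_W x, next_fuel \<eta> x]"

text \<open>Enough fuel disables the clamp, as next values are at most \<open>C * S\<close>. The cap
  bites only when loading ends: earlier on the loading ray the next value is at most
  \<open>2 ^ N\<close>, and in all other states \<open>W\<close> is at least \<open>4 * S\<close>,
  so that \<open>4 * C * |W - 5 / 2 * S|\<close> already exceeds or equals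
  \<open>C * S\<close>.\<close>

lemma capped_follows:
  assumes c: "good N c" "fst c \<noteq> M []"
    and x: "x $ 1 = pt_S c" "x $ 2 = pt_W ix c" "x $ 3 > real \<eta> * (\<bar>x $ 1\<bar> + \<bar>x $ 2\<bar>)"
    and \<kappa>: "\<And>x. 0 \<le> \<kappa> x" "\<And>x. 4 * real C * \<bar>x $ 2 - 5 / 2 * x $ 1\<bar> \<le> \<kappa> x"
      "\<And>z. real \<eta> * 2 ^ N \<le> z \<Longrightarrow> \<kappa> (vector [2 ^ N, 5 / 2 * 2 ^ N, z]) = 0"
    and \<eta>: "C \<le> \<eta>"
  shows "capped \<kappa> \<eta> N x $ 1 = pt_S (nxt N c) \<and> capped \<kappa> \<eta> N x $ 2 = pt_W ix (nxt N c)"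
proof -
  have st: "fst c \<in> states" using c(1) by (auto simp: good_def)
  obtain \<rho> where \<rho>: "\<rho> \<in> rules" "applies \<rho> c" using rule_exists[OF c] by blast
  note phi = phi_rule[OF st c(2) \<rho> x(1,2)]
  have S: "1 \<le> x $ 1" using pt_S_ge_1[of c] x(1) by simp
  have "\<bar>x $ 2\<bar> \<le> width * x $ 1" using pt_W_le_width[OF st] x by simp
  from growth[OF \<rho>(1) _ this] have "val_S \<rho> (x $ 1) \<le> real C * x $ 1" "val_W ix \<rho> (x $ 1) (x $ 2) \<le> real C * x $ 1"
    using S by auto
  then have le: "phi_S x \<le> real C * x $ 1" "phi_W x \<le> real C * x $ 1"
    using phi val_act[OF \<rho>(2) safe_rules[OF \<rho>(1)]] x by simp_all
  have "real C * x $ 1 \<le> real \<eta> * (\<bar>x $ 1\<bar> + \<bar>x $ 2\<bar>)"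
    using \<eta> S by (intro mult_mono) auto
  then have z: "real C * x $ 1 \<le> x $ 3" "0 \<le> x $ 3" using x(3) S
    by (auto intro: order_trans[OF mult_nonneg_nonneg, of "real C" "x $ 1"])
  have step: "next_S x = phi_S x" "next_W x = phi_W x"
    using le z by (simp_all add: next_S_def next_W_def)
  show ?thesis
  proof (cases "fst c = Ld")
    case True
    then obtain b where cb: "c = (Ld, 1, b)" "b \<le> N"
      using c(1) by (cases c) (auto simp: good_def)
    have "\<rho> = load_rule"
      using deterministic[OF \<rho>(1) _ \<rho>(2), of load_rule] cb by (auto simp: rules_def load_rule_def)
    then have act: "act \<rho> c = (Ld, 1, Suc b)" using cb by (simp add: load_rule_def)
    show ?thesis
    proof (cases "b = N")
      case True
      have nx: "nxt N c = (M P, 0, N)" using cb True by (simp add: nxt_def)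
      have "x = vector [2 ^ N, 5 / 2 * 2 ^ N, x $ 3]"
        using x cb True by (simp add: vec_eq_iff forall_3 ix_Ld)
      moreover have "real \<eta> * 2 ^ N \<le> x $ 3"
      proof -
        have "real \<eta> * 2 ^ N \<le> real \<eta> * (\<bar>x $ 1\<bar> + \<bar>x $ 2\<bar>)"
          using x(1) cb True by (intro mult_left_mono) auto
        then show ?thesis using x(3) by simp
      qed
      ultimately have "\<kappa> x = 0" using \<kappa>(3)[of "x $ 3"] by simp
      then show ?thesis
        using phi step act nx True by (simp add: capped_def ix_Ld ix_start)
    next
      case False
      then have "c \<noteq> (Ld, 1, N)" using cb by simp
      from nxt_rule[OF \<rho> this] have nx: "nxt N c = act \<rho> c" .
      have "(2 :: real) ^ Suc b \<le> 2 ^ N" using False cb by (intro power_increasing) auto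
      then have "phi_S x \<le> 2 ^ N + \<kappa> x" using phi(1) act \<kappa>(1)[of x] by simp
      then show ?thesis using phi step nx by (simp add: capped_def)
    qed
  next
    case False
    then have "c \<noteq> (Ld, 1, N)" by auto
    from nxt_rule[OF \<rho> this] have nx: "nxt N c = act \<rho> c" .
    obtain q a b where q: "c = (q, a, b)" by (cases c)
    have "2 \<le> ix q" using False q ix_ge_2[of q] by simp
    then have le4: "4 * 2 ^ b \<le> 2 * real (ix q) * 2 ^ b" by (intro mult_right_mono) auto
    have xq: "x $ 1 = 2 ^ b" "x $ 2 = pt_W ix (q, a, b)" using x q by simp_all
    have "4 * x $ 1 \<le> x $ 2" unfolding xq by (rule order_trans[OF le4 pt_W_bounds(1)])
    then have "x $ 1 \<le> 4 * \<bar>x $ 2 - 5 / 2 * x $ 1\<bar>"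
      using S abs_ge_self[of "x $ 2 - 5 / 2 * x $ 1"] by argo
    then have "real C * x $ 1 \<le> real C * (4 * \<bar>x $ 2 - 5 / 2 * x $ 1\<bar>)" by (intro mult_left_mono) auto
    then have "phi_S x \<le> \<kappa> x"
      using le(1) \<kappa>(2)[of x] by (simp add: mult.assoc mult.left_commute)
    also have "\<kappa> x \<le> 2 ^ N + \<kappa> x" by simp
    finally have "phi_S x \<le> 2 ^ N + \<kappa> x" .
    then show ?thesis using phi step nx by (simp add: capped_def)
  qed
qed

lemma capped_simps:
  "capped \<kappa> \<eta> N x $ 1 = min (next_S x) (2 ^ N + \<kappa> x)"
  "capped \<kappa> \<eta> N x $ 2 = next_W x"
  "capped \<kappa> \<eta> N x $ 3 = next_fuel \<eta> x"
  by (simp_all add: capped_def)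

lemma capped_fuel_map:
  assumes "\<And>x. 0 \<le> \<kappa> x"
  shows "fuel_map (capped \<kappa> \<eta> N) gain
    (\<lambda>n. pt_S ((nxt N ^^ n) (Ld, 1, 0))) (\<lambda>n. pt_W ix ((nxt N ^^ n) (Ld, 1, 0))) (real \<eta>)"
proof
  fix x :: "real^3"
  have "0 \<le> 2 ^ N + \<kappa> x" using assms[of x] by (simp add: add_nonneg_nonneg)
  then show "0 \<le> capped \<kappa> \<eta> N x $ 1 \<and> capped \<kappa> \<eta> N x $ 1 \<le> max 0 (x $ 3) \<and>
      0 \<le> capped \<kappa> \<eta> N x $ 2 \<and> capped \<kappa> \<eta> N x $ 2 \<le> max 0 (x $ 3)"
    using phi_nonneg[of x] by (simp add: capped_simps next_S_def next_W_def)
  show "capped \<kappa> \<eta> N x $ 3 =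
      max 0 (min (x $ 3 - 1) (2 * x $ 3 - 2 * real \<eta> * (\<bar>x $ 1\<bar> + \<bar>x $ 2\<bar>))) + gain x"
    by (simp add: capped_simps next_fuel_def)
  show "0 \<le> gain x" by (simp add: gain_def)
  show "gain x = 0" if "x $ 3 \<le> 1" using that by (simp add: gain_def)
  show "capped \<kappa> \<eta> N x $ 1 = pt_S ((nxt N ^^ 0) (Ld, 1, 0)) \<and>
      capped \<kappa> \<eta> N x $ 2 = pt_W ix ((nxt N ^^ 0) (Ld, 1, 0))" if "0 < gain x"
  proof -
    have pos: "0 < real kb * (x $ 1 - 1) - real (2 * (kb + 3)) * final_pen x" "3 < x $ 3"
      using that by (auto simp: gain_def)
    have "1 \<le> 2 ^ N + \<kappa> x" using assms[of x] one_le_power[of "2 :: real" N] by linarith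
    then show ?thesis
      using phi_reset[OF pos(1)] pos(2) by (simp add: capped_simps next_S_def next_W_def ix_Ld)
  qed
qed

lemma capped_stable_iff:
  assumes \<kappa>: "\<And>x. 0 \<le> \<kappa> x" "\<And>x. 4 * real C * \<bar>x $ 2 - 5 / 2 * x $ 1\<bar> \<le> \<kappa> x"
      "\<And>z. real \<eta> * 2 ^ N \<le> z \<Longrightarrow> \<kappa> (vector [2 ^ N, 5 / 2 * 2 ^ N, z]) = 0"
    and \<eta>: "C \<le> \<eta>" and s: "code 0 s = N"
  shows "(\<forall>\<epsilon>>0. \<exists>\<delta>>0. \<forall>x. norm x < \<delta> \<longrightarrow> (\<forall>k. norm ((capped \<kappa> \<eta> N ^^ k) x) < \<epsilon>)) \<and>
      (\<forall>x. (\<lambda>k. (capped \<kappa> \<eta> N ^^ k) x) \<longlonglongrightarrow> 0) \<longleftrightarrow> \<not> halts P s"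
proof -
  interpret fuel_map "capped \<kappa> \<eta> N" gain "\<lambda>n. pt_S ((nxt N ^^ n) (Ld, 1, 0))"
    "\<lambda>n. pt_W ix ((nxt N ^^ n) (Ld, 1, 0))" "real \<eta>"
    using capped_fuel_map[OF \<kappa>(1)] .
  show ?thesis
  proof (cases "halts P s")
    case False
    note run = machine_runs_forever[OF False s]
    have good: "good N ((nxt N ^^ n) (Ld, 1, 0))" for n using good_run run by blast
    have "(\<lambda>k. (capped \<kappa> \<eta> N ^^ k) x) \<longlonglongrightarrow> 0" for x
    proof (rule attractive)
      fix n and x :: "real^3"
      assume x: "x $ 1 = pt_S ((nxt N ^^ n) (Ld, 1, 0))" "x $ 2 = pt_W ix ((nxt N ^^ n) (Ld, 1, 0))"
      then show "gain x = 0" by (rule gain_zero[OF run])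
      assume "x $ 3 > real \<eta> * (\<bar>x $ 1\<bar> + \<bar>x $ 2\<bar>)"
      from capped_follows[OF good run x this \<kappa> \<eta>]
      show "capped \<kappa> \<eta> N x $ 1 = pt_S ((nxt N ^^ Suc n) (Ld, 1, 0)) \<and>
          capped \<kappa> \<eta> N x $ 2 = pt_W ix ((nxt N ^^ Suc n) (Ld, 1, 0))" by simp
    qed
    then show ?thesis using stable False by blast
  next
    case True
    obtain T n where T: "1 \<le> n" "T + 1 \<le> (cl + 6) * n\<^sup>2" "reach N (Ld, 1, 0) T (M [], 0, n)"
      using machine_halts[OF True s] by blast
    have run: "fst ((nxt N ^^ i) (Ld, 1, 0)) \<noteq> M []" if "i < T" for i
      using T(3) that by (simp add: reach_def)
    have good: "good N ((nxt N ^^ i) (Ld, 1, 0))" if "i < T" for i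
      using good_run[of i] run that by simp
    have final: "(nxt N ^^ T) (Ld, 1, 0) = (M [], 0, n)" using T(3) by (simp add: reach_def)
    have bonus: "real T + 1 \<le> real kb * (2 ^ n - 1)"
    proof -
      have "n\<^sup>2 + 4 \<le> 4 * 2 ^ n" using T(1)
      proof (induction n rule: dec_induct)
        case (step n)
        have "Suc n < 2 ^ Suc n" by (rule less_exp)
        then have "2 * n + 1 \<le> 4 * 2 ^ n" by simp
        moreover have "(Suc n)\<^sup>2 = n\<^sup>2 + (2 * n + 1)" by (simp add: power2_eq_square)
        ultimately show ?case using step by simp
      qed simp
      then have "(cl + 6) * (n\<^sup>2 + 4) \<le> (cl + 6) * (4 * 2 ^ n)" by (rule mult_le_mono2)
      then have "T + 1 + kb \<le> kb * 2 ^ n" using T(2) by (simp add: kb_def algebra_simps)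
      then have "real (T + 1 + kb) \<le> real (kb * 2 ^ n)" by (simp only: of_nat_le_iff)
      then show ?thesis by (simp add: algebra_simps)
    qed
    have "\<exists>x. \<not> (\<lambda>k. (capped \<kappa> \<eta> N ^^ k) x) \<longlonglongrightarrow> 0"
    proof (rule not_attractive[where T = T and Z = 3])
      fix i and x :: "real^3"
      assume i: "i < T" and x: "x $ 1 = pt_S ((nxt N ^^ i) (Ld, 1, 0))" "x $ 2 = pt_W ix ((nxt N ^^ i) (Ld, 1, 0))"
      then show "gain x = 0" by (intro gain_zero[OF run])
      assume "x $ 3 > real \<eta> * (\<bar>x $ 1\<bar> + \<bar>x $ 2\<bar>)"
      from capped_follows[OF good[OF i] run[OF i] x this \<kappa> \<eta>]
      show "capped \<kappa> \<eta> N x $ 1 = pt_S ((nxt N ^^ Suc i) (Ld, 1, 0)) \<and>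
          capped \<kappa> \<eta> N x $ 2 = pt_W ix ((nxt N ^^ Suc i) (Ld, 1, 0))" by simp
    next
      fix x :: "real^3"
      assume "x $ 1 = pt_S ((nxt N ^^ T) (Ld, 1, 0))" "x $ 2 = pt_W ix ((nxt N ^^ T) (Ld, 1, 0))"
      then have "gain x = max 0 (min (real kb * (2 ^ n - 1)) (x $ 3 - 3))"
        unfolding final by (rule gain_final)
      then show "min (real T + 1) (x $ 3 - 3) \<le> gain x" using bonus by auto
    qed simp
    then show ?thesis using True by blast
  qed
qed

section \<open>Realisation by instances that differ in one number\<close>

lemma realised_simulation:
  "\<exists>L D e a b N0. 0 < D \<and> (\<forall>N\<ge>N0. difference_mpc (L @ [(a, b, of_nat (D * 2 ^ N + e))]) \<in> everywhere_feasible_instances \<and>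
    (\<forall>s. code 0 s = N \<longrightarrow>
      (globally_asymptotically_stable (difference_mpc (L @ [(a, b, of_nat (D * 2 ^ N + e))])) \<longleftrightarrow> \<not> halts P s)))"
proof -
  obtain g1 h1 where 1: "max_affine g1" "max_affine h1" "balanced g1 h1" "\<And>x. next_S x = g1 x - h1 x"
    using dc_balanced[OF dc_next_S next_zero(1)] by blast
  obtain g2 h2 where 2: "max_affine g2" "max_affine h2" "balanced g2 h2" "\<And>x. next_W x = g2 x - h2 x"
    using dc_balanced[OF dc_next_W next_zero(2)] by blast
  obtain p S0 \<eta>0 where p: "\<And>x. aff p x \<le> g1 x"
    "\<And>S z. S \<ge> S0 \<Longrightarrow> z \<ge> \<eta>0 * S \<Longrightarrow> aff p (vector [S, 5 / 2 * S, z]) = g1 (vector [S, 5 / 2 * S, z])"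
    using max_affine_dominating_piece[OF 1(1), of "5 / 2"] by metis
  \<comment> \<open>Fuel above the threshold has to keep the clamp inactive, whence
    \<open>C\<close>, and to put the end of loading where \<open>p\<close> attains
    \<open>g1\<close>, whence \<open>\<eta>0\<close>. There is no circularity: \<open>p\<close>
    comes from \<open>g1\<close>, which does not involve \<open>\<eta>\<close>, and the fuel
    coordinate is decomposed only afterwards.\<close>
  obtain \<eta> :: nat where \<eta>: "max (real C) \<eta>0 \<le> real \<eta>" using real_arch_simple by blast
  obtain g3 h3 where 3: "max_affine g3" "max_affine h3" "balanced g3 h3" "\<And>x. next_fuel \<eta> x = g3 x - h3 x"
    using dc_balanced[OF dc_next_fuel next_zero(3)] by blast
  define wall :: "real^3 \<Rightarrow> real" where "wall x = 4 * real C * \<bar>x $ 2 - 5 / 2 * x $ 1\<bar>" for x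
  have wall: "max_affine wall"
  proof -
    have affs: "aff ((\<chi> i. if i = 1 then - 5 / 2 else if i = 2 then 1 else 0), 0) = (\<lambda>x :: real^3. x $ 2 - 5 / 2 * x $ 1)"
      "aff ((\<chi> i. if i = 1 then 5 / 2 else if i = 2 then - 1 else 0), 0) = (\<lambda>x :: real^3. - (x $ 2 - 5 / 2 * x $ 1))"
      by (simp_all add: aff_def fun_eq_iff inner_vec_def sum_3 of_rat_divide of_rat_minus)
    have "max_affine (\<lambda>x :: real^3. x $ 2 - 5 / 2 * x $ 1)" "max_affine (\<lambda>x :: real^3. - (x $ 2 - 5 / 2 * x $ 1))"
      unfolding affs[symmetric] by (rule max_affine_aff)+
    then have "max_affine (\<lambda>x :: real^3. max (x $ 2 - 5 / 2 * x $ 1) (- (x $ 2 - 5 / 2 * x $ 1)))"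
      by (rule max_affine_max)
    moreover have "(\<lambda>x :: real^3. max (x $ 2 - 5 / 2 * x $ 1) (- (x $ 2 - 5 / 2 * x $ 1))) = (\<lambda>x. \<bar>x $ 2 - 5 / 2 * x $ 1\<bar>)"
      by auto
    ultimately show ?thesis
      unfolding wall_def[abs_def] by (intro max_affine_scale) auto
  qed
  have wall_nonneg: "0 \<le> wall x" for x by (simp add: wall_def)
  define g where "g i = (if i = 1 then \<lambda>x. g1 x + wall x else if i = 2 then g2 else g3)" for i :: 3
  define h where "h i = (if i = 1 then \<lambda>x. h1 x + wall x else if i = 2 then h2 else h3)" for i :: 3
  \<comment> \<open>From \<open>G - max H (aff p x - 2 ^ N) = min (G - H) (2 ^ N + G - aff p
    x)\<close>, one more lower bound on the input for \<open>H\<close> is a cap on the difference.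
    Here \<open>G = g1 x + wall x\<close>; adding the wall to both \<open>g1\<close> and
    \<open>h1\<close> leaves the difference \<open>next_S\<close> unchanged but raises the cap off
    the loading ray.\<close>
  define \<kappa> where "\<kappa> x = g1 x + wall x - aff p x" for x
  have p0: "aff p 0 \<le> 0" using p(1)[of 0] 1(3) by (simp add: balanced_def)
  then have snd_p: "snd p \<le> 0" by (simp add: aff_def)
  have max_affine: "max_affine (g i)" "max_affine (h i)" for i
    using 1 2 3 wall by (auto simp: g_def h_def intro: max_affine_add)
  have bal: "balanced (g i) (\<lambda>x. if i = 1 then max (h 1 x) (aff p x - 2 ^ N) else h i x)" for i N
  proof (cases "i = 1")
    case True
    have "balanced (\<lambda>x. g1 x + wall x) (\<lambda>x. max (h1 x + wall x) (aff p x - 2 ^ N))"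
    proof -
      have b: "g1 0 = 0" "h1 0 = 0" "\<And>x. 0 \<le> g1 x \<and> 0 \<le> h1 x \<and> h1 x \<le> 2 * g1 x \<and> g1 x \<le> 2 * h1 x"
        using 1(3) by (auto simp: balanced_def)
      have "0 \<le> g1 x + wall x \<and> 0 \<le> max (h1 x + wall x) (aff p x - 2 ^ N) \<and>
          max (h1 x + wall x) (aff p x - 2 ^ N) \<le> 2 * (g1 x + wall x) \<and>
          g1 x + wall x \<le> 2 * max (h1 x + wall x) (aff p x - 2 ^ N)" for x
      proof -
        have "(0 :: real) \<le> 2 ^ N" by simp
        then have "aff p x - 2 ^ N \<le> g1 x" using p(1)[of x] by linarith
        then show ?thesis using b(3)[of x] wall_nonneg[of x] by (auto simp: max_def)
      qed
      moreover have "max (h1 0 + wall 0) (aff p 0 - 2 ^ N) = 0"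
      proof -
        have "(0 :: real) \<le> 2 ^ N" by simp
        then have "aff p 0 - 2 ^ N \<le> 0" using p0 by linarith
        then show ?thesis using b by (simp add: wall_def max_absorb1)
      qed
      ultimately show ?thesis using b by (simp add: balanced_def wall_def)
    qed
    then show ?thesis using True by (simp add: g_def h_def)
  next
    case False
    then show ?thesis using 2 3 by (auto simp: g_def h_def)
  qed
  obtain L D e a b where D: "0 < D" and real: "\<And>N :: nat. realised_difference (L @ [(a, b, of_nat (D * 2 ^ N + e))]) g
      (\<lambda>i x. if i = 1 then max (h 1 x) (aff p x - 2 ^ N) else h i x)"
    using realise_capped[OF max_affine(1,2) snd_p bal] by blast
  obtain N0 :: nat where N0: "S0 \<le> real N0" using real_arch_simple by blast
  have "difference_mpc (L @ [(a, b, of_nat (D * 2 ^ N + e))]) \<in> everywhere_feasible_instances \<and>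
      (globally_asymptotically_stable (difference_mpc (L @ [(a, b, of_nat (D * 2 ^ N + e))])) \<longleftrightarrow> \<not> halts P s)"
    if N: "N \<ge> N0" and s: "code 0 s = N" for N s
  proof -
    interpret realised_difference "L @ [(a, b, of_nat (D * 2 ^ N + e))]" g
      "\<lambda>i x. if i = 1 then max (h 1 x) (aff p x - 2 ^ N) else h i x"
      by (rule real)
    have closed: "closed_loop I = capped \<kappa> \<eta> N"
    proof
      fix x
      have "g1 x + wall x - max (h1 x + wall x) (aff p x - 2 ^ N) = min (next_S x) (2 ^ N + \<kappa> x)"
        using 1(4)[of x] by (auto simp: \<kappa>_def)
      then show "closed_loop I x = capped \<kappa> \<eta> N x"
        using 2(4)[of x] 3(4)[of x] unfolding closed_loop_eq
        by (simp add: capped_def vec_eq_iff forall_3 g_def h_def)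
    qed
    have "S0 \<le> 2 ^ N"
    proof -
      have "real N0 \<le> real N" using N by simp
      also have "\<dots> \<le> 2 ^ N" by (rule less_imp_le[OF of_nat_less_two_power])
      finally show ?thesis by (rule order_trans[OF N0])
    qed
    then have vanish: "\<kappa> (vector [2 ^ N, 5 / 2 * 2 ^ N, z]) = 0" if "real \<eta> * 2 ^ N \<le> z" for z
    proof -
      have "\<eta>0 * 2 ^ N \<le> real \<eta> * 2 ^ N" using \<eta> by (intro mult_right_mono) auto
      then have "\<eta>0 * 2 ^ N \<le> z" using that by (rule order_trans)
      then have "aff p (vector [2 ^ N, 5 / 2 * 2 ^ N, z]) = g1 (vector [2 ^ N, 5 / 2 * 2 ^ N, z])"
        by (rule p(2)[OF \<open>S0 \<le> 2 ^ N\<close>])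
      then show ?thesis by (simp add: \<kappa>_def wall_def)
    qed
    have \<kappa>: "0 \<le> \<kappa> x" "4 * real C * \<bar>x $ 2 - 5 / 2 * x $ 1\<bar> \<le> \<kappa> x" for x
      using p(1)[of x] wall_nonneg[of x] unfolding \<kappa>_def wall_def[symmetric] by linarith+
    have "C \<le> \<eta>" using \<eta> by simp
    show ?thesis
      using in_class capped_stable_iff[OF \<kappa> vanish \<open>C \<le> \<eta>\<close> s] unfolding stable_iff closed by blast
  qed
  moreover have "difference_mpc (L @ [(a, b, of_nat (D * 2 ^ N + e))]) \<in> everywhere_feasible_instances" for N
    using realised_difference.in_class[OF real] .
  ultimately show ?thesis using D by blast
qed

end

section \<open>The diagonal argument\<close>

lemma (in machine) stability_of_machine:
  "\<exists>L D e a b N0. 0 < D \<and> (\<forall>N\<ge>N0. difference_mpc (L @ [(a, b, of_nat (D * 2 ^ N + e))]) \<in> everywhere_feasible_instances \<and>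
    (\<forall>s. code 0 s = N \<longrightarrow>
      (globally_asymptotically_stable (difference_mpc (L @ [(a, b, of_nat (D * 2 ^ N + e))])) \<longleftrightarrow> \<not> halts P s)))"
proof -
  from gate_constants obtain K C :: nat where
    "\<forall>\<rho>\<in>rules. \<forall>S W. misses ix \<rho> S W \<longrightarrow> \<bar>W\<bar> \<le> width * S \<longrightarrow>
      val_S \<rho> S \<le> real K * pen ix \<rho> S W \<and> val_W ix \<rho> S W \<le> real K * pen ix \<rho> S W"
    "\<forall>\<rho>\<in>rules. \<forall>S W. 0 \<le> S \<longrightarrow> \<bar>W\<bar> \<le> width * S \<longrightarrow>
      val_S \<rho> S \<le> real C * S \<and> val_W ix \<rho> S W \<le> real C * S" by blast
  then have "gadget P nr K C" by unfold_locales blast+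
  then show ?thesis by (rule gadget.realised_simulation)
qed

text \<open>The order of quantifiers carries the diagonalisation: all constants are fixed by
  \<open>P\<close> before a store is chosen, so the store may contain them. Five registers at least
  are coded, as many as the argument list has entries.\<close>

lemma program_context:
  assumes "P \<noteq> []"
  shows "\<exists>nr k A B C N0 I. 5 \<le> nr \<and> (\<forall>N s. N \<ge> N0 \<and> (\<Prod>r<nr. pr r ^ s r) = N \<longrightarrow>
    word_number (mpc_word (I N)) = A + B * grow (N - k) C \<and>
    I N \<in> everywhere_feasible_instances \<and> (globally_asymptotically_stable (I N) \<longleftrightarrow> \<not> halts P s))"
proof -
  obtain n where "registers_below n P" using registers_below_ex by blast
  then have "registers_below (max 5 n) P" by (rule registers_below_mono) simp
  then interpret machine P "max 5 n" using assms by unfold_locales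
  from stability_of_machine obtain L D e a b N1 where D: "0 < D" and
    all: "\<forall>N\<ge>N1. difference_mpc (L @ [(a, b, of_nat (D * 2 ^ N + e))]) \<in> everywhere_feasible_instances \<and>
      (\<forall>s. code 0 s = N \<longrightarrow>
        (globally_asymptotically_stable (difference_mpc (L @ [(a, b, of_nat (D * 2 ^ N + e))])) \<longleftrightarrow> \<not> halts P s))"
    by (elim exE conjE) (rule that)
  define I where "I N = difference_mpc (L @ [(a, b, of_nat (D * 2 ^ N + e))])" for N :: nat
  have "I N = difference_mpc []\<lparr>inequalities := L @ [(a, b, of_nat (D * 2 ^ N + e))]\<rparr>" for N
    by (simp add: I_def difference_mpc_def)
  from mpc_word_slot[OF D this] obtain k A B C where
    w: "\<And>N. N \<ge> k \<Longrightarrow> word_number (mpc_word (I N)) = A + B * grow (N - k) C" by blast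
  have "\<forall>N s. N \<ge> max N1 k \<and> (\<Prod>r<max 5 n. pr r ^ s r) = N \<longrightarrow>
      word_number (mpc_word (I N)) = A + B * grow (N - k) C \<and> I N \<in> everywhere_feasible_instances \<and>
      (globally_asymptotically_stable (I N) \<longleftrightarrow> \<not> halts P s)"
  proof (intro allI impI)
    fix N s
    assume N: "N \<ge> max N1 k \<and> (\<Prod>r<max 5 n. pr r ^ s r) = N"
    then have "code 0 s = N" by (simp add: code_def)
    with N w[of N] all[folded I_def]
    show "word_number (mpc_word (I N)) = A + B * grow (N - k) C \<and> I N \<in> everywhere_feasible_instances \<and>
        (globally_asymptotically_stable (I N) \<longleftrightarrow> \<not> halts P s)"
      by (metis max.bounded_iff)
  qed
  moreover have "5 \<le> max 5 n" by simp
  ultimately show ?thesis by blast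
qed

lemma undecidable:
  assumes "everywhere_feasible_instances \<subseteq> X"
  shows "\<not> decidable_on mpc_word X globally_asymptotically_stable"
proof
  assume "decidable_on mpc_word X globally_asymptotically_stable"
  then obtain f where f: "\<And>I. I \<in> X \<Longrightarrow>
      computes f [word_number (mpc_word I)] (if globally_asymptotically_stable I then 1 else 0)"
    unfolding decidable_on_def by blast
  let ?code = "\<lambda>xs. xs ! 1 + xs ! 2 * grow (context_number pr xs - xs ! 0) (xs ! 3)"
  obtain g where g: "\<And>xs. length xs = 5 \<Longrightarrow> computes g xs (?code xs)"
    using recursive_code[of pr] unfolding recursive_def by blast
  have fg: "computes (Comp f [g]) xs y" if "length xs = 5" "computes f [?code xs] y" for xs y
    using g[OF that(1)] that(2) by (auto intro: computes.comp[where ys = "[?code xs]"])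
  obtain P where P: "P \<noteq> []" "\<And>s y. computes (Comp f [g]) (map s [0..<5]) y \<Longrightarrow> halts P s \<longleftrightarrow> y \<noteq> 0"
    using program_for_recf[of "Comp f [g]" 5] by blast
  from program_context[OF P(1)] obtain nr k A B C N0 I where nr: "5 \<le> nr" and
    all: "\<forall>N s. N \<ge> N0 \<and> (\<Prod>r<nr. pr r ^ s r) = N \<longrightarrow>
      word_number (mpc_word (I N)) = A + B * grow (N - k) C \<and>
      I N \<in> everywhere_feasible_instances \<and> (globally_asymptotically_stable (I N) \<longleftrightarrow> \<not> halts P s)"
    by (elim exE conjE) (rule that)
  \<comment> \<open>The store holds the constants of the very family of instances that
    \<open>P\<close> gives rise to. Its prime code \<open>N\<close> selects a member of that family,
    and \<open>P\<close> recovers both \<open>N\<close> and the code of this member from its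
    arguments.\<close>
  define xs where "xs = [k, A, B, C, N0]"
  define s where "s r = (if r < 5 then xs ! r else 0)" for r
  define N where "N = context_number pr xs"
  have s: "map s [0..<5] = xs"
    by (rule nth_equalityI) (auto simp: s_def xs_def)
  have "(\<Prod>r<nr. pr r ^ s r) = (\<Prod>r<5. pr r ^ s r)"
    using nr by (intro prod.mono_neutral_right) (auto simp: s_def)
  also have "\<dots> = N"
    by (simp add: N_def context_number_def s_def eval_nat_numeral)
  finally have code: "(\<Prod>r<nr. pr r ^ s r) = N" .
  have "N0 \<le> N"
  proof -
    have "N0 < 2 ^ N0" by (rule less_exp)
    also have "\<dots> \<le> pr 4 ^ N0" using pr_ge_2 by (intro power_mono) auto
    also have "\<dots> \<le> N"
      by (simp add: N_def context_number_def xs_def Suc_le_eq pr_pos)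
    finally show ?thesis by simp
  qed
  with all code have I: "word_number (mpc_word (I N)) = A + B * grow (N - k) C"
      "I N \<in> everywhere_feasible_instances" "globally_asymptotically_stable (I N) \<longleftrightarrow> \<not> halts P s"
    by blast+
  have "?code xs = word_number (mpc_word (I N))"
    using I(1) by (simp add: N_def xs_def)
  moreover have "I N \<in> X" using I assms by blast
  ultimately have "computes (Comp f [g]) (map s [0..<5]) (if globally_asymptotically_stable (I N) then 1 else 0)"
    using fg[of xs] f[of "I N"] unfolding s by (simp add: xs_def)
  from P(2)[OF this] I(3) show False by (auto split: if_splits)
qed

theorem theorem12:
  shows "\<not> decidable_on mpc_word identity_weight_instances globally_asymptotically_stable \<and>
    \<not> decidable_on mpc_word everywhere_feasible_instances globally_asymptotically_stable \<and>
    (\<forall>I \<in> everywhere_feasible_instances. recursively_feasible I)"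
  using undecidable[of identity_weight_instances] undecidable[of everywhere_feasible_instances]
  by (auto simp: everywhere_feasible_instances_def recursively_feasible_def)

end
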